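(* If a Legendrian submanifold $\Lambda \subset J^1H^n$ has a spinnable linear-at-infinity generating family, then the spun Legendrian submanifold $\Lambda^s\subset J^1\mathbb R^{n+1}$ has a linear-at-infinity generating family. More generally, if $\Lambda_\theta$, $\theta\in S^1$, is generated by a spinnable loop of linear-at-infinity generating families, then the twist-spun Legendrian submanifold $\Lambda^{ts}\subset J^1\mathbb R^{n+1}$ has a linear-at-infinity generating family.
   Context: $H^n=\{x\in\mathbb R^n: x_n\ge 0\}$; $S^1=[0,2\pi]/\!\sim$. $J^1M$ has coordinates $(x,y,z)$ and contact form $dz-y\,dx$. A smooth function $f:M\times\mathbb R^N\to\mathbb R$, with variables $(x,\eta)$, such that $\mathbf 0$ is a regular value of $\partial_\eta f$, is a generating family for the Legendrian $\{(x,\partial_xf,f) : \partial_\eta f=0\}$ (also used with $M=H^n$). It is linear-at-infinity if there is a nonzero linear $A:\mathbb R^N\to\mathbb R$ with $f(x,\eta)=A(\eta)$ outside a compact subset of $M\times\mathbb R^N$. A spinnable Legendrian $\Lambda\subset J^1H^n$ is a smooth, properly embedded Legendrian submanifold that extends smoothly across $\partial J^1H^n$ by reflection: its union with its image under $(x_n,y_n)\mapsto(-x_n,-y_n)$ is a smooth Legendrian submanifold of $J^1\mathbb R^n$. A spinnable Legendrian loop is a smooth isotopy $\Lambda_\theta$, $\theta\in S^1$, of spinnable Legendrians such that a neighborhood of $\partial\Lambda_\theta$ does not vary with $\theta$. The twist-spun Legendrian $\Lambda^{ts}\subset J^1\mathbb R^{n+1}$ of a spinnable loop is the Legendrian whose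 front projection (to $(x,z)$) is parameterized as follows: if $\phi_\theta(q)=(x_1^\theta(q),\dots,x_n^\theta(q),z^\theta(q))$ are local parameterizations of the fronts of $\Lambda_\theta$, depending smoothly on $\theta$, then $\phi^{ts}(q,\theta)=(x_1^\theta(q),\dots,x_{n-1}^\theta(q),x_n^\theta(q)\cos\theta,x_n^\theta(q)\sin\theta,z^\theta(q))$ parameterizes the front of $\Lambda^{ts}$. The spun Legendrian $\Lambda^s$ is the twist-spun Legendrian of the constant loop $\Lambda_\theta=\Lambda$. A generating family $f:H^n\times\mathbb R^N\to\mathbb R$ is spinnable if extending it by $f(x_1,\dots,x_n,\eta)=f(x_1,\dots,-x_n,\eta)$ for $x_n<0$ gives a smooth function on $\mathbb R^n\times\mathbb R^N$. A spinnable loop of linear-at-infinity generating families is a smooth family $f_\theta$, $\theta\in S^1$, of spinnable generating families $H^n\times\mathbb R^N\to\mathbb R$ such that $f_\theta$ does not depend on $\theta$ in a neighborhood of $\partial H^n\times\mathbb R^N$, and such that there is a nonzero linear function $A$ with $f_\theta(x,\eta)=A(\eta)$ for all $\theta$ outside a compact subset of $H^n\times\mathbb R^N$. Spinnable (loops of) generating families generate spinnable (loops of) Legendrians. *)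

theory Defs
  imports "HOL-Analysis.Analysis"
begin

section \<open>Smooth maps\<close>

text \<open>Class \<open>C\<^sup>k\<close>, used on open sets only, where \<open>differentiable_on\<close> is differentiability in
  the usual sense.\<close>

primrec Ck_on :: "nat \<Rightarrow> 'a::real_normed_vector set \<Rightarrow> ('a \<Rightarrow> 'b::real_normed_vector) \<Rightarrow> bool" where
  "Ck_on 0 U f \<longleftrightarrow> continuous_on U f"
| "Ck_on (Suc k) U f \<longleftrightarrow>
     f differentiable_on U \<and> (\<forall>v. Ck_on k U (\<lambda>x. frechet_derivative f (at x) v))"

text \<open>Smoothness on an arbitrary subset of a Euclidean space means existence of local smooth
  extensions. This covers half-spaces (smooth up to the boundary), submanifolds and tracks of
  isotopies.\<close>

definition smooth_on :: "'a::real_normed_vector set \<Rightarrow> ('a \<Rightarrow> 'b::real_normed_vector) \<Rightarrow> bool" where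
  "smooth_on S f \<longleftrightarrow>
     (\<forall>x\<in>S. \<exists>U g. open U \<and> x \<in> U \<and> (\<forall>k. Ck_on k U g) \<and> (\<forall>y\<in>S \<inter> U. g y = f y))"

definition diffeomorphism ::
    "'a::real_normed_vector set \<Rightarrow> 'b::real_normed_vector set \<Rightarrow> ('a \<Rightarrow> 'b) \<Rightarrow> ('b \<Rightarrow> 'a) \<Rightarrow> bool" where
  "diffeomorphism S T f g \<longleftrightarrow> homeomorphism S T f g \<and> smooth_on S f \<and> smooth_on T g"


section \<open>Half-space, 1-jets, Legendrian submanifolds\<close>

text \<open>\<open>\<real>\<^sup>n\<close> is \<^typ>\<open>real^'n\<close>; the index \<open>l :: 'n\<close> plays the role of the last coordinate. A point of
  the 1-jet space is \<open>(x, y, z)\<close>.\<close>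

type_synonym 'n jet1 = "(real^'n) \<times> (real^'n) \<times> real"

definition halfspace :: "'n \<Rightarrow> (real^'n::finite) set" where
  "halfspace l = {x. 0 \<le> x $ l}"

definition reflection :: "'n \<Rightarrow> real^'n \<Rightarrow> real^'n::finite" where
  "reflection l x = (\<chi> i. if i = l then - (x $ i) else x $ i)"

text \<open>The form \<open>dz - y dx\<close> at the point \<open>p\<close>, evaluated on the tangent vector \<open>v\<close>.\<close>

definition contact_form :: "'n::finite jet1 \<Rightarrow> 'n jet1 \<Rightarrow> real" where
  "contact_form p v = snd (snd v) - fst (snd p) \<bullet> fst v"

text \<open>The contact form pulls back to zero. In all uses \<open>U\<close> is relatively open in a half-space (or
  in a product of an open set with one), so that the derivative within \<open>U\<close> is unique.\<close>

definition isotropic_on :: "'a::real_normed_vector set \<Rightarrow> ('a \<Rightarrow> 'n::finite jet1) \<Rightarrow> bool" where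
  "isotropic_on U \<psi> \<longleftrightarrow>
     (\<forall>q\<in>U. \<exists>D. (\<psi> has_derivative D) (at q within U) \<and> (\<forall>v. contact_form (\<psi> q) (D v) = 0))"

text \<open>Smooth, properly embedded Legendrian submanifolds of \<open>J\<^sup>1H\<^sup>n\<close>: closed subsets with local
  parameterizations by relatively open subsets of \<open>H\<^sup>n\<close>, whose boundary is exactly the set of
  points lying over \<open>\<partial>H\<^sup>n\<close>.\<close>

definition legendrian_submanifold :: "'n \<Rightarrow> 'n::finite jet1 set \<Rightarrow> bool" where
  "legendrian_submanifold l \<Lambda> \<longleftrightarrow>
     closed \<Lambda> \<and> \<Lambda> \<subseteq> halfspace l \<times> UNIV \<and>
     (\<forall>p\<in>\<Lambda>. \<exists>U V \<psi> \<kappa>.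
        openin (top_of_set (halfspace l)) U \<and> openin (top_of_set \<Lambda>) V \<and> p \<in> V \<and>
        diffeomorphism U V \<psi> \<kappa> \<and> isotropic_on U \<psi> \<and>
        (\<forall>q\<in>U. q $ l = 0 \<longleftrightarrow> fst (\<psi> q) $ l = 0))"

text \<open>Loops are parameterized by \<open>\<theta> \<in> \<real>\<close> and \<open>2\<pi>\<close>-periodic. Smooth isotopy means that the track
  of the family is smoothly trivial, compatibly with \<open>\<theta>\<close>; the trivialization itself need not be
  periodic.\<close>

definition track :: "(real \<Rightarrow> 'n::finite jet1 set) \<Rightarrow> (real \<times> 'n jet1) set" where
  "track \<Lambda> = Sigma UNIV \<Lambda>"

definition legendrian_loop :: "'n \<Rightarrow> (real \<Rightarrow> 'n::finite jet1 set) \<Rightarrow> bool" where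
  "legendrian_loop l \<Lambda> \<longleftrightarrow>
     (\<forall>\<theta>. legendrian_submanifold l (\<Lambda> \<theta>)) \<and>
     (\<forall>\<theta>. \<Lambda> (\<theta> + 2 * pi) = \<Lambda> \<theta>) \<and>
     (\<exists>\<Phi> \<Xi>. diffeomorphism (UNIV \<times> \<Lambda> 0) (track \<Lambda>) (\<lambda>(\<theta>, p). (\<theta>, \<Phi> \<theta> p)) \<Xi>)"


section \<open>Twist-spinning\<close>

text \<open>\<open>\<real>\<^sup>n\<^sup>+\<^sup>1\<close> is \<^typ>\<open>real^('n option)\<close>, the additional coordinate having index \<^term>\<open>None\<close>. The linear
  isometric embedding \<open>page l \<theta>\<close> sends \<open>x\<close> to the point with coordinates \<open>x\<^sub>i\<close> \<open>(i \<noteq> l)\<close>,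
  \<open>x\<^sub>l cos \<theta>\<close> and \<open>x\<^sub>l sin \<theta>\<close>.\<close>

definition page :: "'n \<Rightarrow> real \<Rightarrow> real^'n \<Rightarrow> real^('n::finite option)" where
  "page l \<theta> x = (\<chi> i. case i of
       Some j \<Rightarrow> (if j = l then x $ l * cos \<theta> else x $ j)
     | None \<Rightarrow> x $ l * sin \<theta>)"

text \<open>Local parameterizations \<open>\<psi> (\<theta>, q)\<close> of \<open>\<Lambda> \<theta>\<close> depending smoothly on \<open>\<theta> \<in> J\<close>. Their
  \<open>(x, z)\<close>-components parameterize the fronts.\<close>

definition loop_chart ::
    "'n \<Rightarrow> (real \<Rightarrow> 'n::finite jet1 set) \<Rightarrow> real set \<Rightarrow> (real^'n) set \<Rightarrow> (real \<times> (real^'n) \<Rightarrow> 'n jet1) \<Rightarrow> bool"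
  where
  "loop_chart l \<Lambda> J U \<psi> \<longleftrightarrow>
     open J \<and> openin (top_of_set (halfspace l)) U \<and>
     (\<exists>W \<kappa>. openin (top_of_set (track \<Lambda>)) W \<and>
        diffeomorphism (J \<times> U) W (\<lambda>(\<theta>, q). (\<theta>, \<psi> (\<theta>, q))) \<kappa>)"

text \<open>\<open>\<Psi>\<close> is the Legendrian lift of the twist-spun front: it has the prescribed \<open>(x, z)\<close>-components
  and the contact form vanishes along it. Where the front of \<open>\<Lambda> \<theta>\<close> is an immersion these two
  properties determine \<open>\<Psi>\<close>, and they imply the clause on the \<open>y\<close>-components, which says that the
  1-jets in the image of \<open>\<Psi>\<close> restrict, on the page of angle \<open>\<theta>\<close>, to the 1-jets in \<open>\<Lambda> \<theta>\<close>. That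
  clause is needed because the front of a Legendrian may fail to be an immersion on an open set, as
  happens for a piece of a cotangent fibre.\<close>

definition spin_lift ::
    "'n \<Rightarrow> real set \<Rightarrow> (real^'n) set \<Rightarrow> (real \<times> (real^'n) \<Rightarrow> 'n jet1)
      \<Rightarrow> (real \<times> (real^'n) \<Rightarrow> 'n::finite option jet1) \<Rightarrow> bool"
  where
  "spin_lift l J U \<psi> \<Psi> \<longleftrightarrow>
     smooth_on (J \<times> U) \<Psi> \<and> isotropic_on (J \<times> U) \<Psi> \<and>
     (\<forall>\<theta>\<in>J. \<forall>q\<in>U.
        case (\<psi> (\<theta>, q), \<Psi> (\<theta>, q)) of ((x, y, z), (X, Y, Z)) \<Rightarrow>
          X = page l \<theta> x \<and> Z = z \<and> (\<forall>v. Y \<bullet> page l \<theta> v = y \<bullet> v))"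

text \<open>Stated for arbitrary loops; it is meant for spinnable ones (symmetric doubles smooth, constant
  near the boundary), and loops generated by \<open>spinnable_family_loop\<close> below are such. Over the axis
  \<open>x\<^sub>l = 0\<close> the lift is determined by continuity.\<close>

definition twist_spun :: "'n \<Rightarrow> (real \<Rightarrow> 'n::finite jet1 set) \<Rightarrow> 'n option jet1 set" where
  "twist_spun l \<Lambda> =
     {P. \<exists>J U \<psi> \<Psi>. loop_chart l \<Lambda> J U \<psi> \<and> spin_lift l J U \<psi> \<Psi> \<and> P \<in> \<Psi> ` (J \<times> U)}"

definition spun :: "'n \<Rightarrow> 'n::finite jet1 set \<Rightarrow> 'n option jet1 set" where
  "spun l \<Lambda> = twist_spun l (\<lambda>\<theta>. \<Lambda>)"


section \<open>Generating families\<close>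

text \<open>Families are functions on \<open>M \<times> \<real>\<^sup>N\<close> with \<open>M = UNIV\<close> or \<open>M = halfspace l\<close>; values outside
  \<open>M\<close> are irrelevant. At points of \<open>\<partial>H\<^sup>n\<close> the derivatives in \<open>x\<close> are taken within \<open>H\<^sup>n\<close>.\<close>

definition base_grad ::
    "(real^'m) set \<Rightarrow> ((real^'m) \<times> (real^'N) \<Rightarrow> real) \<Rightarrow> (real^'m::finite) \<times> (real^'N::finite) \<Rightarrow> real^'m"
  where
  "base_grad M f p =
     (\<chi> i. frechet_derivative (\<lambda>x. f (x, snd p)) (at (fst p) within M) (axis i 1))"

definition fibre_grad ::
    "((real^'m) \<times> (real^'N) \<Rightarrow> real) \<Rightarrow> (real^'m::finite) \<times> (real^'N::finite) \<Rightarrow> real^'N" where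
  "fibre_grad f p = (\<chi> j. frechet_derivative (\<lambda>\<eta>. f (fst p, \<eta>)) (at (snd p)) (axis j 1))"

definition regular_value ::
    "'a::real_normed_vector set \<Rightarrow> ('a \<Rightarrow> 'b::real_normed_vector) \<Rightarrow> 'b \<Rightarrow> bool" where
  "regular_value S g c \<longleftrightarrow>
     (\<forall>p\<in>S. g p = c \<longrightarrow> (\<exists>D. (g has_derivative D) (at p within S) \<and> surj D))"

definition generating_family ::
    "(real^'m) set \<Rightarrow> ((real^'m::finite) \<times> (real^'N::finite) \<Rightarrow> real) \<Rightarrow> bool" where
  "generating_family M f \<longleftrightarrow>
     smooth_on (M \<times> UNIV) f \<and> regular_value (M \<times> UNIV) (fibre_grad f) 0"

definition generated_legendrian ::
    "(real^'m) set \<Rightarrow> ((real^'m::finite) \<times> (real^'N::finite) \<Rightarrow> real) \<Rightarrow> 'm jet1 set" where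
  "generated_legendrian M f =
     {(x, base_grad M f (x, \<eta>), f (x, \<eta>)) | x \<eta>. x \<in> M \<and> fibre_grad f (x, \<eta>) = 0}"

definition linear_at_infinity ::
    "(real^'m) set \<Rightarrow> ((real^'m::finite) \<times> (real^'N::finite) \<Rightarrow> real) \<Rightarrow> bool" where
  "linear_at_infinity M f \<longleftrightarrow>
     (\<exists>A K. linear A \<and> A \<noteq> (\<lambda>\<eta>. 0) \<and> compact K \<and> K \<subseteq> M \<times> UNIV \<and>
        (\<forall>x\<in>M. \<forall>\<eta>. (x, \<eta>) \<notin> K \<longrightarrow> f (x, \<eta>) = A \<eta>))"

definition spinnable_family ::
    "'n \<Rightarrow> ((real^'n::finite) \<times> (real^'N::finite) \<Rightarrow> real) \<Rightarrow> bool" where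
  "spinnable_family l f \<longleftrightarrow>
     generating_family (halfspace l) f \<and>
     smooth_on UNIV (\<lambda>(x, \<eta>). if 0 \<le> x $ l then f (x, \<eta>) else f (reflection l x, \<eta>))"

text \<open>The linear function \<open>A\<close> and the compact set \<open>K\<close> are common to all \<open>\<theta>\<close>.\<close>

definition spinnable_family_loop ::
    "'n \<Rightarrow> (real \<Rightarrow> (real^'n::finite) \<times> (real^'N::finite) \<Rightarrow> real) \<Rightarrow> bool" where
  "spinnable_family_loop l f \<longleftrightarrow>
     smooth_on (UNIV \<times> (halfspace l \<times> UNIV)) (\<lambda>(\<theta>, p). f \<theta> p) \<and>
     (\<forall>\<theta>. \<forall>p\<in>halfspace l \<times> UNIV. f (\<theta> + 2 * pi) p = f \<theta> p) \<and>
     (\<forall>\<theta>. spinnable_family l (f \<theta>)) \<and>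
     (\<exists>W. open W \<and> {x. x $ l = 0} \<times> UNIV \<subseteq> W \<and>
        (\<forall>\<theta>. \<forall>p\<in>W \<inter> (halfspace l \<times> UNIV). f \<theta> p = f 0 p)) \<and>
     (\<exists>A K. linear A \<and> A \<noteq> (\<lambda>\<eta>. 0) \<and> compact K \<and> K \<subseteq> halfspace l \<times> UNIV \<and>
        (\<forall>\<theta>. \<forall>x\<in>halfspace l. \<forall>\<eta>. (x, \<eta>) \<notin> K \<longrightarrow> f \<theta> (x, \<eta>) = A \<eta>))"

end

theory Submission
  imports Defs
begin

text \<open>
  The family on \<open>\<real>\<^sup>n\<^sup>+\<^sup>1\<close> is obtained by rotating: on the page of angle \<open>\<theta>\<close> it is \<open>f\<^sub>\<theta>\<close>. It is smooth
  off the binding \<open>x\<^sub>l = 0\<close> by polar coordinates, and near the binding, where \<open>f\<^sub>\<theta>\<close> does not depend on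
  \<open>\<theta>\<close>, because an even smooth function of \<open>r\<close> is a smooth function of \<open>(r cos \<theta>, r sin \<theta>)\<close>.

  Its 1-jets restrict on every page to those of \<open>f\<^sub>\<theta>\<close>, so only the covector component normal to the
  page is at stake. Any chart of the loop can be tested along curves of critical points that are
  transverse to the pages: these exist by the implicit function theorem, and along them \<open>dz - y dx\<close>
  equals \<open>x\<^sub>l\<close> times the normal derivative of the family. Off the binding this determines the normal
  component of a Legendrian lift; near the binding it vanishes, and on the binding it is recovered
  by continuity.
\<close>

section \<open>Calculus of smooth maps\<close>

text \<open>Charts and lifts in \<open>twist_spun\<close> are arbitrary, so every lift has to be
  identified and some lift has to be built through every generated point. The obstacle is that a
  point of \<open>\<Lambda> \<theta>\<close> does not remember its fibre variable: several critical
  \<eta> may give the same jet, so no smooth lift of a chart to critical points is at hand. Hence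
  \<eta> is chosen pointwise, without continuity, and only curves are transported: from critical
  points to jets, and by the inverse chart to parameters. The quantity found there is the contact
  form on the \<theta>-derivative of the chart, which is smooth and independent of the choice of
  \<eta>. Dividing it by \<open>x $ l\<close> is harmless: critical points lie in the compact set
  \<open>K\<close>, which yields one \<delta> such that all those with
  \<open>x $ l < \<delta>\<close> lie where the loop is constant. At a point of the binding isotropy
  does not see the normal component, as the rotation has speed 0; the limit argument needs critical
  points off the binding that converge to the given one, and they exist because the fibre gradient
  has vanishing radial derivative there.\<close>

lemma frechet_derivative_cong_open:
  assumes "open U" "\<And>x. x \<in> U \<Longrightarrow> f x = g x" "x \<in> U"
  shows "frechet_derivative f (at x) = frechet_derivative g (at x)"
proof -
  have "(f has_derivative D) (at x) \<longleftrightarrow> (g has_derivative D) (at x)" for D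
    using assms has_derivative_transform_within_open[of f D x UNIV U g]
      has_derivative_transform_within_open[of g D x UNIV U f] by auto
  then show ?thesis
    unfolding frechet_derivative_def by simp
qed

lemma Ck_on_cong:
  assumes "open U" "\<And>x. x \<in> U \<Longrightarrow> f x = g x" "Ck_on k U f"
  shows "Ck_on k U g"
  using assms(2,3)
proof (induction k arbitrary: f g)
  case 0
  then show ?case using continuous_on_cong[of U U f g] by auto
next
  case (Suc k)
  have "g differentiable_on U"
    using Suc.prems unfolding differentiable_on_def
    by (metis Ck_on.simps(2) differentiable_on_def differentiable_transform_within zero_less_one)
  moreover have "Ck_on k U (\<lambda>x. frechet_derivative g (at x) v)" for v
  proof (rule Suc.IH)
    show "frechet_derivative f (at x) v = frechet_derivative g (at x) v" if "x \<in> U" for x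
      using frechet_derivative_cong_open[OF assms(1) Suc.prems(1) that] by simp
  qed (use Suc.prems in auto)
  ultimately show ?case by simp
qed

lemma Ck_on_subset: "Ck_on k U f \<Longrightarrow> V \<subseteq> U \<Longrightarrow> Ck_on k V f"
  by (induction k arbitrary: f) (auto intro: continuous_on_subset differentiable_on_subset)

lemma Ck_on_SucD: "Ck_on (Suc k) U f \<Longrightarrow> Ck_on k U f"
proof (induction k arbitrary: f)
  case 0
  then show ?case by (auto intro: differentiable_imp_continuous_on)
next
  case (Suc k)
  then show ?case by (metis Ck_on.simps(2))
qed

text \<open>Uniqueness of the derivative lets an explicit formula \<open>D\<close> stand in for
  \<open>frechet_derivative\<close>, which is defined by choice. The inductions on the order of
  differentiability pass through this form.\<close>

lemma Ck_on_SucI: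
  assumes "open U" "\<And>x. x \<in> U \<Longrightarrow> (f has_derivative D x) (at x)"
    and "\<And>v. Ck_on k U (\<lambda>x. D x v)"
  shows "Ck_on (Suc k) U f"
proof -
  have "f differentiable_on U"
    using assms by (meson differentiable_def differentiable_at_imp_differentiable_on)
  moreover have "Ck_on k U (\<lambda>x. frechet_derivative f (at x) v)" for v
    using assms(1) _ assms(3)[of v]
    by (rule Ck_on_cong) (metis assms(2) frechet_derivative_at)
  ultimately show ?thesis by simp
qed

lemma Ck_on_Suc_has_derivative:
  assumes "Ck_on (Suc k) U f" "open U" "x \<in> U"
  shows "(f has_derivative frechet_derivative f (at x)) (at x)"
proof -
  have "f differentiable (at x within U)"
    using assms unfolding Ck_on.simps differentiable_on_def by blast
  then show ?thesis
    using assms by (metis at_within_open frechet_derivative_works)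
qed

lemma Ck_on_local:
  assumes "\<And>x. x \<in> U \<Longrightarrow> \<exists>V. open V \<and> x \<in> V \<and> Ck_on k V f"
  shows "Ck_on k U f"
  using assms
proof (induction k arbitrary: f)
  case 0
  then show ?case
    by (metis Ck_on.simps(1) continuous_on_eq_continuous_at continuous_at_imp_continuous_on)
next
  case (Suc k)
  have "f differentiable_on U"
  proof (rule differentiable_at_imp_differentiable_on)
    fix x assume "x \<in> U"
    then obtain V where "open V" "x \<in> V" "Ck_on (Suc k) V f" using Suc.prems by blast
    then show "f differentiable at x"
      by (meson Ck_on_Suc_has_derivative differentiable_def)
  qed
  moreover have "Ck_on k U (\<lambda>x. frechet_derivative f (at x) v)" for v
  proof (rule Suc.IH)
    show "\<exists>V. open V \<and> x \<in> V \<and> Ck_on k V (\<lambda>x. frechet_derivative f (at x) v)" if "x \<in> U" for x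
      using Suc.prems[OF that] by auto
  qed
  ultimately show ?case by simp
qed

section \<open>Closure of C^k under algebraic operations and composition\<close>

lemma Ck_on_const: "Ck_on k U (\<lambda>x. c)"
proof (induction k arbitrary: c)
  case (Suc k)
  then show ?case by simp
qed auto

lemma Ck_on_bounded_linear: "bounded_linear L \<Longrightarrow> Ck_on k U L"
proof (cases k)
  case (Suc j)
  assume L: "bounded_linear L"
  have "frechet_derivative L (at x) = L" for x
    using L by (metis bounded_linear_imp_has_derivative frechet_derivative_at)
  with L show ?thesis
    by (simp add: Suc Ck_on_const bounded_linear_imp_differentiable_on)
qed (auto intro: linear_continuous_on)

lemma Ck_on_compose_bounded_linear:
  assumes "bounded_linear L" "open U" "Ck_on k U f"
  shows "Ck_on k U (\<lambda>x. L (f x))"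
  using assms(3)
proof (induction k arbitrary: f)
  case 0
  then show ?case using assms(1) by (auto intro: bounded_linear.continuous_on)
next
  case (Suc k)
  show ?case
  proof (rule Ck_on_SucI[OF assms(2)])
    show "((\<lambda>x. L (f x)) has_derivative (\<lambda>v. L (frechet_derivative f (at x) v))) (at x)"
      if "x \<in> U" for x
      using Ck_on_Suc_has_derivative[OF Suc.prems assms(2) that]
      by (rule bounded_linear.has_derivative[OF assms(1)])
    show "Ck_on k U (\<lambda>x. L (frechet_derivative f (at x) v))" for v
      using Suc by simp
  qed
qed

lemma Ck_on_add:
  assumes "open U" "Ck_on k U f" "Ck_on k U g"
  shows "Ck_on k U (\<lambda>x. f x + g x)"
  using assms(2,3)
proof (induction k arbitrary: f g)
  case 0
  then show ?case by (auto intro: continuous_intros)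
next
  case (Suc k)
  show ?case
  proof (rule Ck_on_SucI[OF assms(1)])
    show "((\<lambda>x. f x + g x) has_derivative
        (\<lambda>v. frechet_derivative f (at x) v + frechet_derivative g (at x) v)) (at x)"
      if "x \<in> U" for x
      using Ck_on_Suc_has_derivative[OF Suc.prems(1) assms(1) that]
        Ck_on_Suc_has_derivative[OF Suc.prems(2) assms(1) that] by (rule has_derivative_add)
  qed (use Suc in simp)
qed

lemma Ck_on_sum:
  assumes "open U" "\<And>i. i \<in> I \<Longrightarrow> Ck_on k U (f i)"
  shows "Ck_on k U (\<lambda>x. \<Sum>i\<in>I. f i x)"
  using assms(2)
  by (induction I rule: infinite_finite_induct) (auto intro: Ck_on_const Ck_on_add[OF assms(1)])

lemma Ck_on_bounded_bilinear:
  assumes "bounded_bilinear B" "open U" "Ck_on k U f" "Ck_on k U g"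
  shows "Ck_on k U (\<lambda>x. B (f x) (g x))"
  using assms(3,4)
proof (induction k arbitrary: f g)
  case 0
  then show ?case using assms(1) by (auto intro: bounded_bilinear.continuous_on)
next
  case (Suc k)
  show ?case
  proof (rule Ck_on_SucI[OF assms(2)])
    show "((\<lambda>x. B (f x) (g x)) has_derivative
        (\<lambda>v. B (f x) (frechet_derivative g (at x) v) + B (frechet_derivative f (at x) v) (g x))) (at x)"
      if "x \<in> U" for x
      using Ck_on_Suc_has_derivative[OF Suc.prems(1) assms(2) that]
        Ck_on_Suc_has_derivative[OF Suc.prems(2) assms(2) that]
      by (rule bounded_bilinear.FDERIV[OF assms(1)])
    show "Ck_on k U (\<lambda>x. B (f x) (frechet_derivative g (at x) v) + B (frechet_derivative f (at x) v) (g x))"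
      for v
      using Suc.prems Ck_on_SucD[OF Suc.prems(1)] Ck_on_SucD[OF Suc.prems(2)]
      by (intro Ck_on_add[OF assms(2)] Suc.IH) auto
  qed
qed

lemma Ck_on_Pair:
  assumes "open U" "Ck_on k U f" "Ck_on k U g"
  shows "Ck_on k U (\<lambda>x. (f x, g x))"
proof -
  have "Ck_on k U (\<lambda>x. (f x, 0) + (0, g x))"
    using assms by (intro Ck_on_add Ck_on_compose_bounded_linear[where L="\<lambda>a. (a, 0)"]
        Ck_on_compose_bounded_linear[where L="\<lambda>a. (0, a)"] bounded_linear_intros) auto
  then show ?thesis by simp
qed

text \<open>Used to replace a derivative in a variable direction by derivatives in the fixed basis
  directions.\<close>

lemma linear_sum_Basis:
  fixes L :: "'a::euclidean_space \<Rightarrow> 'b::real_vector"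
  assumes "linear L" shows "(\<Sum>b\<in>Basis. (w \<bullet> b) *\<^sub>R L b) = L w"
proof -
  have "L w = L (\<Sum>b\<in>Basis. (w \<bullet> b) *\<^sub>R b)"
    by (simp only: euclidean_representation)
  also have "\<dots> = (\<Sum>b\<in>Basis. (w \<bullet> b) *\<^sub>R L b)"
    by (simp only: linear_sum[OF assms] linear_cmul[OF assms])
  finally show ?thesis by simp
qed

text \<open>\<open>Ck_on\<close> speaks of derivatives in a fixed direction only, whereas the chain
  rule evaluates the derivative of \<open>g\<close> in a direction that moves with \<open>x\<close>.
  Expanding that direction in \<open>Basis\<close> gives sums of products of C^k functions, to which
  the induction hypothesis applies; hence the Euclidean middle space.\<close>

lemma Ck_on_compose:
  fixes g :: "'b::euclidean_space \<Rightarrow> 'c::real_normed_vector"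
  assumes "open U" "open V" "f ` U \<subseteq> V" "Ck_on k U f" "Ck_on k V g"
  shows "Ck_on k U (\<lambda>x. g (f x))"
  using assms(4,5)
proof (induction k arbitrary: g)
  case 0
  then show ?case using assms(3) by (auto intro: continuous_on_compose2)
next
  case (Suc k)
  let ?D = "\<lambda>x v. \<Sum>b\<in>Basis. (frechet_derivative f (at x) v \<bullet> b) *\<^sub>R frechet_derivative g (at (f x)) b"
  show ?case
  proof (rule Ck_on_SucI[OF assms(1)])
    fix x assume x: "x \<in> U"
    let ?g' = "frechet_derivative g (at (f x))"
    have g: "(g has_derivative ?g') (at (f x))"
      using Suc.prems assms x by (intro Ck_on_Suc_has_derivative[of k V]) auto
    have lin: "linear ?g'" using g has_derivative_linear by blast
    show "((\<lambda>x. g (f x)) has_derivative ?D x) (at x)"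
      unfolding linear_sum_Basis[OF lin]
      by (rule has_derivative_compose[OF Ck_on_Suc_has_derivative[OF Suc.prems(1) assms(1) x] g])
  next
    fix v
    show "Ck_on k U (\<lambda>x. ?D x v)"
    proof (intro Ck_on_sum[OF assms(1)] Ck_on_bounded_bilinear[OF bounded_bilinear_scaleR] assms(1)
        Suc.IH Ck_on_compose_bounded_linear[OF bounded_linear_inner_left])
    qed (use Suc.prems Ck_on_SucD[OF Suc.prems(1)] in auto)
  qed
qed

section \<open>Infinitely differentiable maps on open sets\<close>

definition Cinf_on :: "'a::real_normed_vector set \<Rightarrow> ('a \<Rightarrow> 'b::real_normed_vector) \<Rightarrow> bool" where
  "Cinf_on U f \<longleftrightarrow> (\<forall>k. Ck_on k U f)"

named_theorems Cinf_intros

lemma Cinf_on_const [Cinf_intros]: "Cinf_on U (\<lambda>x. c)"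
  by (simp add: Cinf_on_def Ck_on_const)

lemma Cinf_on_id [Cinf_intros]: "Cinf_on U (\<lambda>x. x)"
  by (simp add: Cinf_on_def Ck_on_bounded_linear bounded_linear_ident)

lemma Cinf_on_bounded_linear:
  assumes "bounded_linear L" "open U" "Cinf_on U f" shows "Cinf_on U (\<lambda>x. L (f x))"
  using assms by (simp add: Cinf_on_def Ck_on_compose_bounded_linear)

lemma Cinf_on_fst [Cinf_intros]: "open U \<Longrightarrow> Cinf_on U f \<Longrightarrow> Cinf_on U (\<lambda>x. fst (f x))"
  by (rule Cinf_on_bounded_linear[OF bounded_linear_fst])

lemma Cinf_on_snd [Cinf_intros]: "open U \<Longrightarrow> Cinf_on U f \<Longrightarrow> Cinf_on U (\<lambda>x. snd (f x))"
  by (rule Cinf_on_bounded_linear[OF bounded_linear_snd])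

lemma Cinf_on_vec_nth [Cinf_intros]:
  "open U \<Longrightarrow> Cinf_on U f \<Longrightarrow> Cinf_on U (\<lambda>x. f x $ i)"
  by (rule Cinf_on_bounded_linear[OF bounded_linear_vec_nth])

lemma Cinf_on_Pair [Cinf_intros]:
  "open U \<Longrightarrow> Cinf_on U f \<Longrightarrow> Cinf_on U g \<Longrightarrow> Cinf_on U (\<lambda>x. (f x, g x))"
  by (simp add: Cinf_on_def Ck_on_Pair)

lemma Cinf_on_add [Cinf_intros]:
  "open U \<Longrightarrow> Cinf_on U f \<Longrightarrow> Cinf_on U g \<Longrightarrow> Cinf_on U (\<lambda>x. f x + g x)"
  by (simp add: Cinf_on_def Ck_on_add)

lemma Cinf_on_sum [Cinf_intros]:
  "open U \<Longrightarrow> (\<And>i. i \<in> I \<Longrightarrow> Cinf_on U (f i)) \<Longrightarrow> Cinf_on U (\<lambda>x. \<Sum>i\<in>I. f i x)"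
  by (simp add: Cinf_on_def Ck_on_sum)

lemma Cinf_on_bilinear:
  assumes "bounded_bilinear B" "open U" "Cinf_on U f" "Cinf_on U g"
  shows "Cinf_on U (\<lambda>x. B (f x) (g x))"
  using assms by (simp add: Cinf_on_def Ck_on_bounded_bilinear)

lemmas Cinf_on_mult [Cinf_intros] = Cinf_on_bilinear[OF bounded_bilinear_mult]
  and Cinf_on_scaleR [Cinf_intros] = Cinf_on_bilinear[OF bounded_bilinear_scaleR]
  and Cinf_on_inner [Cinf_intros] = Cinf_on_bilinear[OF bounded_bilinear_inner]

lemma Cinf_on_minus [Cinf_intros]: "open U \<Longrightarrow> Cinf_on U f \<Longrightarrow> Cinf_on U (\<lambda>x. - f x)"
  by (rule Cinf_on_bounded_linear[OF bounded_linear_minus[OF bounded_linear_ident]])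

lemma Cinf_on_diff [Cinf_intros]:
  "open U \<Longrightarrow> Cinf_on U f \<Longrightarrow> Cinf_on U g \<Longrightarrow> Cinf_on U (\<lambda>x. f x - g x)"
  using Cinf_on_add[of U f "\<lambda>x. - g x"] Cinf_on_minus[of U g] by simp

lemma Cinf_on_compose:
  fixes g :: "'b::euclidean_space \<Rightarrow> 'c::real_normed_vector"
  assumes "open U" "open V" "f ` U \<subseteq> V" "Cinf_on U f" "Cinf_on V g"
  shows "Cinf_on U (\<lambda>x. g (f x))"
  using assms by (auto simp: Cinf_on_def intro: Ck_on_compose)

lemma Cinf_on_vec_lambda [Cinf_intros]:
  fixes f :: "'a::real_normed_vector \<Rightarrow> 'i::finite \<Rightarrow> real"
  assumes "open U" "\<And>i. Cinf_on U (\<lambda>x. f x i)"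
  shows "Cinf_on U (\<lambda>x. \<chi> i. f x i)"
proof -
  have "(\<lambda>x. \<chi> i. f x i) = (\<lambda>x. \<Sum>i\<in>UNIV. f x i *\<^sub>R axis i 1)"
    by (simp add: vec_eq_iff fun_eq_iff axis_def if_distrib[of "(*) _"] cong: if_cong)
  then show ?thesis using assms by (simp add: Cinf_intros)
qed

lemma Cinf_on_cong:
  assumes "open U" "\<And>x. x \<in> U \<Longrightarrow> f x = g x" "Cinf_on U f" shows "Cinf_on U g"
  using assms Ck_on_cong unfolding Cinf_on_def by blast

lemma Cinf_on_subset: "Cinf_on U f \<Longrightarrow> V \<subseteq> U \<Longrightarrow> Cinf_on V f"
  using Ck_on_subset unfolding Cinf_on_def by blast

lemma Cinf_on_has_derivative:
  assumes "Cinf_on U f" "open U" "x \<in> U"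
  shows "(f has_derivative frechet_derivative f (at x)) (at x)"
  using assms Ck_on_Suc_has_derivative unfolding Cinf_on_def by blast

lemma Cinf_on_frechet_derivative:
  "Cinf_on U f \<Longrightarrow> Cinf_on U (\<lambda>x. frechet_derivative f (at x) v)"
  unfolding Cinf_on_def using Ck_on.simps(2) by blast

lemma Cinf_on_continuous: "Cinf_on U f \<Longrightarrow> continuous_on U f"
  unfolding Cinf_on_def using Ck_on.simps(1) by blast

text \<open>Bootstrapping, for functions such as \<open>inverse\<close> and \<open>sqrt\<close>
  whose derivative is an expression in the function itself: C^k of \<open>f\<close> gives C^k of the
  derivative, hence C^(k+1) of \<open>f\<close>.\<close>

lemma Cinf_on_has_derivatives:
  assumes "open U" "\<And>x. x \<in> U \<Longrightarrow> (f has_derivative D x) (at x)"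
    and "\<And>k v. Ck_on k U f \<Longrightarrow> Ck_on k U (\<lambda>x. D x v)"
  shows "Cinf_on U f"
  unfolding Cinf_on_def
proof
  fix k show "Ck_on k U f"
  proof (induction k)
    case 0
    show ?case using assms(1,2)
      by (metis Ck_on.simps(1) continuous_at_imp_continuous_on has_derivative_continuous)
  next
    case (Suc k)
    show ?case by (rule Ck_on_SucI[OF assms(1,2) assms(3)[OF Suc]])
  qed
qed

section \<open>Smoothness of the elementary functions behind polar coordinates\<close>

lemma Ck_on_real_mult:
  fixes f g :: "'a::real_normed_vector \<Rightarrow> real"
  assumes "open U" "Ck_on k U f" "Ck_on k U g" shows "Ck_on k U (\<lambda>x. f x * g x)"
  by (rule Ck_on_bounded_bilinear[OF bounded_bilinear_mult assms])

lemma Cinf_on_inverse: "Cinf_on (- {0}) (inverse :: real \<Rightarrow> real)"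
proof (rule Cinf_on_has_derivatives)
  show "(inverse has_derivative (\<lambda>v. - 1 * (inverse x * inverse x) * v)) (at x)"
    if "x \<in> - {0}" for x :: real
    using that by (auto intro!: derivative_eq_intros)
  show "Ck_on k (- {0}) (\<lambda>x::real. - 1 * (inverse x * inverse x) * v)" if "Ck_on k (- {0}) (inverse::real\<Rightarrow>real)"
    for k v
    using that by (intro Ck_on_real_mult Ck_on_const) auto
qed auto

lemma Cinf_on_sqrt: "Cinf_on {0<..} sqrt"
proof (rule Cinf_on_has_derivatives)
  show "(sqrt has_derivative (\<lambda>v. inverse (sqrt x) * (v / 2))) (at x)" if "x \<in> {0<..}" for x
  proof -
    have "(sqrt has_real_derivative inverse (sqrt x) / 2) (at x)"
      using that by (intro DERIV_real_sqrt) auto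
    then show ?thesis
      unfolding has_field_derivative_def by (rule has_derivative_eq_rhs) (simp add: fun_eq_iff)
  qed
  show "Ck_on k {0<..} (\<lambda>x. inverse (sqrt x) * (v / 2))" if "Ck_on k {0<..} sqrt" for k v
  proof (intro Ck_on_real_mult Ck_on_const)
    show "Ck_on k {0<..} (\<lambda>x. inverse (sqrt x))"
      using that Cinf_on_inverse by (rule_tac Ck_on_compose[of _ "- {0}" sqrt]) (auto simp: Cinf_on_def)
  qed auto
qed auto

lemma Cinf_on_sqrt_compose:
  fixes f :: "'a::real_normed_vector \<Rightarrow> real"
  assumes "open U" "Cinf_on U f" "\<And>x. x \<in> U \<Longrightarrow> 0 < f x" shows "Cinf_on U (\<lambda>x. sqrt (f x))"
  using assms by (intro Cinf_on_compose[OF _ _ _ _ Cinf_on_sqrt]) auto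

lemma Cinf_on_divide [Cinf_intros]:
  fixes f g :: "'a::real_normed_vector \<Rightarrow> real"
  assumes "open U" "Cinf_on U f" "Cinf_on U g" "\<And>x. x \<in> U \<Longrightarrow> g x \<noteq> 0"
  shows "Cinf_on U (\<lambda>x. f x / g x)"
  unfolding divide_inverse using assms
  by (intro Cinf_on_mult Cinf_on_compose[OF _ _ _ _ Cinf_on_inverse]) auto

lemma Cinf_on_arctan: "Cinf_on UNIV arctan"
proof (rule Cinf_on_has_derivatives)
  show "(arctan has_derivative (\<lambda>v. v / (1 + x * x))) (at x)" for x
    by (auto intro!: derivative_eq_intros simp: field_simps power2_eq_square)
  have "Cinf_on UNIV (\<lambda>x::real. v / (1 + x * x))" for v
    by (intro Cinf_intros) (auto simp: add_nonneg_eq_0_iff)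
  then show "Ck_on k UNIV (\<lambda>x::real. v / (1 + x * x))" for k v
    by (simp add: Cinf_on_def)
qed auto

text \<open>Joint induction, since each of the two functions is up to sign the derivative of the
  other.\<close>

lemma Ck_on_cos_sin: "Ck_on k UNIV (cos :: real \<Rightarrow> real) \<and> Ck_on k UNIV (sin :: real \<Rightarrow> real)"
proof (induction k)
  case (Suc k)
  have "Ck_on (Suc k) UNIV (cos :: real \<Rightarrow> real)"
  proof (rule Ck_on_SucI)
    show "(cos has_derivative (\<lambda>v. sin x * (- v))) (at x)" for x :: real
      by (auto intro!: derivative_eq_intros)
    show "Ck_on k UNIV (\<lambda>x. sin x * (- v))" for v :: real
      using Suc by (intro Ck_on_real_mult Ck_on_const) auto
  qed auto
  moreover have "Ck_on (Suc k) UNIV (sin :: real \<Rightarrow> real)"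
  proof (rule Ck_on_SucI)
    show "(sin has_derivative (\<lambda>v. cos x * v)) (at x)" for x :: real
      by (auto intro!: derivative_eq_intros)
    show "Ck_on k UNIV (\<lambda>x. cos x * v)" for v :: real
      using Suc by (intro Ck_on_real_mult Ck_on_const) auto
  qed auto
  ultimately show ?case ..
qed (auto intro: continuous_intros)

lemma Cinf_on_cos [Cinf_intros]:
  fixes f :: "'a::real_normed_vector \<Rightarrow> real"
  shows "open U \<Longrightarrow> Cinf_on U f \<Longrightarrow> Cinf_on U (\<lambda>x. cos (f x))"
  by (rule Cinf_on_compose[where V=UNIV]) (auto simp: Cinf_on_def Ck_on_cos_sin)

lemma Cinf_on_sin [Cinf_intros]:
  fixes f :: "'a::real_normed_vector \<Rightarrow> real"
  shows "open U \<Longrightarrow> Cinf_on U f \<Longrightarrow> Cinf_on U (\<lambda>x. sin (f x))"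
  by (rule Cinf_on_compose[where V=UNIV]) (auto simp: Cinf_on_def Ck_on_cos_sin)

lemma Cinf_on_local:
  assumes "\<And>x. x \<in> U \<Longrightarrow> \<exists>V. open V \<and> x \<in> V \<and> Cinf_on V f"
  shows "Cinf_on U f"
  unfolding Cinf_on_def
proof (intro allI Ck_on_local)
  fix k x assume "x \<in> U"
  from assms[OF this] show "\<exists>V. open V \<and> x \<in> V \<and> Ck_on k V f"
    unfolding Cinf_on_def by fast
qed

lemma smooth_on_def':
  "smooth_on S f \<longleftrightarrow>
     (\<forall>x\<in>S. \<exists>U g. open U \<and> x \<in> U \<and> Cinf_on U g \<and> (\<forall>y\<in>S \<inter> U. g y = f y))"
  unfolding smooth_on_def Cinf_on_def ..

section \<open>Smoothness on arbitrary subsets by local extensions\<close>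

lemma smooth_onE:
  assumes "smooth_on S f" "x \<in> S"
  obtains U g where "open U" "x \<in> U" "Cinf_on U g" "\<And>y. y \<in> S \<Longrightarrow> y \<in> U \<Longrightarrow> g y = f y"
proof -
  from assms(1)[unfolded smooth_on_def', rule_format, OF assms(2)]
  obtain U g where "open U" "x \<in> U" "Cinf_on U g" "\<forall>y\<in>S \<inter> U. g y = f y" by (elim exE conjE)
  then show ?thesis using that by simp
qed

lemma smooth_on_openI: "open U \<Longrightarrow> Cinf_on U f \<Longrightarrow> smooth_on U f"
  unfolding smooth_on_def' by (intro ballI exI[of _ U] exI[of _ f]) simp

lemma smooth_on_open:
  assumes "open U" shows "smooth_on U f \<longleftrightarrow> Cinf_on U f"
proof
  assume f: "smooth_on U f"
  have "Ck_on k U f" for k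
  proof (rule Ck_on_local)
    fix x assume "x \<in> U"
    from smooth_onE[OF f this] obtain V g where V: "open V" "x \<in> V" "Cinf_on V g"
      and g: "\<And>y. y \<in> U \<Longrightarrow> y \<in> V \<Longrightarrow> g y = f y" by blast
    have "Cinf_on (U \<inter> V) f"
      using V assms g by (intro Cinf_on_cong[of _ g f] Cinf_on_subset[OF V(3)]) auto
    then show "\<exists>V. open V \<and> x \<in> V \<and> Ck_on k V f"
      using V assms \<open>x \<in> U\<close> by (intro exI[of _ "U \<inter> V"]) (auto simp: Cinf_on_def)
  qed
  then show "Cinf_on U f" by (simp add: Cinf_on_def)
qed (rule smooth_on_openI[OF assms])

lemma smooth_onI:
  assumes "\<And>x. x \<in> S \<Longrightarrow> \<exists>U g. open U \<and> x \<in> U \<and> Cinf_on U g \<and> (\<forall>y. y \<in> S \<longrightarrow> y \<in> U \<longrightarrow> g y = f y)"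
  shows "smooth_on S f"
  using assms unfolding smooth_on_def' by (simp add: Ball_def imp_conjL)

lemma smooth_on_subset:
  assumes "smooth_on S f" "T \<subseteq> S" shows "smooth_on T f"
proof (rule smooth_onI)
  fix x assume "x \<in> T"
  then have "x \<in> S" using assms(2) by blast
  from smooth_onE[OF assms(1) this] obtain U g where "open U" "x \<in> U" "Cinf_on U g"
    and "\<And>y. y \<in> S \<Longrightarrow> y \<in> U \<Longrightarrow> g y = f y" by blast
  then show "\<exists>U g. open U \<and> x \<in> U \<and> Cinf_on U g \<and> (\<forall>y. y \<in> T \<longrightarrow> y \<in> U \<longrightarrow> g y = f y)"
    using assms(2) by (intro exI[of _ U] exI[of _ g]) auto
qed

lemma smooth_on_compose:
  fixes g :: "'b::euclidean_space \<Rightarrow> 'c::real_normed_vector"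
  assumes "smooth_on S f" "smooth_on T g" "f ` S \<subseteq> T"
  shows "smooth_on S (\<lambda>x. g (f x))"
  unfolding smooth_on_def'
proof
  fix x assume x: "x \<in> S"
  from smooth_onE[OF assms(1) x] obtain U f' where U: "open U" "x \<in> U" "Cinf_on U f'"
    and f': "\<And>y. y \<in> S \<Longrightarrow> y \<in> U \<Longrightarrow> f' y = f y" by blast
  have "f x \<in> T" using x assms(3) by blast
  from smooth_onE[OF assms(2) this] obtain V g' where V: "open V" "f x \<in> V" "Cinf_on V g'"
    and g': "\<And>y. y \<in> T \<Longrightarrow> y \<in> V \<Longrightarrow> g' y = g y" by blast
  \<comment> \<open>The preimage is taken under the extension \<open>f'\<close>, not under
    \<open>f\<close>: off \<open>S\<close> the extension may leave the domain of
    \<open>g'\<close>.\<close>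
  define W where "W = U \<inter> f' -` V"
  have "open W"
    unfolding W_def using U V Cinf_on_continuous continuous_open_preimage by blast
  moreover have "Cinf_on W (\<lambda>x. g' (f' x))"
  proof (rule Cinf_on_compose)
    show "Cinf_on W f'" by (rule Cinf_on_subset[OF U(3)]) (simp add: W_def)
  qed (use \<open>open W\<close> V in \<open>auto simp: W_def\<close>)
  moreover have "x \<in> W" using x U V f' by (auto simp: W_def)
  ultimately show "\<exists>U h. open U \<and> x \<in> U \<and> Cinf_on U h \<and> (\<forall>y\<in>S \<inter> U. h y = g (f y))"
    using f' g' assms(3) by (intro exI[of _ W] exI[of _ "\<lambda>x. g' (f' x)"]) (auto simp: W_def)
qed

lemma smooth_on_cong: "smooth_on S f \<Longrightarrow> (\<And>x. x \<in> S \<Longrightarrow> f x = g x) \<Longrightarrow> smooth_on S g"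
  unfolding smooth_on_def' by simp

lemma smooth_on_Pair:
  assumes "smooth_on S f" "smooth_on S g" shows "smooth_on S (\<lambda>x. (f x, g x))"
  unfolding smooth_on_def'
proof
  fix x assume x: "x \<in> S"
  from smooth_onE[OF assms(1) x] obtain U f' where U: "open U" "x \<in> U" "Cinf_on U f'"
    and f': "\<And>y. y \<in> S \<Longrightarrow> y \<in> U \<Longrightarrow> f' y = f y" by blast
  from smooth_onE[OF assms(2) x] obtain V g' where V: "open V" "x \<in> V" "Cinf_on V g'"
    and g': "\<And>y. y \<in> S \<Longrightarrow> y \<in> V \<Longrightarrow> g' y = g y" by blast
  have "Cinf_on (U \<inter> V) (\<lambda>x. (f' x, g' x))"
    using U V by (intro Cinf_intros Cinf_on_subset[OF U(3)] Cinf_on_subset[OF V(3)]) auto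
  then show "\<exists>U h. open U \<and> x \<in> U \<and> Cinf_on U h \<and> (\<forall>y\<in>S \<inter> U. h y = (f y, g y))"
    using f' g' U V by (intro exI[of _ "U \<inter> V"] exI[of _ "\<lambda>x. (f' x, g' x)"]) auto
qed

lemma smooth_on_Cinf_compose:
  fixes g :: "'b::euclidean_space \<Rightarrow> 'c::real_normed_vector"
  assumes "smooth_on S f" "Cinf_on UNIV g" shows "smooth_on S (\<lambda>x. g (f x))"
  using smooth_on_compose[OF assms(1), of UNIV g] assms(2) by (simp add: smooth_on_open)

lemma smooth_on_fst: "smooth_on S fst"
  by (rule smooth_on_subset[OF smooth_on_openI[OF open_UNIV Cinf_on_fst[OF open_UNIV Cinf_on_id]] subset_UNIV])

lemma smooth_on_snd: "smooth_on S snd"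
  by (rule smooth_on_subset[OF smooth_on_openI[OF open_UNIV Cinf_on_snd[OF open_UNIV Cinf_on_id]] subset_UNIV])

lemma smooth_on_id: "smooth_on S (\<lambda>v. v)"
  by (rule smooth_on_subset[OF smooth_on_openI[OF open_UNIV Cinf_on_id] subset_UNIV])

lemma smooth_on_compose_snd: "smooth_on S f \<Longrightarrow> smooth_on (UNIV \<times> S) (\<lambda>v. f (snd v))"
  for f :: "'b::euclidean_space \<Rightarrow> 'c::real_normed_vector"
  by (rule smooth_on_compose[OF smooth_on_snd]) auto

lemma smooth_on_continuous:
  assumes "smooth_on S f" shows "continuous_on S f"
proof (clarsimp simp: continuous_on_eq_continuous_within)
  fix x assume x: "x \<in> S"
  from smooth_onE[OF assms x] obtain U g where U: "open U" "x \<in> U" "Cinf_on U g"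
    and g: "\<And>y. y \<in> S \<Longrightarrow> y \<in> U \<Longrightarrow> g y = f y" by blast
  have "continuous (at x within S) g"
    using U Cinf_on_continuous continuous_on_eq_continuous_at continuous_at_imp_continuous_at_within
    by blast
  moreover have "eventually (\<lambda>y. g y = f y) (at x within S)"
    using U g by (auto simp: eventually_at_topological)
  ultimately show "continuous (at x within S) f"
    using g[OF x U(2)] unfolding continuous_within by (metis (mono_tags, lifting) Lim_transform_eventually)
qed

section \<open>Derivatives within a set and one-sided velocities of curves\<close>

lemma has_derivative_within_extension:
  assumes "open U" "x \<in> U" "x \<in> S" "\<And>y. y \<in> S \<Longrightarrow> y \<in> U \<Longrightarrow> g y = f y"
    and "(g has_derivative D) (at x)"
  shows "(f has_derivative D) (at x within S)"
proof -
  obtain d where d: "d > 0" "ball x d \<subseteq> U" using assms(1,2) open_contains_ball by blast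
  show ?thesis
  proof (rule has_derivative_transform_within[OF has_derivative_at_withinI[OF assms(5)] d(1) assms(3)])
    fix y assume "y \<in> S" "dist y x < d"
    then show "g y = f y" using d(2) assms(4) by (auto simp: dist_commute subset_eq)
  qed
qed

lemma smooth_on_has_derivative:
  assumes "smooth_on S f" "x \<in> S"
  obtains D where "(f has_derivative D) (at x within S)"
proof -
  from smooth_onE[OF assms] obtain U g where U: "open U" "x \<in> U" "Cinf_on U g"
    and g: "\<And>y. y \<in> S \<Longrightarrow> y \<in> U \<Longrightarrow> g y = f y" by blast
  show ?thesis
    using that has_derivative_within_extension[OF U(1,2) assms(2) g Cinf_on_has_derivative[OF U(3,1,2)]]
    by blast
qed

lemma has_vector_derivative_compose_within:
  assumes "(c has_vector_derivative c') (at t within S)" "(f has_derivative D) (at (c t) within T)"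
    and "c ` S \<subseteq> T"
  shows "((\<lambda>s. f (c s)) has_vector_derivative D c') (at t within S)"
  using vector_derivative_diff_chain_within[OF assms(1) has_derivative_subset[OF assms(2,3)]]
  by (simp add: o_def)

text \<open>Curves that start on the boundary of a half-space may run for \<open>t \<ge> 0\<close>
  only, so velocities at 0 are compared as one-sided derivatives; 0 is a limit point of the
  half-open interval.\<close>

lemma has_vector_derivative_unique_right:
  assumes "(f has_vector_derivative a) (at 0 within {0..<\<epsilon>})" "(f has_vector_derivative b) (at 0 within {0..<\<epsilon>})"
    and "(\<epsilon>::real) > 0"
  shows "a = b"
proof (rule vector_derivative_unique_within[OF _ assms(1,2)])
  have "(0::real) islimpt {0..<\<epsilon>}"
    using assms(3) by (simp add: islimpt_Ico)
  then show "at 0 within {0..<\<epsilon>} \<noteq> bot"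
    by (simp add: trivial_limit_within)
qed

text \<open>Differentiation under the integral sign. The Leibniz rule wants the derivative as a
  continuous map into the bounded linear functions, whence the packaging by \<open>Blinfun\<close>;
  in finite dimension its continuity can be checked on basis vectors.\<close>

lemma has_derivative_integral_param:
  fixes m :: "'a::euclidean_space \<times> real \<Rightarrow> real"
  assumes m: "Cinf_on UNIV m"
  shows "((\<lambda>x. integral {0..1} (\<lambda>t. m (x, t))) has_derivative
    (\<lambda>v. integral {0..1} (\<lambda>t. frechet_derivative m (at (x, t)) (v, 0)))) (at x)"
proof -
  let ?D = "\<lambda>x t v. frechet_derivative m (at (x, t)) (v, 0)"
  let ?B = "\<lambda>x t. Blinfun (?D x t)"
  have D: "((\<lambda>x. m (x, t)) has_derivative ?D x t) (at x)" for x t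
    using Cinf_on_has_derivative[OF m]
    by (intro has_derivative_compose[of "\<lambda>x. (x, t)" "\<lambda>v. (v, 0)" x UNIV m])
      (auto intro!: derivative_eq_intros)
  have B: "blinfun_apply (?B x t) = ?D x t" for x t
    by (rule bounded_linear_Blinfun_apply[OF has_derivative_bounded_linear[OF D]])
  have B': "blinfun_apply (Blinfun (\<lambda>v. frechet_derivative m (at p) (v, 0))) =
      (\<lambda>v. frechet_derivative m (at p) (v, 0))" for p
    using B[of "fst p" "snd p"] by simp
  have cont: "continuous_on S (\<lambda>(x, t). ?B x t)" for S
  proof (rule continuous_on_blinfun_componentwise)
    fix i :: 'a
    have "continuous_on S (\<lambda>p. frechet_derivative m (at p) (i, 0))"
      using Cinf_on_continuous[OF Cinf_on_frechet_derivative[OF m]] continuous_on_subset by blast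
    then show "continuous_on S (\<lambda>p. blinfun_apply (case p of (x, t) \<Rightarrow> ?B x t) i)"
      by (simp add: case_prod_unfold B')
  qed
  have pair: "continuous_on S (Pair x)" for S :: "real set" and x :: 'a
    by (rule continuous_on_Pair[OF continuous_on_const continuous_on_id])
  have cont1: "continuous_on S (?B x)" for S x
    using continuous_on_compose2[OF cont[of UNIV], of S "Pair x"] pair by auto
  have cont2: "continuous_on S (\<lambda>t. m (x, t))" for S x
    using continuous_on_compose2[OF Cinf_on_continuous[OF m], of S "Pair x"] pair by auto
  have "((\<lambda>x. integral (cbox 0 1) (\<lambda>t. m (x, t))) has_derivative
      blinfun_apply (integral (cbox 0 1) (?B x))) (at x within UNIV)"
    by (rule leibniz_rule) (use D B cont cont2 in \<open>auto intro!: integrable_continuous_real\<close>)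
  moreover have "blinfun_apply (integral (cbox 0 1) (?B x)) v = integral (cbox 0 1) (\<lambda>t. ?D x t v)" for v
    by (subst blinfun_apply_integral) (auto intro!: integrable_continuous_real cont1 simp: B)
  ultimately show ?thesis
    unfolding cbox_interval by (auto intro: has_derivative_eq_rhs)
qed

text \<open>A directional derivative of the integral is the integral of a directional derivative of
  \<open>m\<close>, which is again smooth. So the induction runs over all integrands at
  once.\<close>

lemma Cinf_on_integral_param:
  fixes m :: "'a::euclidean_space \<times> real \<Rightarrow> real"
  assumes "Cinf_on UNIV m"
  shows "Cinf_on UNIV (\<lambda>x. integral {0..1} (\<lambda>t. m (x, t)))"
proof -
  have "Ck_on k UNIV (\<lambda>x. integral {0..1} (\<lambda>t. m (x, t)))" for k
    using assms
  proof (induction k arbitrary: m)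
    case 0
    show ?case
      unfolding Ck_on.simps
      by (rule continuous_at_imp_continuous_on)
        (blast intro: has_derivative_continuous[OF has_derivative_integral_param[OF 0]])
  next
    case (Suc k)
    show ?case
      by (rule Ck_on_SucI[OF open_UNIV has_derivative_integral_param[OF Suc.prems]])
        (rule Suc.IH[OF Cinf_on_frechet_derivative[OF Suc.prems], of "(_, 0)"])
  qed
  then show ?thesis by (simp add: Cinf_on_def)
qed

text \<open>The inverse function theorem for \<open>(t, s) \<mapsto> (t, H (t, s))\<close>. Since
  the partial derivative of \<open>H\<close> in \<open>s\<close> at the origin is the identity, the
  derivative of this map there is unipotent, with inverse
  \<open>(t, s) \<mapsto> (t, s - ?D (t, 0))\<close>. The curve consists of the second components of
  the preimages of \<open>(t, 0)\<close>.\<close>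

lemma implicit_curve:
  fixes H :: "real \<times> 'b::euclidean_space \<Rightarrow> 'b"
  assumes H: "Cinf_on UNIV H" and H0: "H (0, 0) = 0"
    and id: "\<And>s. frechet_derivative H (at (0, 0)) (0, s) = s"
  obtains \<sigma> \<sigma>' \<epsilon> where "\<epsilon> > 0" "\<sigma> 0 = 0" "(\<sigma> has_vector_derivative \<sigma>') (at 0)"
    "\<And>t. \<bar>t\<bar> < \<epsilon> \<Longrightarrow> H (t, \<sigma> t) = 0"
proof -
  let ?T = "\<lambda>p. (fst p, H p)"
  let ?T' = "\<lambda>p v. (fst v, frechet_derivative H (at p) v)"
  let ?D = "frechet_derivative H (at (0, 0))"
  have H': "(H has_derivative frechet_derivative H (at p)) (at p)" for p
    using Cinf_on_has_derivative[OF H] by simp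
  have T': "(?T has_derivative ?T' p) (at p)" for p
    by (intro has_derivative_Pair H' has_derivative_fst has_derivative_ident)
  have B: "blinfun_apply (Blinfun (?T' p)) = ?T' p" for p
    by (rule bounded_linear_Blinfun_apply[OF has_derivative_bounded_linear[OF T']])
  have lin: "linear ?D" using H' has_derivative_linear by blast
  have D: "?D (a, b) = ?D (a, 0) + b" for a b
    using linear_add[OF lin, of "(a, 0)" "(0, b)"] id by simp
  have "linear (\<lambda>v. (fst v, snd v - ?D (fst v, 0)))"
  proof (rule linearI)
    show "(fst (u + v), snd (u + v) - ?D (fst (u + v), 0)) =
        (fst u, snd u - ?D (fst u, 0)) + (fst v, snd v - ?D (fst v, 0))" for u v
      using linear_add[OF lin, of "(fst u, 0)" "(fst v, 0)"] by simp
    show "(fst (c *\<^sub>R v), snd (c *\<^sub>R v) - ?D (fst (c *\<^sub>R v), 0)) =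
        c *\<^sub>R (fst v, snd v - ?D (fst v, 0))" for c v
      using linear_cmul[OF lin, of c "(fst v, 0)"] by (simp add: algebra_simps)
  qed
  then have I: "blinfun_apply (Blinfun (\<lambda>v. (fst v, snd v - ?D (fst v, 0)))) =
      (\<lambda>v. (fst v, snd v - ?D (fst v, 0)))"
    by (intro bounded_linear_Blinfun_apply) (simp add: linear_conv_bounded_linear)
  have inv: "Blinfun (\<lambda>v. (fst v, snd v - ?D (fst v, 0))) o\<^sub>L Blinfun (?T' (0, 0)) = id_blinfun"
  proof (rule blinfun_eqI)
    fix v :: "real \<times> 'b"
    show "blinfun_apply (Blinfun (\<lambda>v. (fst v, snd v - ?D (fst v, 0))) o\<^sub>L Blinfun (?T' (0, 0))) v
        = blinfun_apply id_blinfun v"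
      using D[of "fst v" "snd v"] by (simp add: I B)
  qed
  have cont: "continuous_on UNIV (\<lambda>p. Blinfun (?T' p))"
    by (rule continuous_on_blinfun_componentwise)
      (auto simp: B intro!: continuous_intros Cinf_on_continuous[OF Cinf_on_frechet_derivative[OF H]])
  obtain U' V g g' where V: "open V" "?T (0, 0) \<in> V" "homeomorphism U' V ?T g" "(0, 0) \<in> U'"
    and g': "\<And>y. y \<in> V \<Longrightarrow> (g has_derivative (g' y)) (at y)"
  proof (rule inverse_function_theorem[of UNIV ?T "\<lambda>p. Blinfun (?T' p)" "(0, 0)"
      "Blinfun (\<lambda>v. (fst v, snd v - ?D (fst v, 0)))", OF open_UNIV _ cont UNIV_I inv])
    show "(?T has_derivative blinfun_apply (Blinfun (?T' p))) (at p)" for p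
      using T' B by simp
  qed blast
  have V0: "(0, 0) \<in> V" using V(2) H0 by simp
  obtain \<epsilon> where \<epsilon>: "\<epsilon> > 0" "ball (0, 0) \<epsilon> \<subseteq> V" using V(1) V0 open_contains_ball by blast
  have tV: "(t, 0) \<in> V" if "\<bar>t\<bar> < \<epsilon>" for t
    using \<epsilon>(2) that by (auto simp: dist_Pair_Pair subset_eq)
  show ?thesis
  proof
    show "\<epsilon> > 0" by (rule \<epsilon>)
    have "g (0, 0) = (0, 0)"
      using homeomorphism_apply1[OF V(3,4)] H0 by simp
    then show "snd (g (0, 0)) = 0" by simp
    have "((\<lambda>t. g (t, 0)) has_vector_derivative g' (0, 0) (1, 0)) (at 0)"
      by (rule has_vector_derivative_compose_within[of "\<lambda>t. (t, 0)" "(1, 0)" 0 UNIV g "g' (0, 0)" UNIV])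
        (use g'[OF V0] in \<open>auto intro!: derivative_eq_intros\<close>)
    from has_vector_derivative_compose_within[OF this bounded_linear_imp_has_derivative[OF bounded_linear_snd]]
    show "((\<lambda>t. snd (g (t, 0))) has_vector_derivative snd (g' (0, 0) (1, 0))) (at 0)"
      by blast
    \<comment> \<open>Comparing first components in \<open>?T (g (t, 0)) = (t, 0)\<close> gives
      \<open>fst (g (t, 0)) = t\<close>; the second components are then the claim.\<close>
    show "H (t, snd (g (t, 0))) = 0" if "\<bar>t\<bar> < \<epsilon>" for t
      using homeomorphism_apply2[OF V(3) tV[OF that]] by (metis fst_conv prod.collapse snd_conv)
  qed
qed

section \<open>Even functions of the last coordinate and polar coordinates\<close>

text \<open>The quotient map of the rotation about the binding, with the half-space as model of the
  quotient: the last coordinate becomes the distance to the binding.\<close>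

definition unspin :: "'n \<Rightarrow> real^('n option) \<Rightarrow> real^'n::finite" where
  "unspin l X = (\<chi> i. if i = l then sqrt ((X $ Some l)\<^sup>2 + (X $ None)\<^sup>2) else X $ Some i)"

definition refl_fst :: "'n \<Rightarrow> (real^'n) \<times> 'b \<Rightarrow> (real^'n::finite) \<times> 'b" where
  "refl_fst l p = (reflection l (fst p), snd p)"

text \<open>The components that the rotation leaves alone. The entry 0 makes the result invariant
  under the reflection.\<close>

definition drop_last :: "'n \<Rightarrow> real^('n option) \<Rightarrow> real^'n::finite" where
  "drop_last l V = (\<chi> i. if i = l then 0 else V $ Some i)"

lemma refl_fst_linear: "linear (refl_fst l :: (real^'n::finite) \<times> 'b::real_vector \<Rightarrow> _)"
  by (rule linearI) (auto simp: refl_fst_def reflection_def vec_eq_iff algebra_simps)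

lemma sum_option: "(\<Sum>i\<in>UNIV. f i) = f None + (\<Sum>j\<in>UNIV. f (Some j))"
  for f :: "'n::finite option \<Rightarrow> 'a::comm_monoid_add"
  by (simp add: UNIV_option_conv sum.reindex)

text \<open>The symmetry is differentiated by the chain rule. The factor \<open>c\<close> lets one
  statement serve even functions (1) and odd ones (-1).\<close>

lemma even_frechet_derivative:
  fixes g :: "(real^'n::finite) \<times> 'b::euclidean_space \<Rightarrow> real"
  assumes g: "Cinf_on UNIV g" and ev: "\<And>p. g (refl_fst l p) = c * g p"
  shows "frechet_derivative g (at (refl_fst l p)) (refl_fst l v) = c * frechet_derivative g (at p) v"
proof -
  have d: "(g has_derivative frechet_derivative g (at p)) (at p)" for p
    using Cinf_on_has_derivative[OF g] by simp
  have "(refl_fst l has_derivative refl_fst l) (at p)" for p :: "(real^'n) \<times> 'b"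
    using refl_fst_linear linear_imp_has_derivative by blast
  then have "((\<lambda>p. g (refl_fst l p)) has_derivative (\<lambda>v. frechet_derivative g (at (refl_fst l p)) (refl_fst l v))) (at p)"
    by (rule has_derivative_compose[OF _ d])
  moreover have "((\<lambda>p. g (refl_fst l p)) has_derivative (\<lambda>v. c * frechet_derivative g (at p) v)) (at p)"
    unfolding ev by (rule has_derivative_mult_right[OF d])
  ultimately show ?thesis using has_derivative_unique by metis
qed

text \<open>Hadamard's lemma for \<open>g1\<close>, the derivative of \<open>g\<close> in the last
  coordinate. As \<open>g\<close> is even, \<open>g1\<close> is odd and vanishes on the binding, so
  integrating its derivative along the segment from the binding pulls out the last coordinate as a
  factor. The quotient inherits evenness from \<open>g2\<close>, which is what allows
  iteration.\<close>

lemma even_quotient: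
  fixes g :: "(real^'n::finite) \<times> 'b::euclidean_space \<Rightarrow> real"
  assumes g: "Cinf_on UNIV g" and ev: "\<And>p. g (refl_fst l p) = g p"
  obtains h where "Cinf_on UNIV h" "\<And>p. h (refl_fst l p) = h p"
    "\<And>p. frechet_derivative g (at p) (axis l 1, 0) = fst p $ l * h p"
proof -
  let ?e = "(axis l 1, 0) :: (real^'n) \<times> 'b"
  define g1 where "g1 = (\<lambda>p. frechet_derivative g (at p) ?e)"
  define g2 where "g2 = (\<lambda>p. frechet_derivative g1 (at p) ?e)"
  \<comment> \<open>\<open>S (p, t)\<close> multiplies the last coordinate of \<open>p\<close> by
    \<open>t\<close>; for \<open>t = 0\<close> it is the projection to the binding.\<close>
  define S where "S = (\<lambda>(p :: (real^'n) \<times> 'b, t). p + ((t - 1) * fst p $ l) *\<^sub>R ?e)"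
  define h where "h = (\<lambda>p. integral {0..1} (\<lambda>t. g2 (S (p, t))))"
  have g1: "Cinf_on UNIV g1" unfolding g1_def by (rule Cinf_on_frechet_derivative[OF g])
  have g2: "Cinf_on UNIV g2" unfolding g2_def by (rule Cinf_on_frechet_derivative[OF g1])
  have e: "refl_fst l ?e = - ?e"
    by (auto simp: refl_fst_def reflection_def vec_eq_iff axis_def)
  have odd1: "g1 (refl_fst l p) = (- 1) * g1 p" for p
  proof -
    have "frechet_derivative g (at (refl_fst l p)) (- ?e) = frechet_derivative g (at p) ?e"
      using even_frechet_derivative[OF g, of l 1 p ?e] ev e by simp
    moreover have "linear (frechet_derivative g (at (refl_fst l p)))"
      using Cinf_on_has_derivative[OF g] has_derivative_linear by blast
    ultimately show ?thesis
      unfolding g1_def using linear_neg[of _ ?e] by fastforce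
  qed
  have even2: "g2 (refl_fst l p) = g2 p" for p
  proof -
    have "frechet_derivative g1 (at (refl_fst l p)) (- ?e) = - frechet_derivative g1 (at p) ?e"
      using even_frechet_derivative[OF g1 odd1, of p ?e] e by simp
    moreover have "linear (frechet_derivative g1 (at (refl_fst l p)))"
      using Cinf_on_has_derivative[OF g1] has_derivative_linear by blast
    ultimately show ?thesis
      unfolding g2_def using linear_neg[of _ ?e] by fastforce
  qed
  have S: "Cinf_on UNIV S"
    unfolding S_def case_prod_unfold by (intro Cinf_intros open_UNIV)
  have "Cinf_on UNIV (\<lambda>q. g2 (S q))"
    using S g2 by (rule Cinf_on_compose[OF open_UNIV open_UNIV subset_UNIV])
  then have h: "Cinf_on UNIV h"
    unfolding h_def by (rule Cinf_on_integral_param)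
  have "S (refl_fst l p, t) = refl_fst l (S (p, t))" for p t
    by (auto simp: S_def refl_fst_def reflection_def vec_eq_iff axis_def algebra_simps)
  then have h_even: "h (refl_fst l p) = h p" for p
    unfolding h_def by (simp add: even2)
  have "g1 p = fst p $ l * h p" for p
  proof -
    have "((\<lambda>t. g1 (S (p, t))) has_vector_derivative fst p $ l * g2 (S (p, t))) (at t within {0..1})" for t
    proof -
      have "((\<lambda>t. S (p, t)) has_vector_derivative (fst p $ l) *\<^sub>R ?e) (at t within {0..1})"
        unfolding S_def by (auto intro!: derivative_eq_intros)
      moreover have d: "(g1 has_derivative frechet_derivative g1 (at (S (p, t)))) (at (S (p, t)))"
        using Cinf_on_has_derivative[OF g1] by simp
      ultimately have "((\<lambda>t. g1 (S (p, t))) has_vector_derivative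
          frechet_derivative g1 (at (S (p, t))) ((fst p $ l) *\<^sub>R ?e)) (at t within {0..1})"
        by (rule has_vector_derivative_compose_within) simp
      then show ?thesis
        by (simp only: g2_def linear_cmul[OF has_derivative_linear[OF d]] real_scaleR_def)
    qed
    then have "((\<lambda>t. fst p $ l * g2 (S (p, t))) has_integral (g1 (S (p, 1)) - g1 (S (p, 0)))) {0..1}"
      by (intro fundamental_theorem_of_calculus) auto
    moreover have "S (p, 1) = p" by (simp add: S_def zero_prod_def)
    \<comment> \<open>An odd function vanishes at the fixed points of the reflection.\<close>
    moreover have "refl_fst l (S (p, 0)) = S (p, 0)"
      by (simp add: S_def refl_fst_def reflection_def vec_eq_iff axis_def prod_eq_iff)
    then have "g1 (S (p, 0)) = 0" using odd1[of "S (p, 0)"] by simp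
    ultimately have "integral {0..1} (\<lambda>t. fst p $ l * g2 (S (p, t))) = g1 p"
      by (auto dest: integral_unique)
    then show ?thesis unfolding h_def by simp
  qed
  then show ?thesis using that h h_even unfolding g1_def by blast
qed

text \<open>The differential of the radius has the radius as denominator, but the last partial
  derivative of \<open>g\<close> has it as a factor. The two cancel, and the resulting formula makes
  sense, and remains true, on the binding.\<close>

lemma has_derivative_unspin:
  fixes g :: "(real^'n::finite) \<times> 'b::euclidean_space \<Rightarrow> real"
  assumes g: "Cinf_on UNIV g"
    and h: "\<And>p. frechet_derivative g (at p) (axis l 1, 0) = fst p $ l * h p"
  shows "((\<lambda>(X, \<eta>). g (unspin l X, \<eta>)) has_derivative
    (\<lambda>v. frechet_derivative g (at (unspin l (fst q), snd q)) (drop_last l (fst v), snd v) +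
      h (unspin l (fst q), snd q) *
        (fst q $ Some l * fst v $ Some l + fst q $ None * fst v $ None))) (at q)"
    (is "(?G has_derivative ?G') _")
proof -
  define p where "p = (unspin l (fst q), snd q)"
  let ?D = "frechet_derivative g (at p)"
  define r where "r = (\<lambda>X :: real^('n option). sqrt ((X $ Some l)\<^sup>2 + (X $ None)\<^sup>2))"
  have D: "(g has_derivative ?D) (at p)" using Cinf_on_has_derivative[OF g] by simp
  have lin: "linear ?D" by (rule has_derivative_linear[OF D])
  have unspin: "unspin l X = drop_last l X + r X *\<^sub>R axis l 1" for X
    by (simp add: unspin_def drop_last_def r_def vec_eq_iff axis_def)
  have drop_lin: "linear (drop_last l)"
    by (rule linearI) (auto simp: drop_last_def vec_eq_iff)
  have D_split: "?D (a + c *\<^sub>R axis l 1, w) = ?D (a, w) + c * (fst p $ l * h p)" for a c w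
    using linear_add[OF lin, of "(a, w)" "c *\<^sub>R (axis l 1, 0)"] linear_cmul[OF lin, of c "(axis l 1, 0)"]
    by (simp add: h)
  have pl: "fst p $ l = r (fst q)" by (simp add: p_def unspin_def r_def)
  show ?thesis
  proof (cases "r (fst q) = 0")
    case False
    have pos: "0 < (fst q $ Some l)\<^sup>2 + (fst q $ None)\<^sup>2"
      using False unfolding r_def
      by (metis add_nonneg_nonneg less_le real_sqrt_zero zero_le_power2)
    have sq: "((\<lambda>X. (X $ Some l)\<^sup>2 + (X $ None)\<^sup>2) has_derivative
        (\<lambda>V. 2 * (fst q $ Some l * V $ Some l + fst q $ None * V $ None))) (at (fst q))"
      by (auto intro!: derivative_eq_intros bounded_linear_imp_has_derivative bounded_linear_vec_nth
          simp: algebra_simps)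
    have halve: "inverse c / 2 * (2 * w) = w / c" for c w :: real
      by (simp add: field_simps)
    from has_derivative_compose[OF sq DERIV_real_sqrt[OF pos, unfolded has_field_derivative_def], unfolded halve]
    have "(r has_derivative (\<lambda>V. (fst q $ Some l * V $ Some l + fst q $ None * V $ None) / r (fst q)))
        (at (fst q))"
      unfolding r_def .
    then have r': "((\<lambda>q. r (fst q)) has_derivative
        (\<lambda>v. (fst q $ Some l * fst v $ Some l + fst q $ None * fst v $ None) / r (fst q))) (at q)"
      by (rule has_derivative_compose[OF has_derivative_fst[OF has_derivative_ident]])
    have drop': "((\<lambda>q :: _ \<times> 'b. drop_last l (fst q)) has_derivative (\<lambda>v. drop_last l (fst v))) (at q)"
      using drop_lin by (intro has_derivative_compose[OF has_derivative_fst[OF has_derivative_ident]]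
          linear_imp_has_derivative)
    have "((\<lambda>q. (drop_last l (fst q) + r (fst q) *\<^sub>R axis l 1, snd q)) has_derivative
        (\<lambda>v. (drop_last l (fst v) + ((fst q $ Some l * fst v $ Some l + fst q $ None * fst v $ None)
          / r (fst q)) *\<^sub>R axis l 1, snd v))) (at q)"
      by (intro has_derivative_Pair has_derivative_add has_derivative_scaleR_left drop' r'
          has_derivative_snd has_derivative_ident)
    then have "((\<lambda>q. (unspin l (fst q), snd q)) has_derivative
        (\<lambda>v. (drop_last l (fst v) + ((fst q $ Some l * fst v $ Some l + fst q $ None * fst v $ None)
          / r (fst q)) *\<^sub>R axis l 1, snd v))) (at q)"
      by (simp only: unspin)
    from has_derivative_compose[OF this D[unfolded p_def]]
    have "(?G has_derivative (\<lambda>v. ?D (drop_last l (fst v) +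
        ((fst q $ Some l * fst v $ Some l + fst q $ None * fst v $ None) / r (fst q)) *\<^sub>R axis l 1, snd v))) (at q)"
      by (simp add: case_prod_unfold p_def)
    then show ?thesis
      unfolding D_split pl using False by (simp add: p_def mult.commute)
  next
    case True
    then have z: "fst q $ Some l = 0" "fst q $ None = 0"
      by (auto simp: r_def add_nonneg_eq_0_iff)
    have G': "?G' = (\<lambda>v. ?D (drop_last l (fst v), snd v))"
      by (simp add: z p_def)
    have bl: "bounded_linear (\<lambda>v :: _ \<times> 'b. ?D (drop_last l (fst v), snd v))"
      by (intro bounded_linear_compose[OF has_derivative_bounded_linear[OF D]] bounded_linear_Pair
          bounded_linear_compose[OF linear_conv_bounded_linear[THEN iffD1, OF drop_lin]] bounded_linear_intros)
    \<comment> \<open>For \<open>q\<close> on the binding the last entry of the difference is just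
      the radius of \<open>q'\<close>, so \<open>unspin\<close> preserves distances from
      \<open>q\<close>. The remainder estimate of \<open>g\<close> at \<open>p\<close> then carries
      over unchanged.\<close>
    have norm_eq: "norm ((unspin l (fst q'), snd q') - p) = norm (q' - q)" for q'
    proof -
      have "(norm (unspin l (fst q') - unspin l (fst q)))\<^sup>2 = (norm (fst q' - fst q))\<^sup>2"
      proof -
        have "(norm (unspin l (fst q') - unspin l (fst q)))\<^sup>2 =
            (\<Sum>i\<in>UNIV. ((unspin l (fst q') - unspin l (fst q)) $ i)\<^sup>2)"
          by (simp add: norm_vec_def L2_set_def sum_nonneg)
        also have "\<dots> = ((fst q' $ Some l)\<^sup>2 + (fst q' $ None)\<^sup>2) +
            (\<Sum>i\<in>UNIV - {l}. (fst q' $ Some i - fst q $ Some i)\<^sup>2)"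
          by (subst sum.remove[of _ l]) (auto simp: unspin_def z intro!: sum.cong)
        also have "\<dots> = (\<Sum>i\<in>UNIV. ((fst q' - fst q) $ i)\<^sup>2)"
          unfolding sum_option by (subst (2) sum.remove[of _ l]) (auto simp: z)
        also have "\<dots> = (norm (fst q' - fst q))\<^sup>2"
          by (simp add: norm_vec_def L2_set_def sum_nonneg)
        finally show ?thesis .
      qed
      then show ?thesis
        by (simp add: norm_prod_def p_def)
    qed
    show ?thesis
      unfolding G' has_derivative_at_alt
    proof (intro conjI bl allI impI)
      fix e :: real assume "e > 0"
      then obtain d where d: "d > 0"
        and le: "\<And>y. norm (y - p) < d \<Longrightarrow> norm (g y - g p - ?D (y - p)) \<le> e * norm (y - p)"
        using D unfolding has_derivative_at_alt by blast
      show "\<exists>d>0. \<forall>q'. norm (q' - q) < d \<longrightarrow>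
        norm (?G q' - ?G q - ?D (drop_last l (fst (q' - q)), snd (q' - q))) \<le> e * norm (q' - q)"
      proof (intro exI[of _ d] conjI d allI impI)
        fix q' assume "norm (q' - q) < d"
        \<comment> \<open>The radial part of the increment is invisible to \<open>?D\<close>,
          because the last partial derivative of \<open>g\<close> vanishes on the binding.\<close>
        moreover have "?D ((unspin l (fst q'), snd q') - p) = ?D (drop_last l (fst (q' - q)), snd (q' - q))"
        proof -
          have "(unspin l (fst q'), snd q') - p =
              (drop_last l (fst (q' - q)) + r (fst q') *\<^sub>R axis l 1, snd (q' - q))"
            by (simp add: p_def unspin True linear_diff[OF drop_lin])
          then show ?thesis by (simp add: D_split pl True)
        qed
        ultimately show "norm (?G q' - ?G q - ?D (drop_last l (fst (q' - q)), snd (q' - q)))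
            \<le> e * norm (q' - q)"
          using le[of "(unspin l (fst q'), snd q')"] unfolding norm_eq
          by (simp add: case_prod_unfold p_def)
      qed
    qed
  qed
qed

text \<open>A directional derivative consists of two functions of the same kind: a derivative of
  \<open>g\<close> in a reflection-invariant direction, which is even, and the even quotient
  \<open>h\<close>, multiplied by a linear function of \<open>X\<close>. Induction over all even
  \<open>g\<close> therefore reaches every order.\<close>

lemma Cinf_on_unspin_even:
  fixes g :: "(real^'n::finite) \<times> 'b::euclidean_space \<Rightarrow> real"
  assumes "Cinf_on UNIV g" "\<And>p. g (refl_fst l p) = g p"
  shows "Cinf_on UNIV (\<lambda>(X, \<eta>). g (unspin l X, \<eta>))"
proof -
  have "Ck_on k UNIV (\<lambda>(X, \<eta>). g (unspin l X, \<eta>))" for k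
    using assms
  proof (induction k arbitrary: g)
    case 0
    from even_quotient[OF 0] obtain h where
      "\<And>p. frechet_derivative g (at p) (axis l 1, 0) = fst p $ l * h p" by metis
    from has_derivative_continuous[OF has_derivative_unspin[OF 0(1) this]] show ?case
      unfolding Ck_on.simps by (rule continuous_at_imp_continuous_on[OF ballI])
  next
    case (Suc k)
    from even_quotient[OF Suc.prems] obtain h where h: "Cinf_on UNIV h" "\<And>p. h (refl_fst l p) = h p"
      and eq: "\<And>p. frechet_derivative g (at p) (axis l 1, 0) = fst p $ l * h p" by metis
    show ?case
    proof (rule Ck_on_SucI[OF open_UNIV has_derivative_unspin[OF Suc.prems(1) eq]])
      fix v :: "(real^'n option) \<times> 'b"
      let ?b = "(drop_last l (fst v), snd v)"
      have b: "refl_fst l ?b = ?b"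
        by (simp add: refl_fst_def reflection_def drop_last_def vec_eq_iff)
      have "Ck_on k UNIV (\<lambda>(X, \<eta>). frechet_derivative g (at (unspin l X, \<eta>)) ?b)"
      proof (rule Suc.IH)
        show "Cinf_on UNIV (\<lambda>p. frechet_derivative g (at p) ?b)"
          by (rule Cinf_on_frechet_derivative[OF Suc.prems(1)])
        show "frechet_derivative g (at (refl_fst l p)) ?b = frechet_derivative g (at p) ?b" for p
          using even_frechet_derivative[OF Suc.prems(1), of l 1 p ?b] Suc.prems(2) b by simp
      qed
      moreover have "Ck_on k UNIV (\<lambda>(X, \<eta>). h (unspin l X, \<eta>))"
        by (rule Suc.IH[OF h])
      moreover have "Cinf_on UNIV (\<lambda>q :: (real^'n option) \<times> 'b.
          fst q $ Some l * fst v $ Some l + fst q $ None * fst v $ None)"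
        by (intro Cinf_intros open_UNIV)
      ultimately show "Ck_on k UNIV (\<lambda>q. frechet_derivative g (at (unspin l (fst q), snd q)) ?b +
          h (unspin l (fst q), snd q) *
            (fst q $ Some l * fst v $ Some l + fst q $ None * fst v $ None))"
        unfolding case_prod_unfold
        by (rule_tac Ck_on_add[OF open_UNIV _ Ck_on_real_mult[OF open_UNIV]]) (auto simp: Cinf_on_def)
    qed
  qed
  then show ?thesis by (simp add: Cinf_on_def)
qed

section \<open>Pages of the open book\<close>

text \<open>The unit normal of the page, in the direction of increasing \<theta>. It is written as
  the radial vector of the page a quarter turn ahead, so that facts about \<open>page\<close> apply
  to it.\<close>

definition page_normal :: "'n \<Rightarrow> real \<Rightarrow> real^('n::finite option)" where
  "page_normal l \<theta> = page l (\<theta> + pi / 2) (axis l 1)"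

lemma page_nth [simp]:
  "page l \<theta> x $ None = x $ l * sin \<theta>"
  "page l \<theta> x $ Some j = (if j = l then x $ l * cos \<theta> else x $ j)"
  by (simp_all add: page_def)

lemma page_normal_nth [simp]:
  "page_normal l \<theta> $ None = cos \<theta>"
  "page_normal l \<theta> $ Some j = (if j = l then - sin \<theta> else 0)"
  by (auto simp: page_normal_def axis_def sin_add cos_add)

lemma vec_option_eq_iff: "X = Y \<longleftrightarrow> X $ None = Y $ None \<and> (\<forall>j. X $ Some j = Y $ Some j)"
  for X Y :: "'a^('n::finite option)"
  by (auto simp: vec_eq_iff split_option_all)

lemma page_linear: "linear (page l \<theta>)"
  by (rule linearI) (auto simp: vec_option_eq_iff algebra_simps)

text \<open>Two different angles are allowed in order to cover \<open>page_normal\<close>, where the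
  cosine of a quarter turn is 0.\<close>

lemma inner_page: "page l \<theta> v \<bullet> page l \<phi> w = v \<bullet> w + v $ l * w $ l * (cos (\<theta> - \<phi>) - 1)"
proof -
  have "page l \<theta> v \<bullet> page l \<phi> w = v $ l * sin \<theta> * (w $ l * sin \<phi>) +
      (v $ l * cos \<theta> * (w $ l * cos \<phi>) + (\<Sum>j\<in>UNIV - {l}. v $ j * w $ j))"
    unfolding inner_vec_def sum_option
    by (subst sum.remove[of _ l]) (auto intro!: sum.cong)
  moreover have "v \<bullet> w = v $ l * w $ l + (\<Sum>j\<in>UNIV - {l}. v $ j * w $ j)"
    unfolding inner_vec_def by (subst sum.remove[of _ l]) auto
  ultimately show ?thesis by (simp add: cos_diff algebra_simps)
qed

lemma inner_page_same [simp]: "page l \<theta> v \<bullet> page l \<theta> w = v \<bullet> w"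
  by (simp add: inner_page)

lemma inner_page_normal [simp]:
  "page_normal l \<theta> \<bullet> page l \<theta> v = 0" "page l \<theta> v \<bullet> page_normal l \<theta> = 0"
  "page_normal l \<theta> \<bullet> page_normal l \<theta> = 1"
  by (simp_all add: page_normal_def inner_page inner_axis inner_axis')

text \<open>Orthogonal splitting of a covector into its restriction to the page and its normal
  component; the jets of the loop determine only the former.\<close>

lemma page_decompose:
  "X = page l \<theta> (\<chi> j. X \<bullet> page l \<theta> (axis j 1)) + (X \<bullet> page_normal l \<theta>) *\<^sub>R page_normal l \<theta>"
proof -
  have *: "X \<bullet> page l \<theta> (axis j 1) = (if j = l then X $ None * sin \<theta> + X $ Some l * cos \<theta> else X $ Some j)" for j
  proof -
    have "page l \<theta> (axis j 1) = (if j = l then sin \<theta> *\<^sub>R axis None 1 + cos \<theta> *\<^sub>R axis (Some l) 1 else axis (Some j) 1)"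
      by (auto simp: vec_option_eq_iff axis_def)
    then show ?thesis by (simp add: inner_add_right inner_axis)
  qed
  have "page_normal l \<theta> = cos \<theta> *\<^sub>R axis None 1 - sin \<theta> *\<^sub>R axis (Some l) 1"
    by (auto simp: vec_option_eq_iff axis_def)
  then have n: "X \<bullet> page_normal l \<theta> = X $ None * cos \<theta> - X $ Some l * sin \<theta>"
    by (simp add: inner_diff_right inner_axis)
  have "cos \<theta> * (cos \<theta> * a) + sin \<theta> * (sin \<theta> * a) = ((sin \<theta>)\<^sup>2 + (cos \<theta>)\<^sup>2) * a" for a
    by (simp only: power2_eq_square distrib_right mult.assoc add.commute)
  then have [simp]: "cos \<theta> * (cos \<theta> * a) + sin \<theta> * (sin \<theta> * a) = a" for a
    by simp
  show ?thesis
    by (auto simp: vec_option_eq_iff * n algebra_simps)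
qed

lemma page_eqI:
  assumes "\<And>v. Y \<bullet> page l \<theta> v = Y' \<bullet> page l \<theta> v" "Y \<bullet> page_normal l \<theta> = Y' \<bullet> page_normal l \<theta>"
  shows "Y = Y'"
  using page_decompose[of Y l \<theta>] page_decompose[of Y' l \<theta>] assms by simp

lemma Cinf_on_page [Cinf_intros]:
  assumes "open U" "Cinf_on U a" "Cinf_on U x"
  shows "Cinf_on U (\<lambda>p. page l (a p) (x p))"
  unfolding page_def
proof (rule Cinf_on_vec_lambda[OF assms(1)])
  fix i
  show "Cinf_on U (\<lambda>p. case i of None \<Rightarrow> x p $ l * sin (a p)
      | Some j \<Rightarrow> if j = l then x p $ l * cos (a p) else x p $ j)"
  proof (cases i)
    case (Some j)
    then show ?thesis by (cases "j = l") (auto intro!: Cinf_intros assms)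
  qed (auto intro!: Cinf_intros assms)
qed

text \<open>The adjoint of \<open>page l \<theta>\<close>; on covectors it is the restriction to the
  page.\<close>

definition unpage :: "'n \<Rightarrow> real \<Rightarrow> real^('n::finite option) \<Rightarrow> real^'n" where
  "unpage l \<theta> Y = (\<chi> j. Y \<bullet> page l \<theta> (axis j 1))"

lemma inner_unpage: "unpage l \<theta> Y \<bullet> v = Y \<bullet> page l \<theta> v"
proof -
  have "Y \<bullet> page l \<theta> v = page l \<theta> (unpage l \<theta> Y) \<bullet> page l \<theta> v +
      (Y \<bullet> page_normal l \<theta>) * (page_normal l \<theta> \<bullet> page l \<theta> v)"
    unfolding unpage_def
    by (subst page_decompose[of Y l \<theta>]) (simp only: inner_add_left inner_scaleR_left)
  then show ?thesis by simp
qed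

lemma Cinf_on_unpage [Cinf_intros]:
  assumes "open U" "Cinf_on U a" "Cinf_on U Y"
  shows "Cinf_on U (\<lambda>p. unpage l (a p) (Y p))"
  unfolding unpage_def by (intro Cinf_intros assms)

text \<open>Rotation moves a point with speed \<open>x $ l\<close> along the normal and has no
  effect on the binding. Through this factor the contact form later detects normal
  derivatives.\<close>

lemma has_derivative_page:
  fixes l :: "'n::finite"
  shows "((\<lambda>q. page l (fst q) (snd q)) has_derivative
    (\<lambda>v. page l (fst q) (snd v) + (fst v * snd q $ l) *\<^sub>R page_normal l (fst q))) (at q)"
proof -
  \<comment> \<open>\<open>E\<close> collects the coordinates that the rotation does not
    move.\<close>
  define E where "E = (\<lambda>x :: real^'n. page l 0 x - (x $ l) *\<^sub>R axis (Some l) 1)"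
  have E: "linear E"
    unfolding E_def by (rule linearI) (auto simp: vec_option_eq_iff axis_def algebra_simps)
  have eq: "page l \<theta> x = E x + (x $ l * cos \<theta>) *\<^sub>R axis (Some l) 1 + (x $ l * sin \<theta>) *\<^sub>R axis None 1" for \<theta> x
    by (auto simp: E_def vec_option_eq_iff axis_def)
  have n: "page_normal l \<theta> = cos \<theta> *\<^sub>R axis None 1 - sin \<theta> *\<^sub>R axis (Some l) 1" for \<theta>
    by (auto simp: vec_option_eq_iff axis_def)
  have dE: "((\<lambda>q :: real \<times> _. E (snd q)) has_derivative (\<lambda>v. E (snd v))) (at q)"
    using E by (intro has_derivative_compose[OF has_derivative_snd[OF has_derivative_ident]]
        linear_imp_has_derivative)
  have dl: "((\<lambda>q :: real \<times> (real^'n). snd q $ l) has_derivative (\<lambda>v. snd v $ l)) (at q)"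
    by (intro bounded_linear.has_derivative[OF bounded_linear_vec_nth] has_derivative_snd has_derivative_ident)
  show ?thesis
    unfolding eq
    by (rule has_derivative_eq_rhs, rule has_derivative_add, rule has_derivative_add[OF dE])
      (auto intro!: derivative_eq_intros dl simp: n algebra_simps)
qed

lemma mem_halfspace: "x \<in> halfspace l \<longleftrightarrow> 0 \<le> x $ l"
  by (simp add: halfspace_def)

lemma unspin_in_halfspace [simp]: "unspin l X \<in> halfspace l"
  by (simp add: mem_halfspace unspin_def)

lemma unspin_page:
  assumes "x \<in> halfspace l" shows "unspin l (page l \<theta> x) = x"
proof -
  have "(x $ l * cos \<theta>)\<^sup>2 + (x $ l * sin \<theta>)\<^sup>2 = (x $ l)\<^sup>2"
    by (simp add: power_mult_distrib flip: distrib_left)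
  then show ?thesis
    using assms by (simp add: unspin_def vec_eq_iff mem_halfspace)
qed

text \<open>The bounds on the angle serve compactness: a compact interval of angles sweeps a compact
  set into a compact set. On the binding any angle will do.\<close>

lemma page_unspin_ex: "\<exists>\<theta>. 0 \<le> \<theta> \<and> \<theta> \<le> 2 * pi \<and> X = page l \<theta> (unspin l X)"
proof (cases "unspin l X $ l = 0")
  case True
  then show ?thesis
    by (intro exI[of _ 0]) (auto simp: vec_option_eq_iff unspin_def add_nonneg_eq_0_iff)
next
  case False
  let ?r = "unspin l X $ l"
  have r: "?r\<^sup>2 = (X $ Some l)\<^sup>2 + (X $ None)\<^sup>2" by (simp add: unspin_def)
  have "(X $ Some l / ?r)\<^sup>2 + (X $ None / ?r)\<^sup>2 = ((X $ Some l)\<^sup>2 + (X $ None)\<^sup>2) / ?r\<^sup>2"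
    by (simp only: power_divide add_divide_distrib)
  then have "(X $ Some l / ?r)\<^sup>2 + (X $ None / ?r)\<^sup>2 = 1"
    unfolding r[symmetric] using False by simp
  then obtain t where "0 \<le> t" "t < 2 * pi" "X $ Some l / ?r = cos t" "X $ None / ?r = sin t"
    using sincos_total_2pi by metis
  then show ?thesis
    using False by (intro exI[of _ t]) (auto simp: vec_option_eq_iff field_simps unspin_def)
qed

lemma page_angle_unique:
  assumes "page l \<theta> x = page l \<phi> x" "x $ l \<noteq> 0"
  obtains k :: int where "\<phi> = \<theta> + 2 * pi * k"
proof -
  have "x $ l * sin \<theta> = x $ l * sin \<phi>" "x $ l * cos \<theta> = x $ l * cos \<phi>"
    using arg_cong[OF assms(1), of "\<lambda>X. X $ None"] arg_cong[OF assms(1), of "\<lambda>X. X $ Some l"] by auto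
  then have "sin \<phi> = sin \<theta> \<and> cos \<phi> = cos \<theta>" using assms(2) by simp
  then show ?thesis using that sin_cos_eq_iff by blast
qed

text \<open>The condition under which derivatives within the product are unique, boundary points
  included. Every basis vector has a nonnegative last entry, so a small positive step along it stays
  inside.\<close>

lemma halfspace_product_approach:
  assumes "p \<in> halfspace l \<times> (UNIV :: 'b::euclidean_space set)" "i \<in> Basis" "(e::real) > 0"
  shows "\<exists>d. 0 < \<bar>d\<bar> \<and> \<bar>d\<bar> < e \<and> p + d *\<^sub>R i \<in> halfspace l \<times> UNIV"
proof (intro exI[of _ "e / 2"] conjI)
  have "0 \<le> fst i $ l"
    using assms(2) by (auto simp: Basis_prod_def Basis_vec_def axis_def)
  then show "p + (e / 2) *\<^sub>R i \<in> halfspace l \<times> UNIV"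
    using assms by (auto simp: mem_halfspace mem_Times_iff)
qed (use assms in auto)

lemma halfspace_approach:
  assumes "x \<in> halfspace l" "i \<in> Basis" "(e::real) > 0"
  shows "\<exists>d. 0 < \<bar>d\<bar> \<and> \<bar>d\<bar> < e \<and> x + d *\<^sub>R i \<in> halfspace l"
proof (intro exI[of _ "e / 2"] conjI)
  have "0 \<le> i $ l"
    using assms(2) by (auto simp: Basis_vec_def axis_def)
  then show "x + (e / 2) *\<^sub>R i \<in> halfspace l"
    using assms by (auto simp: mem_halfspace)
qed (use assms in auto)

section \<open>Gradients of families\<close>

context
  fixes F :: "(real^'m::finite) \<times> (real^'N::finite) \<Rightarrow> real"
  assumes F: "Cinf_on UNIV F"
begin

lemma smooth_has_derivative: "(F has_derivative frechet_derivative F (at p)) (at p)"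
  using Cinf_on_has_derivative[OF F] by simp

lemma base_slice_has_derivative:
  "((\<lambda>x. F (x, \<eta>)) has_derivative (\<lambda>v. frechet_derivative F (at (x, \<eta>)) (v, 0))) (at x)"
  by (intro has_derivative_compose[of "\<lambda>x. (x, \<eta>)" "\<lambda>v. (v, 0)" x UNIV F] smooth_has_derivative)
    (auto intro!: derivative_eq_intros)

lemma fibre_slice_has_derivative:
  "((\<lambda>\<eta>. F (x, \<eta>)) has_derivative (\<lambda>w. frechet_derivative F (at (x, \<eta>)) (0, w))) (at \<eta>)"
  by (intro has_derivative_compose[of "\<lambda>\<eta>. (x, \<eta>)" "\<lambda>v. (0, v)" \<eta> UNIV F] smooth_has_derivative)
    (auto intro!: derivative_eq_intros)

lemma base_grad_eq: "base_grad UNIV F p = (\<chi> i. frechet_derivative F (at p) (axis i 1, 0))"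
  unfolding base_grad_def
  using frechet_derivative_at[OF base_slice_has_derivative, symmetric, of "snd p" "fst p"] by simp

lemma fibre_grad_eq: "fibre_grad F p = (\<chi> j. frechet_derivative F (at p) (0, axis j 1))"
  unfolding fibre_grad_def
  using frechet_derivative_at[OF fibre_slice_has_derivative, symmetric, of "fst p" "snd p"] by simp

lemma Cinf_on_base_grad: "Cinf_on UNIV (base_grad UNIV F)"
proof -
  have "base_grad UNIV F = (\<lambda>p. \<chi> i. frechet_derivative F (at p) (axis i 1, 0))"
    by (rule ext) (rule base_grad_eq)
  then show ?thesis
    by (simp only: Cinf_on_vec_lambda[OF open_UNIV Cinf_on_frechet_derivative[OF F]])
qed

lemma Cinf_on_fibre_grad: "Cinf_on UNIV (fibre_grad F)"
proof -
  have "fibre_grad F = (\<lambda>p. \<chi> i. frechet_derivative F (at p) (0, axis i 1))"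
    by (rule ext) (rule fibre_grad_eq)
  then show ?thesis
    by (simp only: Cinf_on_vec_lambda[OF open_UNIV Cinf_on_frechet_derivative[OF F]])
qed

lemma base_grad_inner: "base_grad UNIV F p \<bullet> v = frechet_derivative F (at p) (v, 0)"
proof -
  have lin: "linear (\<lambda>v. frechet_derivative F (at p) (v, 0))"
    using base_slice_has_derivative[of "snd p" "fst p"] has_derivative_linear by fastforce
  have "(\<Sum>i\<in>UNIV. frechet_derivative F (at p) (axis i 1, 0) * v $ i) =
      (\<Sum>i\<in>UNIV. (v $ i) *\<^sub>R (\<lambda>v. frechet_derivative F (at p) (v, 0)) (axis i 1))"
    by (simp add: mult.commute)
  also have "\<dots> = frechet_derivative F (at p) ((\<Sum>i\<in>UNIV. (v $ i) *\<^sub>R axis i 1), 0)"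
    by (simp only: linear_sum[OF lin] linear_cmul[OF lin])
  also have "(\<Sum>i\<in>UNIV. (v $ i) *\<^sub>R axis i 1) = v"
    by (simp add: vec_eq_iff axis_def if_distrib[of "(*) _"] cong: if_cong)
  finally show ?thesis by (simp add: inner_vec_def base_grad_eq)
qed

lemma fibre_grad_inner: "fibre_grad F p \<bullet> v = frechet_derivative F (at p) (0, v)"
proof -
  have lin: "linear (\<lambda>v. frechet_derivative F (at p) (0, v))"
    using fibre_slice_has_derivative[of "fst p" "snd p"] has_derivative_linear by fastforce
  have "(\<Sum>i\<in>UNIV. frechet_derivative F (at p) (0, axis i 1) * v $ i) =
      (\<Sum>i\<in>UNIV. (v $ i) *\<^sub>R (\<lambda>v. frechet_derivative F (at p) (0, v)) (axis i 1))"
    by (simp add: mult.commute)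
  also have "\<dots> = frechet_derivative F (at p) (0, (\<Sum>i\<in>UNIV. (v $ i) *\<^sub>R axis i 1))"
    by (simp only: linear_sum[OF lin] linear_cmul[OF lin])
  also have "(\<Sum>i\<in>UNIV. (v $ i) *\<^sub>R axis i 1) = v"
    by (simp add: vec_eq_iff axis_def if_distrib[of "(*) _"] cong: if_cong)
  finally show ?thesis by (simp add: inner_vec_def fibre_grad_eq)
qed

lemma derivative_eq_grads:
  "frechet_derivative F (at p) v = base_grad UNIV F p \<bullet> fst v + fibre_grad F p \<bullet> snd v"
  using linear_add[OF has_derivative_linear[OF smooth_has_derivative], of p "(fst v, 0)" "(0, snd v)"]
  by (simp add: base_grad_inner fibre_grad_inner)

end

text \<open>A function whose restriction to a page near a point of the binding does not depend on the page
  takes the same values on opposite pages, so its radial derivative vanishes there.\<close>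

lemma binding_derivative_zero:
  fixes Q :: "(real^('n::finite option)) \<times> 'b::real_normed_vector \<Rightarrow> 'c::real_normed_vector"
  assumes D: "(Q has_derivative D) (at (page l \<theta> x, \<eta>))" and x: "x $ l = 0" and "\<epsilon> > 0"
    and q: "\<And>\<phi> t. 0 \<le> t \<Longrightarrow> t < \<epsilon> \<Longrightarrow> Q (page l \<phi> (x + t *\<^sub>R axis l 1), \<eta>) = q t"
  shows "D (page l \<phi> (axis l 1), 0) = 0"
proof -
  have page_x: "page l \<phi> x = page l \<theta> x" for \<phi>
    using x by (auto simp: vec_option_eq_iff)
  have q': "(q has_vector_derivative D (page l \<phi> (axis l 1), 0)) (at 0 within {0..<\<epsilon>})" for \<phi>
  proof -
    have "((\<lambda>t. (page l \<theta> x + t *\<^sub>R page l \<phi> (axis l 1), \<eta>)) has_vector_derivative (page l \<phi> (axis l 1), 0))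
        (at 0 within {0..<\<epsilon>})"
      by (auto intro!: derivative_eq_intros)
    moreover have "(Q has_derivative D) (at (page l \<theta> x + 0 *\<^sub>R page l \<phi> (axis l 1), \<eta>))"
      using D by simp
    ultimately have "((\<lambda>t. Q (page l \<theta> x + t *\<^sub>R page l \<phi> (axis l 1), \<eta>)) has_vector_derivative
        D (page l \<phi> (axis l 1), 0)) (at 0 within {0..<\<epsilon>})"
      by (rule has_vector_derivative_compose_within) simp
    then show ?thesis
    proof (rule has_vector_derivative_transform[rotated 2])
      show "q t = Q (page l \<theta> x + t *\<^sub>R page l \<phi> (axis l 1), \<eta>)" if "t \<in> {0..<\<epsilon>}" for t
        using q[of t \<phi>] that
        by (simp add: linear_add[OF page_linear] linear_cmul[OF page_linear] page_x[of \<phi>])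
    qed (use \<open>\<epsilon> > 0\<close> in simp)
  qed
  have "page l (\<phi> + pi) (axis l 1) = - page l \<phi> (axis l 1)"
    by (auto simp: vec_option_eq_iff axis_def)
  then have "D (page l (\<phi> + pi) (axis l 1), 0) = D (- (page l \<phi> (axis l 1), 0))"
    by simp
  then have "D (page l (\<phi> + pi) (axis l 1), 0) = - D (page l \<phi> (axis l 1), 0)"
    using linear_neg[OF has_derivative_linear[OF D]] by metis
  then have "D (page l \<phi> (axis l 1), 0) = - D (page l \<phi> (axis l 1), 0)"
    using has_vector_derivative_unique_right[OF q'[of \<phi>] q'[of "\<phi> + pi"] \<open>\<epsilon> > 0\<close>] by simp
  then have "2 *\<^sub>R D (page l \<phi> (axis l 1), 0) = 0"
    by (metis add.right_inverse scaleR_2)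
  then show ?thesis by simp
qed

section \<open>The rotated family and its smoothness\<close>

locale spinnable_loop =
  fixes l :: "'n::finite" and f :: "real \<Rightarrow> (real^'n) \<times> (real^'N::finite) \<Rightarrow> real"
  assumes loop: "spinnable_family_loop l f"
begin

text \<open>The angle is any one whose page passes through the point; the value turns out not to
  depend on it, by \<open>F_page\<close>.\<close>

definition F :: "(real^('n option)) \<times> (real^'N) \<Rightarrow> real" where
  "F p = f (SOME \<theta>. fst p = page l \<theta> (unspin l (fst p))) (unspin l (fst p), snd p)"

text \<open>The largest open set over which the loop is constant. Openness makes derivatives agree
  there too, and leaves a compact remainder when the set is removed from \<open>K\<close>.\<close>

definition steady :: "((real^'n) \<times> (real^'N)) set" where
  "steady = \<Union> {V. open V \<and> (\<forall>\<theta>. \<forall>p\<in>V \<inter> (halfspace l \<times> UNIV). f \<theta> p = f 0 p)}"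

lemma open_steady: "open steady"
  unfolding steady_def by (rule open_Union) blast

lemma steady_eq: "p \<in> steady \<Longrightarrow> fst p \<in> halfspace l \<Longrightarrow> f \<theta> p = f \<phi> p"
proof -
  assume "p \<in> steady" and p: "fst p \<in> halfspace l"
  then obtain V where V: "p \<in> V" "\<forall>\<theta>. \<forall>p\<in>V \<inter> (halfspace l \<times> UNIV). f \<theta> p = f 0 p"
    unfolding steady_def by blast
  have "p \<in> V \<inter> (halfspace l \<times> UNIV)" using V(1) p by (simp add: mem_Times_iff)
  then show "f \<theta> p = f \<phi> p" using V(2) by metis
qed

lemma axis_steady:
  assumes "x $ l = 0" shows "(x, \<eta>) \<in> steady"
proof -
  obtain W where "open W" "{x. x $ l = 0} \<times> UNIV \<subseteq> W"
      "\<forall>\<theta>. \<forall>p\<in>W \<inter> (halfspace l \<times> UNIV). f \<theta> p = f 0 p"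
    using loop unfolding spinnable_family_loop_def by (elim exE conjE)
  with assms show ?thesis unfolding steady_def by blast
qed

lemma periodic_nat: "fst p \<in> halfspace l \<Longrightarrow> f (\<theta> + 2 * pi * real k) p = f \<theta> p"
proof (induction k)
  case (Suc k)
  have "f (\<theta> + 2 * pi * real (Suc k)) p = f ((\<theta> + 2 * pi * real k) + 2 * pi) p"
    by (simp add: algebra_simps)
  also have "\<dots> = f (\<theta> + 2 * pi * real k) p"
  proof -
    have "p \<in> halfspace l \<times> UNIV" using Suc.prems by (simp add: mem_Times_iff)
    then show ?thesis using loop unfolding spinnable_family_loop_def by blast
  qed
  finally show ?case using Suc by simp
qed simp

lemma periodic_int:
  assumes "fst p \<in> halfspace l" shows "f (\<theta> + 2 * pi * of_int k) p = f \<theta> p"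
proof (cases "0 \<le> k")
  case True
  then show ?thesis using periodic_nat[OF assms, of \<theta> "nat k"] by simp
next
  case False
  then show ?thesis
    using periodic_nat[OF assms, of "\<theta> + 2 * pi * of_int k" "nat (- k)"] by simp
qed

text \<open>Off the binding the angle is unique up to full turns, which periodicity absorbs; on it
  every angle is possible, but there the loop is constant.\<close>

lemma F_page:
  assumes x: "x \<in> halfspace l" shows "F (page l \<theta> x, \<eta>) = f \<theta> (x, \<eta>)"
proof -
  let ?\<phi> = "SOME \<phi>. page l \<theta> x = page l \<phi> x"
  have \<phi>: "page l \<theta> x = page l ?\<phi> x" by (rule someI[of _ \<theta>]) simp
  have F: "F (page l \<theta> x, \<eta>) = f ?\<phi> (x, \<eta>)"
    by (simp add: F_def unspin_page[OF x])
  show ?thesis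
  proof (cases "x $ l = 0")
    case True
    then show ?thesis using steady_eq[OF axis_steady] x F by simp
  next
    case False
    from page_angle_unique[OF \<phi> this] obtain k :: int where "?\<phi> = \<theta> + 2 * pi * k" .
    then show ?thesis using F periodic_int[of "(x, \<eta>)"] x by simp
  qed
qed

lemma F_unspin: "X = page l \<theta> (unspin l X) \<Longrightarrow> F (X, \<eta>) = f \<theta> (unspin l X, \<eta>)"
  using F_page[OF unspin_in_halfspace] by metis

text \<open>Where the loop is constant, \<open>F\<close> is the symmetric double of
  \<open>f 0\<close> composed with \<open>unspin\<close>, and the double is smooth and even.\<close>

lemma Cinf_near_binding:
  assumes "unspin l X $ l = 0"
  shows "\<exists>V. open V \<and> (X, \<eta>) \<in> V \<and> Cinf_on V F"
proof -
  define g where "g = (\<lambda>(x, \<eta>). if 0 \<le> x $ l then f 0 (x, \<eta>) else f 0 (reflection l x, \<eta>))"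
  have "smooth_on UNIV g"
    using loop unfolding spinnable_family_loop_def spinnable_family_def g_def by blast
  then have g: "Cinf_on UNIV g" by (simp add: smooth_on_open)
  have refl0: "reflection l x = x" if "x $ l = 0" for x
    using that by (simp add: reflection_def vec_eq_iff)
  have "reflection l (reflection l x) = x" for x
    by (simp add: reflection_def vec_eq_iff)
  then have g_even: "g (refl_fst l p) = g p" for p
    using refl0[of "fst p"]
    by (cases "fst p $ l = 0") (auto simp: g_def refl_fst_def case_prod_unfold reflection_def)
  define V where "V = (\<lambda>p. (unspin l (fst p), snd p)) -` steady"
  have "continuous_on UNIV (\<lambda>p :: (real^'n option) \<times> (real^'N). (unspin l (fst p), snd p))"
  proof -
    have "continuous_on UNIV (\<lambda>p :: (real^'n option) \<times> (real^'N). if i = l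
        then sqrt ((fst p $ Some l)\<^sup>2 + (fst p $ None)\<^sup>2) else fst p $ Some i)" for i
      by (cases "i = l") (auto intro!: continuous_intros)
    then show ?thesis unfolding unspin_def by (intro continuous_intros)
  qed
  then have V: "open V" unfolding V_def using open_steady open_vimage by blast
  have "Cinf_on V F"
  proof (rule Cinf_on_cong[OF V])
    show "Cinf_on V (\<lambda>(X, \<eta>). g (unspin l X, \<eta>))"
      by (rule Cinf_on_subset[OF Cinf_on_unspin_even[OF g g_even]]) simp
    show "(case p of (X, \<eta>) \<Rightarrow> g (unspin l X, \<eta>)) = F p" if p: "p \<in> V" for p
    proof -
      obtain \<theta> where \<theta>: "fst p = page l \<theta> (unspin l (fst p))" using page_unspin_ex by blast
      have "F (fst p, snd p) = f 0 (unspin l (fst p), snd p)"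
        using F_unspin[OF \<theta>, of "snd p"] steady_eq[of "(unspin l (fst p), snd p)" \<theta> 0] p
        by (simp add: V_def)
      moreover have "0 \<le> unspin l (fst p) $ l" using unspin_in_halfspace mem_halfspace by blast
      ultimately show ?thesis by (simp add: g_def case_prod_unfold)
    qed
  qed
  moreover have "(X, \<eta>) \<in> V" using axis_steady[OF assms] by (simp add: V_def)
  ultimately show ?thesis using V by blast
qed

lemma Cinf_off_binding:
  assumes "unspin l X0 $ l \<noteq> 0"
  shows "\<exists>V. open V \<and> (X0, \<eta>) \<in> V \<and> Cinf_on V F"
proof -
  let ?r = "\<lambda>X. unspin l X $ l"
  obtain \<theta> where \<theta>: "X0 = page l \<theta> (unspin l X0)" using page_unspin_ex by blast
  \<comment> \<open>Cartesian coordinates turned by \<theta>, in which \<open>X0\<close> has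
    \<open>u > 0\<close> and \<open>v = 0\<close>. On the half-space \<open>u > 0\<close> the
    function \<open>\<alpha>\<close> is a smooth branch of the angle.\<close>
  define u where "u = (\<lambda>X :: real^('n option). X $ Some l * cos \<theta> + X $ None * sin \<theta>)"
  define v where "v = (\<lambda>X :: real^('n option). X $ None * cos \<theta> - X $ Some l * sin \<theta>)"
  define \<alpha> where "\<alpha> = (\<lambda>X. \<theta> + arctan (v X / u X))"
  define V where "V = {p :: (real^('n option)) \<times> (real^'N). u (fst p) > 0}"
  have "continuous_on UNIV (\<lambda>p :: (real^('n option)) \<times> (real^'N). u (fst p))"
    unfolding u_def by (intro continuous_intros)
  then have V: "open V"
    unfolding V_def using open_Collect_less[of "\<lambda>_. 0"] by (auto intro: continuous_intros)
  have uv: "X $ Some l = u X * cos \<theta> - v X * sin \<theta>" "X $ None = u X * sin \<theta> + v X * cos \<theta>" for X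
  proof -
    have [simp]: "cos \<theta> * (cos \<theta> * a) + sin \<theta> * (sin \<theta> * a) = a" for a
    proof -
      have "cos \<theta> * (cos \<theta> * a) + sin \<theta> * (sin \<theta> * a) = ((sin \<theta>)\<^sup>2 + (cos \<theta>)\<^sup>2) * a"
        by (simp only: power2_eq_square distrib_right mult.assoc add.commute)
      then show ?thesis by simp
    qed
    show "X $ Some l = u X * cos \<theta> - v X * sin \<theta>" "X $ None = u X * sin \<theta> + v X * cos \<theta>"
      by (simp_all add: u_def v_def algebra_simps)
  qed
  have r2: "(X $ Some l)\<^sup>2 + (X $ None)\<^sup>2 = (u X)\<^sup>2 + (v X)\<^sup>2" for X
  proof -
    have "(u X)\<^sup>2 + (v X)\<^sup>2 = ((X $ Some l)\<^sup>2 + (X $ None)\<^sup>2) * ((sin \<theta>)\<^sup>2 + (cos \<theta>)\<^sup>2)"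
      unfolding u_def v_def power2_eq_square by algebra
    then show ?thesis by simp
  qed
  \<comment> \<open>The root is the one that occurs in the formulas for the cosine and sine of an
    arctangent.\<close>
  have r: "?r X = u X * sqrt (1 + (v X / u X)\<^sup>2)" if "u X > 0" for X
  proof -
    have "?r X = sqrt ((u X)\<^sup>2 * (1 + (v X / u X)\<^sup>2))"
      using that by (simp add: unspin_def r2 power_divide distrib_left)
    then show ?thesis using that by (simp add: real_sqrt_mult)
  qed
  have page: "X = page l (\<alpha> X) (unspin l X)" if "u X > 0" for X
  proof -
    have s: "sqrt (1 + (v X / u X)\<^sup>2) > 0" by (simp add: add_pos_nonneg)
    have c: "?r X * cos (arctan (v X / u X)) = u X"
      using s by (simp add: r[OF that] cos_arctan)
    have d: "?r X * sin (arctan (v X / u X)) = v X"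
      using s that by (simp add: r[OF that] sin_arctan)
    have "?r X * cos (\<alpha> X) = (?r X * cos (arctan (v X / u X))) * cos \<theta> -
        (?r X * sin (arctan (v X / u X))) * sin \<theta>"
      unfolding \<alpha>_def cos_add by (simp only: right_diff_distrib mult.assoc mult.commute mult.left_commute)
    also have "\<dots> = X $ Some l"
      unfolding c d by (rule uv(1)[symmetric])
    finally have "?r X * cos (\<alpha> X) = X $ Some l" .
    moreover have "?r X * sin (\<alpha> X) = (?r X * cos (arctan (v X / u X))) * sin \<theta> +
        (?r X * sin (arctan (v X / u X))) * cos \<theta>"
      unfolding \<alpha>_def sin_add by (simp only: distrib_left mult.assoc mult.commute mult.left_commute)
    then have "?r X * sin (\<alpha> X) = X $ None"
      unfolding c d uv(2)[symmetric] .
    ultimately show ?thesis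
      by (auto simp: vec_option_eq_iff) (simp add: unspin_def)
  qed
  have uC: "Cinf_on V (\<lambda>p. u (fst p))" and vC: "Cinf_on V (\<lambda>p. v (fst p))"
    unfolding u_def v_def by (intro Cinf_intros V)+
  have "Cinf_on V (\<lambda>p. arctan (v (fst p) / u (fst p)))"
  proof (rule Cinf_on_compose[OF V open_UNIV _ _ Cinf_on_arctan])
    show "Cinf_on V (\<lambda>p. v (fst p) / u (fst p))"
      by (rule Cinf_on_divide[OF V vC uC]) (simp add: V_def)
  qed simp
  then have \<alpha>C: "Cinf_on V (\<lambda>p. \<alpha> (fst p))"
    unfolding \<alpha>_def by (intro Cinf_on_add V Cinf_on_const)
  have rpos: "0 < (X $ Some l)\<^sup>2 + (X $ None)\<^sup>2" if "u X > 0" for X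
    unfolding r2 using that by (simp add: add_pos_nonneg)
  have unspinC: "Cinf_on V (\<lambda>p. unspin l (fst p))"
    unfolding unspin_def
  proof (rule Cinf_on_vec_lambda[OF V])
    fix i
    have "Cinf_on V (\<lambda>p. sqrt ((fst p $ Some l)\<^sup>2 + (fst p $ None)\<^sup>2))"
    proof (rule Cinf_on_sqrt_compose[OF V])
      show "Cinf_on V (\<lambda>p. (fst p $ Some l)\<^sup>2 + (fst p $ None)\<^sup>2)"
        unfolding power2_eq_square by (intro Cinf_intros V)
      show "0 < (fst p $ Some l)\<^sup>2 + (fst p $ None)\<^sup>2" if "p \<in> V" for p
        using that by (intro rpos) (simp add: V_def)
    qed
    then show "Cinf_on V (\<lambda>p. if i = l then sqrt ((fst p $ Some l)\<^sup>2 + (fst p $ None)\<^sup>2) else fst p $ Some i)"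
      by (cases "i = l") (auto intro!: Cinf_intros V)
  qed
  have "smooth_on V (\<lambda>p. (\<alpha> (fst p), (unspin l (fst p), snd p)))"
    by (intro smooth_on_openI V Cinf_intros \<alpha>C unspinC)
  moreover have "smooth_on (UNIV \<times> (halfspace l \<times> UNIV)) (\<lambda>(\<theta>, p). f \<theta> p)"
    using loop unfolding spinnable_family_loop_def by blast
  ultimately have "smooth_on V (\<lambda>p. (\<lambda>(\<theta>, p). f \<theta> p) (\<alpha> (fst p), (unspin l (fst p), snd p)))"
    by (rule smooth_on_compose) auto
  then have "smooth_on V F"
  proof (rule smooth_on_cong)
    fix p assume "p \<in> V"
    then have "F (fst p, snd p) = f (\<alpha> (fst p)) (unspin l (fst p), snd p)"
      by (intro F_unspin page) (simp add: V_def)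
    then show "(\<lambda>(\<theta>, p). f \<theta> p) (\<alpha> (fst p), (unspin l (fst p), snd p)) = F p" by simp
  qed
  moreover have "u X0 = ?r X0"
  proof -
    have "X0 $ Some l = ?r X0 * cos \<theta>" "X0 $ None = ?r X0 * sin \<theta>"
      by (subst \<theta>; simp)+
    then have "u X0 = ?r X0 * ((sin \<theta>)\<^sup>2 + (cos \<theta>)\<^sup>2)"
      unfolding u_def power2_eq_square by algebra
    then show ?thesis by simp
  qed
  then have "(X0, \<eta>) \<in> V"
    using assms unspin_in_halfspace[of l X0] by (simp add: V_def mem_halfspace)
  ultimately show ?thesis using V smooth_on_open by blast
qed

lemma Cinf_F: "Cinf_on UNIV F"
proof (rule Cinf_on_local)
  show "\<exists>V. open V \<and> p \<in> V \<and> Cinf_on V F" for p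
    using Cinf_near_binding[of "fst p" "snd p"] Cinf_off_binding[of "fst p" "snd p"] by auto
qed

section \<open>Gradients on a page and regularity\<close>

abbreviation "G \<equiv> fibre_grad F"
abbreviation "B \<equiv> base_grad UNIV F"

lemmas Cinf_G = Cinf_on_fibre_grad[OF Cinf_F]
  and Cinf_B = Cinf_on_base_grad[OF Cinf_F]

lemma G_has_derivative: "(G has_derivative frechet_derivative G (at p)) (at p)"
  using Cinf_on_has_derivative[OF Cinf_G] by simp

lemma F_has_derivative: "(F has_derivative (\<lambda>v. B p \<bullet> fst v + G p \<bullet> snd v)) (at p)"
proof -
  have "frechet_derivative F (at p) = (\<lambda>v. B p \<bullet> fst v + G p \<bullet> snd v)"
    by (rule ext) (rule derivative_eq_grads[OF Cinf_F])
  then show ?thesis using smooth_has_derivative[OF Cinf_F, of p] by simp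
qed

lemma fibre_grad_page: "x \<in> halfspace l \<Longrightarrow> fibre_grad (f \<theta>) (x, \<eta>) = G (page l \<theta> x, \<eta>)"
  by (simp add: fibre_grad_def F_page)

text \<open>Chain rule along the embedding of the page; \<open>halfspace_approach\<close> makes the
  derivative within the half-space unique at boundary points.\<close>

lemma base_grad_page:
  assumes x: "x \<in> halfspace l"
  shows "base_grad (halfspace l) (f \<theta>) (x, \<eta>) = unpage l \<theta> (B (page l \<theta> x, \<eta>))"
proof -
  let ?D = "\<lambda>v. B (page l \<theta> x, \<eta>) \<bullet> page l \<theta> v"
  have "((\<lambda>x. (page l \<theta> x, \<eta>)) has_derivative (\<lambda>v. (page l \<theta> v, 0))) (at x within halfspace l)"
    by (intro has_derivative_Pair has_derivative_const linear_imp_has_derivative page_linear)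
  from has_derivative_compose[OF this F_has_derivative]
  have "((\<lambda>x. F (page l \<theta> x, \<eta>)) has_derivative ?D) (at x within halfspace l)"
    by simp
  then have D: "((\<lambda>x. f \<theta> (x, \<eta>)) has_derivative ?D) (at x within halfspace l)"
    by (rule has_derivative_transform[rotated 2]) (use x F_page in auto)
  have "frechet_derivative (\<lambda>x. f \<theta> (x, \<eta>)) (at x within halfspace l) = ?D"
    by (rule frechet_derivative_unique_within[OF _ D halfspace_approach[OF x]])
      (use D frechet_derivative_works differentiable_def in blast)+
  then show ?thesis by (simp add: base_grad_def unpage_def)
qed

lemma generated_page:
  "(x, y, z) \<in> generated_legendrian (halfspace l) (f \<theta>) \<longleftrightarrow>
    x \<in> halfspace l \<and> (\<exists>\<eta>. G (page l \<theta> x, \<eta>) = 0 \<and> y = unpage l \<theta> (B (page l \<theta> x, \<eta>)) \<and> z = F (page l \<theta> x, \<eta>))"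
  by (auto simp: generated_legendrian_def fibre_grad_page base_grad_page F_page)

lemma page_pair_linear: "linear (\<lambda>v :: _ \<times> 'b::real_vector. (page l \<theta> (fst v), snd v))"
  by (rule linearI) (simp_all add: linear_add[OF page_linear] linear_cmul[OF page_linear])

text \<open>The regularity of \<open>f \<theta>\<close>, read on its page. It says more than
  surjectivity of the derivative of \<open>G\<close>: directions within the page suffice, that is,
  the critical set is transverse to the pages. This is what lets critical curves cross them.\<close>

lemma regular_page:
  assumes x: "x \<in> halfspace l" and crit: "G (page l \<theta> x, \<eta>) = 0"
  shows "surj (\<lambda>v. frechet_derivative G (at (page l \<theta> x, \<eta>)) (page l \<theta> (fst v), snd v))"
proof -
  have "regular_value (halfspace l \<times> UNIV) (fibre_grad (f \<theta>)) 0"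
    using loop unfolding spinnable_family_loop_def spinnable_family_def generating_family_def by blast
  then obtain D where D: "(fibre_grad (f \<theta>) has_derivative D) (at (x, \<eta>) within halfspace l \<times> UNIV)"
    and surj: "surj D"
    using x crit unfolding regular_value_def by (force simp: fibre_grad_page)
  have "((\<lambda>q. (page l \<theta> (fst q), snd q)) has_derivative (\<lambda>v. (page l \<theta> (fst v), snd v)))
      (at (x, \<eta>) within halfspace l \<times> UNIV)"
    by (intro linear_imp_has_derivative page_pair_linear)
  from has_derivative_compose[OF this G_has_derivative]
  have "((\<lambda>q. G (page l \<theta> (fst q), snd q)) has_derivative
      (\<lambda>v. frechet_derivative G (at (page l \<theta> x, \<eta>)) (page l \<theta> (fst v), snd v)))
      (at (x, \<eta>) within halfspace l \<times> UNIV)"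
    by simp
  then have "(fibre_grad (f \<theta>) has_derivative
      (\<lambda>v. frechet_derivative G (at (page l \<theta> x, \<eta>)) (page l \<theta> (fst v), snd v)))
      (at (x, \<eta>) within halfspace l \<times> UNIV)"
    by (rule has_derivative_transform[rotated 2]) (use x fibre_grad_page in auto)
  from frechet_derivative_unique_within[OF D this halfspace_product_approach] surj x
  show ?thesis by (simp add: mem_Times_iff)
qed

lemma generating_F: "generating_family UNIV F"
  unfolding generating_family_def regular_value_def
proof (intro conjI ballI impI)
  show "smooth_on (UNIV \<times> UNIV) F" using smooth_on_openI[OF open_UNIV Cinf_F] by simp
  fix p assume "G p = 0"
  obtain \<theta> where "fst p = page l \<theta> (unspin l (fst p))" using page_unspin_ex by blast
  then have p: "p = (page l \<theta> (unspin l (fst p)), snd p)" by (simp add: prod_eq_iff)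
  have "G (page l \<theta> (unspin l (fst p)), snd p) = 0"
    using \<open>G p = 0\<close> unfolding p[symmetric] .
  from regular_page[OF unspin_in_halfspace this]
  have "surj (frechet_derivative G (at p))"
    unfolding p[symmetric] surj_def by blast
  then show "\<exists>D. (G has_derivative D) (at p within UNIV \<times> UNIV) \<and> surj D"
    using G_has_derivative[of p] by auto
qed

section \<open>Behaviour at infinity and near the binding\<close>

lemma linear_outside_compact:
  obtains A K where "linear A" "A \<noteq> (\<lambda>\<eta>. 0)" "compact K" "K \<subseteq> halfspace l \<times> UNIV"
    "\<And>\<theta> x \<eta>. x \<in> halfspace l \<Longrightarrow> (x, \<eta>) \<notin> K \<Longrightarrow> f \<theta> (x, \<eta>) = A \<eta>"
  using loop unfolding spinnable_family_loop_def by blast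

lemma linear_at_infinity_F: "linear_at_infinity UNIV F"
proof -
  obtain A K where A: "linear A" "A \<noteq> (\<lambda>\<eta>. 0)" and K: "compact K" "K \<subseteq> halfspace l \<times> UNIV"
    and f: "\<And>\<theta> x \<eta>. x \<in> halfspace l \<Longrightarrow> (x, \<eta>) \<notin> K \<Longrightarrow> f \<theta> (x, \<eta>) = A \<eta>"
    using linear_outside_compact by metis
  let ?K = "(\<lambda>(\<theta>, p). (page l \<theta> (fst p), snd p)) ` ({0..2 * pi} \<times> K)"
  have "Cinf_on UNIV (\<lambda>q :: real \<times> (real^'n) \<times> (real^'N). (page l (fst q) (fst (snd q)), snd (snd q)))"
    by (intro Cinf_intros open_UNIV)
  then have "continuous_on ({0..2 * pi} \<times> K) (\<lambda>(\<theta>, p). (page l \<theta> (fst p), snd p))"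
    unfolding case_prod_unfold using Cinf_on_continuous continuous_on_subset by blast
  then have "compact ?K"
    using K by (intro compact_continuous_image compact_Times compact_Icc)
  moreover have "F (X, \<eta>) = A \<eta>" if "(X, \<eta>) \<notin> ?K" for X \<eta>
  proof -
    obtain \<theta> where \<theta>: "0 \<le> \<theta>" "\<theta> \<le> 2 * pi" "X = page l \<theta> (unspin l X)"
      using page_unspin_ex by blast
    have "(unspin l X, \<eta>) \<notin> K"
    proof
      assume "(unspin l X, \<eta>) \<in> K"
      then have "(\<lambda>(\<theta>, p). (page l \<theta> (fst p), snd p)) (\<theta>, (unspin l X, \<eta>)) \<in> ?K"
        using \<theta>(1,2) by (intro imageI) simp
      then show False using that \<theta>(3) by simp
    qed
    then show ?thesis using F_unspin[OF \<theta>(3)] f by simp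
  qed
  ultimately show ?thesis
    unfolding linear_at_infinity_def using A by (intro exI[of _ A] exI[of _ ?K]) auto
qed

text \<open>Critical points lie in \<open>K\<close>, since outside it the fibre derivative is the
  nonzero map \<open>A\<close>. What remains of \<open>K\<close> outside the open set
  \<open>steady\<close> is compact and misses the binding, so its last coordinate has a positive
  lower bound, uniform in \<theta>.\<close>

lemma critical_near_binding:
  obtains \<delta> where "\<delta> > 0"
    "\<And>\<theta> x \<eta>. x \<in> halfspace l \<Longrightarrow> G (page l \<theta> x, \<eta>) = 0 \<Longrightarrow> x $ l < \<delta> \<Longrightarrow> (x, \<eta>) \<in> steady"
proof -
  obtain A K where A: "linear A" "A \<noteq> (\<lambda>\<eta>. 0)" and K: "compact K" "K \<subseteq> halfspace l \<times> UNIV"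
    and f: "\<And>\<theta> x \<eta>. x \<in> halfspace l \<Longrightarrow> (x, \<eta>) \<notin> K \<Longrightarrow> f \<theta> (x, \<eta>) = A \<eta>"
    using linear_outside_compact by metis
  have crit: "(x, \<eta>) \<in> K" if x: "x \<in> halfspace l" and "G (page l \<theta> x, \<eta>) = 0" for x \<theta> \<eta>
  proof (rule ccontr)
    assume nK: "(x, \<eta>) \<notin> K"
    let ?V = "(\<lambda>\<eta>'. (x, \<eta>')) -` (- K)"
    have V: "open ?V"
      using K(1) compact_imp_closed by (intro open_vimage) (auto intro!: continuous_intros)
    have "((\<lambda>\<eta>. F (page l \<theta> x, \<eta>)) has_derivative A) (at \<eta>)"
    proof (rule has_derivative_transform_within_open[OF linear_imp_has_derivative[OF A(1)] V])
      show "A \<eta>' = F (page l \<theta> x, \<eta>')" if "\<eta>' \<in> ?V" for \<eta>'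
        using f[OF x, of \<eta>' \<theta>] F_page[OF x, of \<theta> \<eta>'] that by simp
    qed (use nK in simp)
    then have "A = (\<lambda>w. frechet_derivative F (at (page l \<theta> x, \<eta>)) (0, w))"
      using fibre_slice_has_derivative[OF Cinf_F, of "page l \<theta> x" \<eta>] has_derivative_unique by blast
    then have "A = (\<lambda>w. 0)"
      using that(2) by (simp add: fibre_grad_inner[OF Cinf_F, symmetric])
    then show False using A(2) by simp
  qed
  let ?C = "(\<lambda>p. fst p $ l) ` (K - steady)"
  have cpt: "compact ?C"
    using K(1) open_steady
    by (intro compact_continuous_image compact_diff) (auto intro!: continuous_intros)
  have pos: "c > 0" if c: "c \<in> ?C" for c
  proof -
    from c obtain p where p: "p \<in> K" "p \<notin> steady" "c = fst p $ l" by blast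
    then have "fst p $ l \<noteq> 0" using axis_steady[of "fst p" "snd p"] by auto
    moreover have "0 \<le> fst p $ l" using p(1) K(2) by (auto simp: mem_halfspace)
    ultimately show ?thesis using p(3) by simp
  qed
  obtain \<delta> where \<delta>: "\<delta> > 0" "\<And>c. c \<in> ?C \<Longrightarrow> \<delta> \<le> c"
  proof (cases "?C = {}")
    case False
    from compact_attains_inf[OF cpt this] obtain c where "c \<in> ?C" "\<forall>t\<in>?C. c \<le> t" by blast
    then show ?thesis using that[of c] pos[of c] by (metis (lifting))
  next
    case True
    show ?thesis by (rule that[of 1]) (simp_all only: True zero_less_one empty_iff)
  qed
  show ?thesis
  proof (rule that[OF \<delta>(1)])
    fix \<theta> x \<eta>
    assume x: "x \<in> halfspace l" "G (page l \<theta> x, \<eta>) = 0" "x $ l < \<delta>"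
    show "(x, \<eta>) \<in> steady"
    proof (rule ccontr)
      assume "(x, \<eta>) \<notin> steady"
      then have "x $ l \<in> ?C" using crit[OF x(1,2)] by (intro image_eqI[of _ _ "(x, \<eta>)"]) simp_all
      then show False using \<delta>(2) x(3) by (meson not_le)
    qed
  qed
qed

lemma steady_segment:
  assumes "x \<in> halfspace l" "x $ l = 0"
  obtains \<epsilon> where "\<epsilon> > 0"
    "\<And>t. 0 \<le> t \<Longrightarrow> t < \<epsilon> \<Longrightarrow> (x + t *\<^sub>R axis l 1, \<eta>) \<in> steady \<and> x + t *\<^sub>R axis l 1 \<in> halfspace l"
proof -
  have "open ((\<lambda>t. (x + t *\<^sub>R axis l 1, \<eta>)) -` steady)"
    using open_steady by (rule open_vimage) (intro continuous_intros)
  moreover have "0 \<in> (\<lambda>t. (x + t *\<^sub>R axis l 1, \<eta>)) -` steady"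
    using axis_steady[OF assms(2)] by simp
  ultimately obtain \<epsilon> where \<epsilon>: "\<epsilon> > 0" "ball 0 \<epsilon> \<subseteq> (\<lambda>t. (x + t *\<^sub>R axis l 1, \<eta>)) -` steady"
    using open_contains_ball by blast
  show ?thesis
  proof (rule that[OF \<epsilon>(1)])
    fix t :: real assume "0 \<le> t" "t < \<epsilon>"
    then have "t \<in> ball 0 \<epsilon>" by simp
    from subsetD[OF \<epsilon>(2) this] show "(x + t *\<^sub>R axis l 1, \<eta>) \<in> steady \<and> x + t *\<^sub>R axis l 1 \<in> halfspace l"
      using assms \<open>0 \<le> t\<close> by (auto simp: mem_halfspace)
  qed
qed

text \<open>The slice of \<open>steady\<close> over \<open>x\<close> is a neighbourhood of \<eta>,
  on which the two functions of the fibre variable coincide.\<close>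

lemma G_steady:
  assumes "(x, \<eta>) \<in> steady" "x \<in> halfspace l"
  shows "G (page l \<theta> x, \<eta>) = G (page l \<phi> x, \<eta>)"
proof -
  let ?V = "(\<lambda>\<eta>'. (x, \<eta>')) -` steady"
  have V: "open ?V" using open_steady by (rule open_vimage) (intro continuous_intros)
  have "frechet_derivative (\<lambda>\<eta>. f \<theta> (x, \<eta>)) (at \<eta>) = frechet_derivative (\<lambda>\<eta>. f \<phi> (x, \<eta>)) (at \<eta>)"
    by (rule frechet_derivative_cong_open[OF V]) (use assms steady_eq in auto)
  then have "fibre_grad (f \<theta>) (x, \<eta>) = fibre_grad (f \<phi>) (x, \<eta>)"
    by (simp add: fibre_grad_def)
  then show ?thesis using fibre_grad_page[OF assms(2)] by metis
qed

text \<open>Needed to leave the binding: as radial directions contribute nothing to the derivative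
  of \<open>G\<close>, its surjectivity comes from directions along the binding and the fibre
  alone.\<close>

lemma G_radial_zero:
  assumes "x \<in> halfspace l" "x $ l = 0"
  shows "frechet_derivative G (at (page l \<theta> x, \<eta>)) (page l \<phi> (axis l 1), 0) = 0"
proof -
  obtain \<epsilon> where \<epsilon>: "\<epsilon> > 0"
    "\<And>t. 0 \<le> t \<Longrightarrow> t < \<epsilon> \<Longrightarrow> (x + t *\<^sub>R axis l 1, \<eta>) \<in> steady \<and> x + t *\<^sub>R axis l 1 \<in> halfspace l"
    using steady_segment[OF assms] by metis
  show ?thesis
    by (rule binding_derivative_zero[OF G_has_derivative assms(2) \<epsilon>(1),
        where q = "\<lambda>t. G (page l 0 (x + t *\<^sub>R axis l 1), \<eta>)"]) (use \<epsilon>(2) G_steady in blast)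
qed

text \<open>Off the binding, \<open>F\<close> is constant along the rotation of the point, and the
  angular derivative is \<open>x $ l\<close> times the normal one. On the binding this reads 0 = 0;
  there the normal is itself the radial vector of another page, and radial derivatives
  vanish.\<close>

lemma normal_derivative_steady:
  assumes "(x, \<eta>) \<in> steady" "x \<in> halfspace l"
  shows "B (page l \<theta> x, \<eta>) \<bullet> page_normal l \<theta> = 0"
proof (cases "x $ l = 0")
  case True
  obtain \<epsilon> where \<epsilon>: "\<epsilon> > 0"
    "\<And>t. 0 \<le> t \<Longrightarrow> t < \<epsilon> \<Longrightarrow> (x + t *\<^sub>R axis l 1, \<eta>) \<in> steady \<and> x + t *\<^sub>R axis l 1 \<in> halfspace l"
    using steady_segment[OF assms(2) True] by metis
  have "(\<lambda>v. B (page l \<theta> x, \<eta>) \<bullet> fst v + G (page l \<theta> x, \<eta>) \<bullet> snd v) (page l (\<theta> + pi / 2) (axis l 1), 0) = 0"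
    by (rule binding_derivative_zero[OF F_has_derivative True \<epsilon>(1),
        where q = "\<lambda>t. F (page l 0 (x + t *\<^sub>R axis l 1), \<eta>)"]) (use \<epsilon>(2) F_page steady_eq in \<open>metis fst_conv\<close>)
  then show ?thesis by (simp add: page_normal_def)
next
  case False
  have "((\<lambda>\<phi>. (\<phi>, x)) has_derivative (\<lambda>s. (s, 0))) (at \<theta>)"
    by (auto intro!: derivative_eq_intros)
  from has_derivative_compose[OF this has_derivative_page[of l]]
  have "((\<lambda>\<phi>. page l \<phi> x) has_derivative (\<lambda>s. (s * x $ l) *\<^sub>R page_normal l \<theta>)) (at \<theta>)"
    by (simp add: linear_0[OF page_linear])
  then have "((\<lambda>\<phi>. (page l \<phi> x, \<eta>)) has_derivative (\<lambda>s. ((s * x $ l) *\<^sub>R page_normal l \<theta>, 0))) (at \<theta>)"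
    by (intro has_derivative_Pair has_derivative_const)
  from has_derivative_compose[OF this F_has_derivative]
  have "((\<lambda>\<phi>. F (page l \<phi> x, \<eta>)) has_derivative
      (\<lambda>s. s * x $ l * (B (page l \<theta> x, \<eta>) \<bullet> page_normal l \<theta>))) (at \<theta>)"
    by simp
  moreover have "(\<lambda>\<phi>. F (page l \<phi> x, \<eta>)) = (\<lambda>\<phi>. f 0 (x, \<eta>))"
    using F_page[OF assms(2)] steady_eq[OF assms(1)] assms(2) by (metis fst_conv)
  ultimately have "(\<lambda>s. s * x $ l * (B (page l \<theta> x, \<eta>) \<bullet> page_normal l \<theta>)) = (\<lambda>s. 0)"
    using has_derivative_unique has_derivative_const by metis
  from fun_cong[OF this, of 1] show ?thesis using False by simp
qed

text \<open>A path with angular speed \<open>a\<close> and radial speed \<open>b\<close> is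
  prescribed, and a correction \<open>\<sigma> t\<close>, fed through a right inverse of the
  derivative of \<open>G\<close>, restores criticality. The pair (1, 0) crosses the pages; (0, 1)
  leaves the binding within a page.\<close>

lemma critical_curve_general:
  assumes crit: "G (page l \<theta> x, \<eta>) = 0" and R: "linear R1" "linear R2"
    and inv: "\<And>s. frechet_derivative G (at (page l \<theta> x, \<eta>)) (page l \<theta> (R1 s), R2 s) = s"
  obtains \<sigma> \<sigma>' \<epsilon> where "\<epsilon> > 0" "\<sigma> 0 = 0" "(\<sigma> has_vector_derivative \<sigma>') (at 0)"
    "\<And>t. \<bar>t\<bar> < \<epsilon> \<Longrightarrow> G (page l (\<theta> + a * t) (x + (b * t) *\<^sub>R axis l 1 + R1 (\<sigma> t)), \<eta> + R2 (\<sigma> t)) = 0"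
proof -
  define H where "H = (\<lambda>q. G (page l (\<theta> + a * fst q) (x + (b * fst q) *\<^sub>R axis l 1 + R1 (snd q)), \<eta> + R2 (snd q)))"
  have bl: "bounded_linear R1" "bounded_linear R2" using R by (simp_all add: linear_conv_bounded_linear)
  have "Cinf_on UNIV (\<lambda>q. (page l (\<theta> + a * fst q) (x + (b * fst q) *\<^sub>R axis l 1 + R1 (snd q)), \<eta> + R2 (snd q)))"
    by (intro Cinf_intros open_UNIV Cinf_on_bounded_linear[OF bl(1)] Cinf_on_bounded_linear[OF bl(2)])
  then have H: "Cinf_on UNIV H"
    unfolding H_def by (rule Cinf_on_compose[OF open_UNIV open_UNIV subset_UNIV _ Cinf_G])
  have H': "(H has_derivative frechet_derivative H (at (0, 0))) (at (0, 0))"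
    using Cinf_on_has_derivative[OF H] by simp
  have R0: "R1 0 = 0" "R2 0 = 0" using R linear_0 by blast+
  \<comment> \<open>At time 0 only the correction varies, and the right inverse turns the derivative
    of \<open>G\<close> along it into the identity.\<close>
  have id: "frechet_derivative H (at (0, 0)) (0, s) = s" for s
  proof -
    have "((\<lambda>s. (0, s)) has_derivative (\<lambda>s. (0, s))) (at 0)"
      by (auto intro!: derivative_eq_intros)
    from has_derivative_compose[OF this H']
    have 1: "((\<lambda>s. H (0, s)) has_derivative (\<lambda>s. frechet_derivative H (at (0, 0)) (0, s))) (at 0)" .
    have "linear (\<lambda>s. (page l \<theta> (R1 s), R2 s))"
      by (rule linearI) (simp_all add: linear_add[OF R(1)] linear_add[OF R(2)] linear_cmul[OF R(1)]
          linear_cmul[OF R(2)] linear_add[OF page_linear] linear_cmul[OF page_linear])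
    then have "((\<lambda>s. (page l \<theta> x, \<eta>) + (page l \<theta> (R1 s), R2 s)) has_derivative
        (\<lambda>s. 0 + (page l \<theta> (R1 s), R2 s))) (at 0)"
      by (intro has_derivative_add has_derivative_const linear_imp_has_derivative)
    then have "((\<lambda>s. (page l \<theta> (x + R1 s), \<eta> + R2 s)) has_derivative
        (\<lambda>s. (page l \<theta> (R1 s), R2 s))) (at 0)"
      by (simp add: linear_add[OF page_linear])
    from has_derivative_compose[OF this, of G "frechet_derivative G (at (page l \<theta> x, \<eta>))"]
    have 2: "((\<lambda>s. H (0, s)) has_derivative (\<lambda>s. s)) (at 0)"
      using G_has_derivative by (simp add: R0 inv H_def)
    from has_derivative_unique[OF 1 2] show ?thesis by metis
  qed
  have "H (0, 0) = 0" by (simp add: H_def R0 crit)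
  from implicit_curve[OF H this id] obtain \<sigma> \<sigma>' \<epsilon> where "\<epsilon> > 0" "\<sigma> 0 = 0"
    "(\<sigma> has_vector_derivative \<sigma>') (at 0)" "\<And>t. \<bar>t\<bar> < \<epsilon> \<Longrightarrow> H (t, \<sigma> t) = 0" by metis
  then show ?thesis using that unfolding H_def by simp
qed

lemma regular_right_inverse:
  assumes "x \<in> halfspace l" "G (page l \<theta> x, \<eta>) = 0"
  obtains R1 R2 where "linear R1" "linear R2"
    "\<And>s. frechet_derivative G (at (page l \<theta> x, \<eta>)) (page l \<theta> (R1 s), R2 s) = s"
proof -
  have "linear (\<lambda>v :: (real^'n) \<times> (real^'N). frechet_derivative G (at (page l \<theta> x, \<eta>)) (page l \<theta> (fst v), snd v))"
    using linear_compose[OF page_pair_linear has_derivative_linear[OF G_has_derivative]]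
    by (simp add: o_def)
  from linear_surjective_right_inverse[OF this regular_page[OF assms]]
  obtain R where R: "linear R"
    "(\<lambda>v. frechet_derivative G (at (page l \<theta> x, \<eta>)) (page l \<theta> (fst v), snd v)) \<circ> R = id" by blast
  show ?thesis
  proof (rule that)
    show "linear (\<lambda>s. fst (R s))" "linear (\<lambda>s. snd (R s))"
      using linear_compose[OF R(1) linear_fst] linear_compose[OF R(1) linear_snd] by (simp_all add: o_def)
    show "frechet_derivative G (at (page l \<theta> x, \<eta>)) (page l \<theta> (fst (R s)), snd (R s)) = s" for s
      using fun_cong[OF R(2), of s] by simp
  qed
qed

text \<open>Off the binding this is the implicit curve of unit angular speed, cut short so that the
  last coordinate stays positive. On the binding rotation fixes the point, and the constant curve
  serves.\<close>

lemma critical_curve: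
  assumes x: "x \<in> halfspace l" and crit: "G (page l \<theta> x, \<eta>) = 0"
  obtains \<epsilon> c e c' e' where "\<epsilon> > 0" "c 0 = x" "e 0 = \<eta>"
    "(c has_vector_derivative c') (at 0 within {0..<\<epsilon>})"
    "(e has_vector_derivative e') (at 0 within {0..<\<epsilon>})"
    "\<And>t. t \<in> {0..<\<epsilon>} \<Longrightarrow> c t \<in> halfspace l \<and> G (page l (\<theta> + t) (c t), e t) = 0"
proof (cases "x $ l = 0")
  case True
  have "page l (\<theta> + t) x = page l \<theta> x" for t
    using True by (auto simp: vec_option_eq_iff)
  then show ?thesis
    using that[of 1 "\<lambda>t. x" "\<lambda>t. \<eta>" 0 0] x crit by simp
next
  case False
  obtain R1 R2 where R: "linear R1" "linear R2"
    and inv: "\<And>s. frechet_derivative G (at (page l \<theta> x, \<eta>)) (page l \<theta> (R1 s), R2 s) = s"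
    using regular_right_inverse[OF x crit] by metis
  obtain \<sigma> \<sigma>' \<epsilon> where \<epsilon>: "\<epsilon> > 0" "\<sigma> 0 = 0" and \<sigma>': "(\<sigma> has_vector_derivative \<sigma>') (at 0)"
    and \<sigma>: "\<And>t. \<bar>t\<bar> < \<epsilon> \<Longrightarrow> G (page l (\<theta> + 1 * t) (x + (0 * t) *\<^sub>R axis l 1 + R1 (\<sigma> t)), \<eta> + R2 (\<sigma> t)) = 0"
    using critical_curve_general[OF crit R inv, of 1 0] by metis
  have bl: "bounded_linear R1" "bounded_linear R2" using R by (simp_all add: linear_conv_bounded_linear)
  have c': "((\<lambda>t. x + R1 (\<sigma> t)) has_vector_derivative R1 \<sigma>') (at 0)"
    and e': "((\<lambda>t. \<eta> + R2 (\<sigma> t)) has_vector_derivative R2 \<sigma>') (at 0)"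
    using bounded_linear.has_vector_derivative[OF bl(1) \<sigma>'] bounded_linear.has_vector_derivative[OF bl(2) \<sigma>']
    by (auto intro!: derivative_eq_intros)
  have c0: "x + R1 (\<sigma> 0) = x" "\<eta> + R2 (\<sigma> 0) = \<eta>" using \<epsilon>(2) R linear_0 by force+
  have "isCont (\<lambda>t. (x + R1 (\<sigma> t)) $ l) 0"
    by (rule bounded_linear.isCont[OF bounded_linear_vec_nth has_vector_derivative_continuous[OF c']])
  moreover have "0 < (x + R1 (\<sigma> 0)) $ l" using False x c0 by (simp add: mem_halfspace)
  ultimately have "eventually (\<lambda>t. 0 < (x + R1 (\<sigma> t)) $ l) (at 0)"
    unfolding isCont_def by (rule order_tendstoD)
  then obtain d where d: "d > 0" "\<And>t. t \<noteq> 0 \<Longrightarrow> \<bar>t\<bar> < d \<Longrightarrow> 0 < (x + R1 (\<sigma> t)) $ l"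
    by (auto simp: eventually_at dist_real_def)
  show ?thesis
  proof (rule that[of "min \<epsilon> d" "\<lambda>t. x + R1 (\<sigma> t)" "\<lambda>t. \<eta> + R2 (\<sigma> t)"])
    fix t assume t: "t \<in> {0..<min \<epsilon> d}"
    then have "x + R1 (\<sigma> t) \<in> halfspace l"
      using d(2)[of t] c0 x by (cases "t = 0") (auto simp: mem_halfspace)
    then show "x + R1 (\<sigma> t) \<in> halfspace l \<and> G (page l (\<theta> + t) (x + R1 (\<sigma> t)), \<eta> + R2 (\<sigma> t)) = 0"
      using \<sigma>[of t] t by simp
  qed (use \<epsilon> d c0 c' e' in \<open>auto intro: has_vector_derivative_at_within\<close>)
qed

text \<open>The correction is chosen without last coordinate, so that the last coordinate at time
  \<open>t\<close> is exactly \<open>t\<close> and the curve really leaves the binding.\<close>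

lemma critical_curve_off_binding:
  assumes x: "x \<in> halfspace l" "x $ l = 0" and crit: "G (page l \<theta> x, \<eta>) = 0"
  obtains \<epsilon> :: real and c e where "\<epsilon> > 0" "(c \<longlongrightarrow> x) (at_right 0)" "(e \<longlongrightarrow> \<eta>) (at_right 0)"
    "\<And>t. t \<in> {0<..<\<epsilon>} \<Longrightarrow> c t \<in> halfspace l \<and> c t $ l > 0 \<and> G (page l \<theta> (c t), e t) = 0"
proof -
  let ?D = "frechet_derivative G (at (page l \<theta> x, \<eta>))"
  obtain R1 R2 where R: "linear R1" "linear R2"
    and inv: "\<And>s. ?D (page l \<theta> (R1 s), R2 s) = s"
    using regular_right_inverse[OF x(1) crit] by metis
  \<comment> \<open>Removing the radial part of \<open>R1\<close> does not spoil the right inverse,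
    as radial derivatives of \<open>G\<close> vanish on the binding.\<close>
  let ?R = "\<lambda>s. R1 s - (R1 s $ l) *\<^sub>R axis l 1"
  have R': "linear ?R"
    by (rule linearI) (simp_all add: linear_add[OF R(1)] linear_cmul[OF R(1)] algebra_simps)
  have inv': "?D (page l \<theta> (?R s), R2 s) = s" for s
  proof -
    have "(page l \<theta> (?R s), R2 s) = (page l \<theta> (R1 s), R2 s) - (R1 s $ l) *\<^sub>R (page l \<theta> (axis l 1), 0)"
      by (simp add: linear_diff[OF page_linear] linear_cmul[OF page_linear])
    then show ?thesis
      by (simp only: linear_diff[OF has_derivative_linear[OF G_has_derivative]] inv
          linear_cmul[OF has_derivative_linear[OF G_has_derivative]] G_radial_zero[OF x]) simp
  qed
  obtain \<sigma> \<sigma>' \<epsilon> where \<epsilon>: "\<epsilon> > 0" "\<sigma> 0 = 0" and \<sigma>': "(\<sigma> has_vector_derivative \<sigma>') (at 0)"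
    and \<sigma>: "\<And>t. \<bar>t\<bar> < \<epsilon> \<Longrightarrow> G (page l (\<theta> + 0 * t) (x + (1 * t) *\<^sub>R axis l 1 + ?R (\<sigma> t)), \<eta> + R2 (\<sigma> t)) = 0"
    using critical_curve_general[OF crit R' R(2) inv', of 0 1] by metis
  have bl: "bounded_linear ?R" "bounded_linear R2" using R R' by (simp_all add: linear_conv_bounded_linear)
  have R0: "?R 0 = 0" "R2 0 = 0" using R R' linear_0 by blast+
  have \<sigma>0: "(\<sigma> \<longlongrightarrow> 0) (at_right 0)"
    using has_vector_derivative_continuous[OF \<sigma>'] \<epsilon>(2)
    by (auto simp: isCont_def intro: tendsto_mono[OF at_le])
  have 1: "((\<lambda>t. ?R (\<sigma> t)) \<longlongrightarrow> 0) (at_right 0)" and 2: "((\<lambda>t. R2 (\<sigma> t)) \<longlongrightarrow> 0) (at_right 0)"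
    using bounded_linear.tendsto[OF bl(1) \<sigma>0] bounded_linear.tendsto[OF bl(2) \<sigma>0] by (simp_all only: R0)
  show ?thesis
  proof (rule that[OF \<epsilon>(1)])
    have "((\<lambda>t. x + t *\<^sub>R axis l 1 + ?R (\<sigma> t)) \<longlongrightarrow> x + 0 *\<^sub>R axis l 1 + 0) (at_right 0)"
      by (intro tendsto_intros 1)
    then show "((\<lambda>t. x + t *\<^sub>R axis l 1 + ?R (\<sigma> t)) \<longlongrightarrow> x) (at_right 0)" by simp
    have "((\<lambda>t. \<eta> + R2 (\<sigma> t)) \<longlongrightarrow> \<eta> + 0) (at_right 0)"
      by (intro tendsto_intros 2)
    then show "((\<lambda>t. \<eta> + R2 (\<sigma> t)) \<longlongrightarrow> \<eta>) (at_right 0)" by simp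
    fix t assume t: "t \<in> {0<..<\<epsilon>}"
    then show "x + t *\<^sub>R axis l 1 + ?R (\<sigma> t) \<in> halfspace l \<and> (x + t *\<^sub>R axis l 1 + ?R (\<sigma> t)) $ l > 0 \<and>
        G (page l \<theta> (x + t *\<^sub>R axis l 1 + ?R (\<sigma> t)), \<eta> + R2 (\<sigma> t)) = 0"
      using \<sigma>[of t] x by (simp add: mem_halfspace)
  qed
qed

end

section \<open>Curves in Legendrian submanifolds\<close>

lemma diffeomorphismD:
  assumes "diffeomorphism S T f g"
  shows "\<And>x. x \<in> S \<Longrightarrow> f x \<in> T" "\<And>y. y \<in> T \<Longrightarrow> g y \<in> S"
    "\<And>x. x \<in> S \<Longrightarrow> g (f x) = x" "\<And>y. y \<in> T \<Longrightarrow> f (g y) = y"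
    "smooth_on S f" "smooth_on T g"
  using assms unfolding diffeomorphism_def homeomorphism_def by auto

lemma diffeomorphismI:
  fixes f :: "'a::euclidean_space \<Rightarrow> 'b::euclidean_space"
  assumes "\<And>x. x \<in> S \<Longrightarrow> f x \<in> T" "\<And>y. y \<in> T \<Longrightarrow> g y \<in> S"
    "\<And>x. x \<in> S \<Longrightarrow> g (f x) = x" "\<And>y. y \<in> T \<Longrightarrow> f (g y) = y"
    "smooth_on S f" "smooth_on T g"
  shows "diffeomorphism S T f g"
  unfolding diffeomorphism_def
  using assms by (auto intro!: homeomorphismI smooth_on_continuous)

text \<open>\<open>V\<close> is only relatively open, so the curve has to lie in \<open>T\<close>;
  continuity then keeps it in \<open>V\<close> for a short time, during which the inverse chart can
  be applied.\<close>

lemma inverse_chart_curve: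
  fixes p :: "real \<Rightarrow> 'b::euclidean_space"
  assumes diff: "diffeomorphism U V \<psi> \<kappa>" and V: "openin (top_of_set T) V" and "p 0 \<in> V" "\<epsilon> > 0"
    and pT: "\<And>t. t \<in> {0..<\<epsilon>} \<Longrightarrow> p t \<in> T"
    and p': "(p has_vector_derivative p') (at 0 within {0..<\<epsilon>})"
  obtains d q' where "0 < d" "d \<le> \<epsilon>" "\<And>t. t \<in> {0..<d} \<Longrightarrow> p t \<in> V"
    "((\<lambda>t. \<kappa> (p t)) has_vector_derivative q') (at 0 within {0..<d})"
proof -
  obtain N where N: "open N" "V = T \<inter> N" using V openin_open by metis
  have "continuous (at 0 within {0..<\<epsilon>}) p"
    using p' has_vector_derivative_continuous by blast
  moreover have "p 0 \<in> N" using N assms(3) by simp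
  ultimately have "eventually (\<lambda>t. p t \<in> N) (at 0 within {0..<\<epsilon>})"
    using N(1) unfolding continuous_within by (metis topological_tendstoD)
  then obtain r where r: "r > 0" "\<And>t. t \<in> {0..<\<epsilon>} \<Longrightarrow> t \<noteq> 0 \<Longrightarrow> \<bar>t\<bar> < r \<Longrightarrow> p t \<in> N"
    by (auto simp: eventually_at dist_real_def)
  define d where "d = min \<epsilon> r"
  have d: "0 < d" "d \<le> \<epsilon>" using r(1) assms(4) by (auto simp: d_def)
  have pV: "p t \<in> V" if "t \<in> {0..<d}" for t
    using that r(2)[of t] pT[of t] assms(3) N(2) by (cases "t = 0") (auto simp: d_def)
  obtain D where D: "(\<kappa> has_derivative D) (at (p 0) within V)"
    using smooth_on_has_derivative[OF diffeomorphismD(6)[OF diff] assms(3)] by blast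
  have "(p has_vector_derivative p') (at 0 within {0..<d})"
    using p' by (rule has_vector_derivative_within_subset) (use d in auto)
  from has_vector_derivative_compose_within[OF this D]
  have "((\<lambda>t. \<kappa> (p t)) has_vector_derivative D p') (at 0 within {0..<d})"
    using pV by blast
  then show ?thesis using that d pV by blast
qed

lemma legendrian_chartE:
  assumes "legendrian_submanifold l \<Lambda>" "p \<in> \<Lambda>"
  obtains U V \<psi> \<kappa> where "openin (top_of_set (halfspace l)) U" "openin (top_of_set \<Lambda>) V" "p \<in> V"
    "diffeomorphism U V \<psi> \<kappa>" "isotropic_on U \<psi>"
proof -
  have "\<forall>p\<in>\<Lambda>. \<exists>U V \<psi> \<kappa>. openin (top_of_set (halfspace l)) U \<and> openin (top_of_set \<Lambda>) V \<and> p \<in> V \<and>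
      diffeomorphism U V \<psi> \<kappa> \<and> isotropic_on U \<psi> \<and> (\<forall>q\<in>U. q $ l = 0 \<longleftrightarrow> fst (\<psi> q) $ l = 0)"
    using assms(1) unfolding legendrian_submanifold_def by (elim conjE)
  from bspec[OF this assms(2)] show ?thesis
    by (elim exE conjE) (rule that)
qed

lemma contact_form_linear: "linear (contact_form p)"
  by (rule linearI) (auto simp: contact_form_def algebra_simps inner_add_right)

text \<open>A short piece of the curve is pulled back by a chart and pushed forward again, so its
  velocity lies in the image of the derivative of the chart, where the contact form
  vanishes.\<close>

lemma legendrian_curve:
  assumes "legendrian_submanifold l \<Lambda>" "\<epsilon> > 0"
    and p\<Lambda>: "\<And>t. t \<in> {0..<\<epsilon>} \<Longrightarrow> p t \<in> \<Lambda>"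
    and p': "(p has_vector_derivative p') (at 0 within {0..<\<epsilon>})"
  shows "contact_form (p 0) p' = 0"
proof -
  have "p 0 \<in> \<Lambda>" using p\<Lambda> assms(2) by simp
  from legendrian_chartE[OF assms(1) this] obtain U V \<psi> \<kappa>
    where "openin (top_of_set (halfspace l)) U" and V: "openin (top_of_set \<Lambda>) V" "p 0 \<in> V"
      and diff: "diffeomorphism U V \<psi> \<kappa>" and iso: "isotropic_on U \<psi>" .
  from inverse_chart_curve[OF diff V assms(2) p\<Lambda> p']
  obtain d q' where d: "0 < d" "d \<le> \<epsilon>" and pV: "\<And>t. t \<in> {0..<d} \<Longrightarrow> p t \<in> V"
    and q': "((\<lambda>t. \<kappa> (p t)) has_vector_derivative q') (at 0 within {0..<d})" by blast
  have q0: "\<kappa> (p 0) \<in> U" and \<psi>q0: "\<psi> (\<kappa> (p 0)) = p 0"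
    using diffeomorphismD[OF diff] V(2) by auto
  obtain D where D: "(\<psi> has_derivative D) (at (\<kappa> (p 0)) within U)"
    and contact: "\<And>v. contact_form (\<psi> (\<kappa> (p 0))) (D v) = 0"
    using bspec[OF iso[unfolded isotropic_on_def] q0] by blast
  have "((\<lambda>t. \<psi> (\<kappa> (p t))) has_vector_derivative D q') (at 0 within {0..<d})"
    by (rule has_vector_derivative_compose_within[OF q' D]) (use pV diffeomorphismD(2)[OF diff] in blast)
  then have "(p has_vector_derivative D q') (at 0 within {0..<d})"
    by (rule has_vector_derivative_transform[rotated 2]) (use d pV diffeomorphismD(4)[OF diff] in auto)
  moreover have "(p has_vector_derivative p') (at 0 within {0..<d})"
    using p' by (rule has_vector_derivative_within_subset) (use d in auto)
  ultimately have "p' = D q'"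
    using has_vector_derivative_unique_right d(1) by metis
  then show ?thesis using contact \<psi>q0 by simp
qed

lemma spin_liftD:
  assumes "spin_lift l J U \<psi> \<Psi>" "\<theta> \<in> J" "q \<in> U"
  shows "fst (\<Psi> (\<theta>, q)) = page l \<theta> (fst (\<psi> (\<theta>, q)))"
    "snd (snd (\<Psi> (\<theta>, q))) = snd (snd (\<psi> (\<theta>, q)))"
    "fst (snd (\<Psi> (\<theta>, q))) \<bullet> page l \<theta> v = fst (snd (\<psi> (\<theta>, q))) \<bullet> v"
proof -
  have "\<forall>\<theta>\<in>J. \<forall>q\<in>U. case (\<psi> (\<theta>, q), \<Psi> (\<theta>, q)) of ((x, y, z), (X, Y, Z)) \<Rightarrow>
      X = page l \<theta> x \<and> Z = z \<and> (\<forall>v. Y \<bullet> page l \<theta> v = y \<bullet> v)"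
    using assms(1) unfolding spin_lift_def by (elim conjE)
  from bspec[OF bspec[OF this assms(2)] assms(3)]
  have *: "fst (\<Psi> (\<theta>, q)) = page l \<theta> (fst (\<psi> (\<theta>, q))) \<and> snd (snd (\<Psi> (\<theta>, q))) = snd (snd (\<psi> (\<theta>, q))) \<and>
      (\<forall>v. fst (snd (\<Psi> (\<theta>, q))) \<bullet> page l \<theta> v = fst (snd (\<psi> (\<theta>, q))) \<bullet> v)"
    unfolding case_prod_unfold fst_conv snd_conv .
  then show "fst (\<Psi> (\<theta>, q)) = page l \<theta> (fst (\<psi> (\<theta>, q)))"
    "snd (snd (\<Psi> (\<theta>, q))) = snd (snd (\<psi> (\<theta>, q)))"
    "fst (snd (\<Psi> (\<theta>, q))) \<bullet> page l \<theta> v = fst (snd (\<psi> (\<theta>, q))) \<bullet> v"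
    by blast+
qed

text \<open>The isotopy carries a chart of \<open>\<Lambda> 0\<close> to all angles at once. It need
  not preserve the contact form; that the slices of the resulting chart are Legendrian will come
  from the hypothesis on each \<open>\<Lambda> \<theta>\<close>.\<close>

lemma loop_chart_exists:
  fixes \<Lambda> :: "real \<Rightarrow> 'n::finite jet1 set"
  assumes "legendrian_loop l \<Lambda>" "p \<in> \<Lambda> \<theta>"
  obtains U \<psi> q where "loop_chart l \<Lambda> UNIV U \<psi>" "q \<in> U" "\<psi> (\<theta>, q) = p"
proof -
  note def = assms(1)[unfolded legendrian_loop_def]
  have leg: "legendrian_submanifold l (\<Lambda> 0)"
    by (rule def[THEN conjunct1, THEN spec])
  note ex = def[THEN conjunct2, THEN conjunct2]
  from ex obtain \<Phi> \<Xi>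
    where diff: "diffeomorphism (UNIV \<times> \<Lambda> 0) (track \<Lambda>) (\<lambda>(\<theta>, p). (\<theta>, \<Phi> \<theta> p)) \<Xi>"
    by (elim exE)
  let ?h = "\<lambda>(\<theta>, p). (\<theta>, \<Phi> \<theta> p)"
  note h = diffeomorphismD[OF diff]
  have "(\<theta>, p) \<in> track \<Lambda>" using assms(2) by (simp add: track_def)
  then have \<Xi>p: "snd (\<Xi> (\<theta>, p)) \<in> \<Lambda> 0" "?h (\<Xi> (\<theta>, p)) = (\<theta>, p)"
    using h(2,4)[of "(\<theta>, p)"] by (auto simp: mem_Times_iff)
  from legendrian_chartE[OF leg \<Xi>p(1)] obtain U V \<psi> \<kappa>
    where U: "openin (top_of_set (halfspace l)) U"
      and V: "openin (top_of_set (\<Lambda> 0)) V" "snd (\<Xi> (\<theta>, p)) \<in> V" and diff0: "diffeomorphism U V \<psi> \<kappa>"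
      and "isotropic_on U \<psi>" .
  note \<psi> = diffeomorphismD[OF diff0]
  have V0: "V \<subseteq> \<Lambda> 0" using V(1) openin_imp_subset by blast
  define W where "W = ?h ` (UNIV \<times> V)"
  have "openin (top_of_set (track \<Lambda>)) W"
    unfolding W_def using diff V(1)
    by (intro homeomorphism_imp_open_map[of "UNIV \<times> \<Lambda> 0"] openin_Times) (auto simp: diffeomorphism_def)
  moreover have "diffeomorphism (UNIV \<times> U) W (\<lambda>(\<theta>, q). (\<theta>, \<Phi> \<theta> (\<psi> q))) (\<lambda>v. (fst v, \<kappa> (snd (\<Xi> v))))"
  proof (rule diffeomorphismI)
    have \<Xi>h: "\<Xi> (\<theta>, \<Phi> \<theta> p) = (\<theta>, p)" if "p \<in> V" for \<theta> p
      using h(3)[of "(\<theta>, p)"] that V0 by auto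
    show "(\<lambda>(\<theta>, q). (\<theta>, \<Phi> \<theta> (\<psi> q))) x \<in> W" if "x \<in> UNIV \<times> U" for x
      using that \<psi>(1) by (force simp: W_def)
    show "(fst v, \<kappa> (snd (\<Xi> v))) \<in> UNIV \<times> U" if "v \<in> W" for v
      using that \<psi>(2) \<Xi>h by (auto simp: W_def)
    show "(\<lambda>v. (fst v, \<kappa> (snd (\<Xi> v)))) ((\<lambda>(\<theta>, q). (\<theta>, \<Phi> \<theta> (\<psi> q))) x) = x" if "x \<in> UNIV \<times> U" for x
      using that \<Xi>h[OF \<psi>(1)] \<psi>(3) by (cases x) simp
    show "(\<lambda>(\<theta>, q). (\<theta>, \<Phi> \<theta> (\<psi> q))) (fst v, \<kappa> (snd (\<Xi> v))) = v" if "v \<in> W" for v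
      using that \<psi>(4) \<Xi>h by (auto simp: W_def)
    have "smooth_on (UNIV \<times> U) (\<lambda>v. \<psi> (snd v))"
      by (rule smooth_on_compose[OF smooth_on_snd \<psi>(5)]) auto
    then have "smooth_on (UNIV \<times> U) (\<lambda>v :: real \<times> _. (fst v, \<psi> (snd v)))"
      by (intro smooth_on_Pair smooth_on_fst)
    then have "smooth_on (UNIV \<times> U) (\<lambda>v. ?h (fst v, \<psi> (snd v)))"
      by (rule smooth_on_compose[OF _ h(5)]) (use \<psi>(1) V0 in auto)
    then show "smooth_on (UNIV \<times> U) (\<lambda>(\<theta>, q). (\<theta>, \<Phi> \<theta> (\<psi> q)))"
      by (simp add: case_prod_unfold)
    have W: "W \<subseteq> track \<Lambda>" unfolding W_def using h(1) V0 by blast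
    have "smooth_on W (\<lambda>v. snd (\<Xi> v))"
      by (rule smooth_on_Cinf_compose[OF smooth_on_subset[OF h(6) W]]) (intro Cinf_intros open_UNIV)
    then have "smooth_on W (\<lambda>v. \<kappa> (snd (\<Xi> v)))"
      by (rule smooth_on_compose[OF _ \<psi>(6)]) (auto simp: W_def \<Xi>h)
    then show "smooth_on W (\<lambda>v. (fst v, \<kappa> (snd (\<Xi> v))))"
      by (intro smooth_on_Pair smooth_on_fst)
  qed
  ultimately have "loop_chart l \<Lambda> UNIV U (\<lambda>(\<theta>, q). \<Phi> \<theta> (\<psi> q))"
    unfolding loop_chart_def using U by auto
  moreover have "\<kappa> (snd (\<Xi> (\<theta>, p))) \<in> U" using \<psi>(2) V(2) by blast
  moreover have "\<Phi> \<theta> (\<psi> (\<kappa> (snd (\<Xi> (\<theta>, p))))) = p"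
    using \<psi>(4)[OF V(2)] \<Xi>p(2) by (auto simp: case_prod_unfold)
  ultimately show ?thesis using that by auto
qed

lemma loop_chart_smooth:
  fixes \<psi> :: "real \<times> (real^'n::finite) \<Rightarrow> 'n jet1"
  assumes "loop_chart l \<Lambda> J U \<psi>" shows "smooth_on (J \<times> U) \<psi>"
proof -
  obtain W \<kappa> where "diffeomorphism (J \<times> U) W (\<lambda>(\<theta>, q). (\<theta>, \<psi> (\<theta>, q))) \<kappa>"
    using assms unfolding loop_chart_def by blast
  from diffeomorphismD(5)[OF this] have "smooth_on (J \<times> U) (\<lambda>v. snd ((\<lambda>(\<theta>, q). (\<theta>, \<psi> (\<theta>, q))) v))"
    by (rule smooth_on_Cinf_compose) (intro Cinf_intros open_UNIV)
  then show ?thesis by (rule smooth_on_cong) auto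
qed

lemma loop_chart_mem:
  assumes "loop_chart l \<Lambda> J U \<psi>" "\<theta> \<in> J" "q \<in> U" shows "\<psi> (\<theta>, q) \<in> \<Lambda> \<theta>"
proof -
  obtain W \<kappa> where "diffeomorphism (J \<times> U) W (\<lambda>(\<theta>, q). (\<theta>, \<psi> (\<theta>, q))) \<kappa>"
    and "W \<subseteq> track \<Lambda>"
    using assms(1) unfolding loop_chart_def using openin_imp_subset by blast
  from diffeomorphismD(1)[OF this(1), of "(\<theta>, q)"] this(2) show ?thesis
    using assms(2,3) by (auto simp: track_def)
qed

section \<open>The twist-spun Legendrian\<close>

locale generated_loop = spinnable_loop l f
  for l :: "'n::finite" and f :: "real \<Rightarrow> (real^'n) \<times> (real^'N::finite) \<Rightarrow> real" +
  fixes \<Lambda> :: "real \<Rightarrow> 'n jet1 set"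
  assumes legendrian_loop: "legendrian_loop l \<Lambda>"
    and generated: "\<And>\<theta>. \<Lambda> \<theta> = generated_legendrian (halfspace l) (f \<theta>)"
begin

text \<open>The jet of \<open>f \<theta>\<close>, expressed through \<open>F\<close> so that one
  formula is smooth in the angle and the point together.\<close>

abbreviation jet :: "real \<Rightarrow> real^'n \<Rightarrow> real^'N \<Rightarrow> 'n jet1" where
  "jet \<theta> x \<eta> \<equiv> (x, unpage l \<theta> (B (page l \<theta> x, \<eta>)), F (page l \<theta> x, \<eta>))"

lemma mem_\<Lambda>:
  "p \<in> \<Lambda> \<theta> \<longleftrightarrow> fst p \<in> halfspace l \<and> (\<exists>\<eta>. G (page l \<theta> (fst p), \<eta>) = 0 \<and> p = jet \<theta> (fst p) \<eta>)"
  using generated_page[of "fst p" "fst (snd p)" "snd (snd p)" \<theta>]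
  by (auto simp: generated prod_eq_iff)

lemma \<Lambda>_jetI: "x \<in> halfspace l \<Longrightarrow> G (page l \<theta> x, \<eta>) = 0 \<Longrightarrow> jet \<theta> x \<eta> \<in> \<Lambda> \<theta>"
  by (auto simp: mem_\<Lambda>)

lemma legendrian_\<Lambda>: "legendrian_submanifold l (\<Lambda> \<theta>)"
  using legendrian_loop[unfolded legendrian_loop_def] by blast

text \<open>Since the chart offers no smooth choice of \<eta>, the curve is built from the other
  end: a critical curve of unit angular speed through the given point yields jets in the track, and
  the inverse chart turns these into the curve \<gamma> of parameters. Because the fibre gradient
  vanishes, the motion of \<eta> does not enter the derivative of the height.\<close>

lemma chart_critical_curve:
  assumes chart: "loop_chart l \<Lambda> J U \<psi>" and \<theta>: "\<theta> \<in> J" "q \<in> U"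
    and x: "x \<in> halfspace l" and crit: "G (page l \<theta> x, \<eta>) = 0" and \<psi>: "\<psi> (\<theta>, q) = jet \<theta> x \<eta>"
  obtains d \<gamma> w c' y' where "d > 0" "\<gamma> 0 = (\<theta>, q)" "\<And>t. t \<in> {0..<d} \<Longrightarrow> \<gamma> t \<in> J \<times> U"
    "(\<gamma> has_vector_derivative (1, w)) (at 0 within {0..<d})"
    "((\<lambda>t. \<psi> (\<gamma> t)) has_vector_derivative
      (c', y', B (page l \<theta> x, \<eta>) \<bullet> (page l \<theta> c' + x $ l *\<^sub>R page_normal l \<theta>))) (at 0 within {0..<d})"
    "((\<lambda>t. page l (fst (\<gamma> t)) (fst (\<psi> (\<gamma> t)))) has_vector_derivative
      page l \<theta> c' + x $ l *\<^sub>R page_normal l \<theta>) (at 0 within {0..<d})"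
proof -
  from critical_curve[OF x crit] obtain \<epsilon> c e c' e' where \<epsilon>: "\<epsilon> > 0" and c0: "c 0 = x" and e0: "e 0 = \<eta>"
    and c': "(c has_vector_derivative c') (at 0 within {0..<\<epsilon>})"
    and e': "(e has_vector_derivative e') (at 0 within {0..<\<epsilon>})"
    and ce: "\<And>t. t \<in> {0..<\<epsilon>} \<Longrightarrow> c t \<in> halfspace l \<and> G (page l (\<theta> + t) (c t), e t) = 0" by blast
  let ?X' = "page l \<theta> c' + x $ l *\<^sub>R page_normal l \<theta>"
  define P where "P = (\<lambda>t. jet (\<theta> + t) (c t) (e t))"
  have \<theta>': "((\<lambda>t. \<theta> + t) has_vector_derivative 1) (at 0 within {0..<\<epsilon>})"
    by (auto intro!: derivative_eq_intros)
  have X': "((\<lambda>t. page l (\<theta> + t) (c t)) has_vector_derivative ?X') (at 0 within {0..<\<epsilon>})"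
    using has_vector_derivative_compose_within[OF has_vector_derivative_Pair[OF \<theta>' c'] has_derivative_page[of l]]
    by (simp add: c0)
  have XE': "((\<lambda>t. (page l (\<theta> + t) (c t), e t)) has_vector_derivative (?X', e')) (at 0 within {0..<\<epsilon>})"
    by (rule has_vector_derivative_Pair[OF X' e'])
  have z': "((\<lambda>t. F (page l (\<theta> + t) (c t), e t)) has_vector_derivative B (page l \<theta> x, \<eta>) \<bullet> ?X')
      (at 0 within {0..<\<epsilon>})"
    using has_vector_derivative_compose_within[OF XE' F_has_derivative] by (simp add: c0 e0 crit)
  \<comment> \<open>Some velocity \<open>y'\<close> must exist for the inverse chart to be
    differentiated along \<open>P\<close>; its value is irrelevant, as the contact form does not see
    it.\<close>
  let ?Y = "\<lambda>v. unpage l (fst v) (B (snd v))"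
  have "Cinf_on UNIV ?Y"
    by (intro Cinf_intros open_UNIV Cinf_on_compose[OF open_UNIV open_UNIV subset_UNIV _ Cinf_B])
  from Cinf_on_has_derivative[OF this open_UNIV UNIV_I]
  have "(?Y has_derivative frechet_derivative ?Y (at v)) (at v)" for v .
  from has_vector_derivative_compose_within[OF has_vector_derivative_Pair[OF \<theta>' XE'] this]
  obtain y' where "((\<lambda>t. ?Y (\<theta> + t, page l (\<theta> + t) (c t), e t)) has_vector_derivative y') (at 0 within {0..<\<epsilon>})"
    by blast
  then have P': "(P has_vector_derivative (c', y', B (page l \<theta> x, \<eta>) \<bullet> ?X')) (at 0 within {0..<\<epsilon>})"
    unfolding P_def by (intro has_vector_derivative_Pair c' z') simp
  obtain W \<kappa> where W: "openin (top_of_set (track \<Lambda>)) W"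
    and diff: "diffeomorphism (J \<times> U) W (\<lambda>(\<theta>, q). (\<theta>, \<psi> (\<theta>, q))) \<kappa>"
    using chart unfolding loop_chart_def by blast
  note D = diffeomorphismD[OF diff]
  have P0: "(\<theta> + 0, P 0) = (\<theta>, \<psi> (\<theta>, q))" by (simp add: P_def c0 e0 \<psi>)
  then have W0: "(\<theta> + 0, P 0) \<in> W" using D(1)[of "(\<theta>, q)"] \<theta> by simp
  have track: "(\<theta> + t, P t) \<in> track \<Lambda>" if "t \<in> {0..<\<epsilon>}" for t
    using \<Lambda>_jetI ce[OF that] by (simp add: track_def P_def)
  from inverse_chart_curve[OF diff W W0 \<epsilon> track has_vector_derivative_Pair[OF \<theta>' P']]
  obtain d v where d: "0 < d" "d \<le> \<epsilon>" and PW: "\<And>t. t \<in> {0..<d} \<Longrightarrow> (\<theta> + t, P t) \<in> W"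
    and \<gamma>': "((\<lambda>t. \<kappa> (\<theta> + t, P t)) has_vector_derivative v) (at 0 within {0..<d})" by blast
  define \<gamma> where "\<gamma> = (\<lambda>t. \<kappa> (\<theta> + t, P t))"
  have \<gamma>JU: "\<gamma> t \<in> J \<times> U" if "t \<in> {0..<d}" for t
    unfolding \<gamma>_def using D(2) PW[OF that] by blast
  have "(fst (\<gamma> t), \<psi> (\<gamma> t)) = (\<theta> + t, P t)" if "t \<in> {0..<d}" for t
    using D(4)[OF PW[OF that]] unfolding \<gamma>_def by (simp add: case_prod_unfold)
  then have \<gamma>: "fst (\<gamma> t) = \<theta> + t" "\<psi> (\<gamma> t) = P t" if "t \<in> {0..<d}" for t
    using that by auto
  have sub: "{0..<d} \<subseteq> {0..<\<epsilon>}" using d by auto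
  have 0: "0 \<in> {0..<d}" using d by simp
  have "((\<lambda>t. fst (\<gamma> t)) has_vector_derivative fst v) (at 0 within {0..<d})"
    unfolding \<gamma>_def
    by (rule bounded_linear.has_vector_derivative[OF bounded_linear_fst \<gamma>'])
  moreover have "((\<lambda>t. fst (\<gamma> t)) has_vector_derivative 1) (at 0 within {0..<d})"
    using has_vector_derivative_within_subset[OF \<theta>' sub]
    by (rule has_vector_derivative_transform[OF 0, rotated]) (simp add: \<gamma>)
  ultimately have "fst v = 1"
    using has_vector_derivative_unique_right d(1) by blast
  then have v: "v = (1, snd v)" by (simp add: prod_eq_iff)
  show ?thesis
  proof (rule that[OF d(1)])
    show "\<gamma> 0 = (\<theta>, q)" using D(3)[of "(\<theta>, q)"] \<theta> P0 by (simp add: \<gamma>_def)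
    show "\<gamma> t \<in> J \<times> U" if "t \<in> {0..<d}" for t by (rule \<gamma>JU[OF that])
    show "(\<gamma> has_vector_derivative (1, snd v)) (at 0 within {0..<d})"
      using \<gamma>' v unfolding \<gamma>_def by simp
    show "((\<lambda>t. \<psi> (\<gamma> t)) has_vector_derivative (c', y', B (page l \<theta> x, \<eta>) \<bullet> ?X')) (at 0 within {0..<d})"
      using has_vector_derivative_within_subset[OF P' sub]
      by (rule has_vector_derivative_transform[OF 0, rotated]) (simp add: \<gamma>)
    show "((\<lambda>t. page l (fst (\<gamma> t)) (fst (\<psi> (\<gamma> t)))) has_vector_derivative ?X') (at 0 within {0..<d})"
      using has_vector_derivative_within_subset[OF X' sub]
      by (rule has_vector_derivative_transform[OF 0, rotated]) (simp add: \<gamma> P_def)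
  qed
qed

text \<open>The derivative of the height along the curve \<gamma> is computed twice: isotropy of the
  lift gives its covector applied to the velocity, criticality gives \<open>B\<close> applied to it.
  Both covectors agree on the page, so what is compared is \<open>x $ l\<close> times their normal
  components, and \<open>x $ l\<close> cancels.\<close>

lemma lift_off_binding:
  assumes chart: "loop_chart l \<Lambda> J U \<psi>" and lift: "spin_lift l J U \<psi> \<Psi>" and \<theta>: "\<theta> \<in> J" "q \<in> U"
    and x: "x \<in> halfspace l" "x $ l \<noteq> 0" and crit: "G (page l \<theta> x, \<eta>) = 0" and \<psi>: "\<psi> (\<theta>, q) = jet \<theta> x \<eta>"
  shows "\<Psi> (\<theta>, q) = (page l \<theta> x, B (page l \<theta> x, \<eta>), F (page l \<theta> x, \<eta>))"
proof -
  from chart_critical_curve[OF chart \<theta> x(1) crit \<psi>]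
  obtain d \<gamma> w c' y' where d: "d > 0" and \<gamma>0: "\<gamma> 0 = (\<theta>, q)" and \<gamma>JU: "\<And>t. t \<in> {0..<d} \<Longrightarrow> \<gamma> t \<in> J \<times> U"
    and \<gamma>': "(\<gamma> has_vector_derivative (1, w)) (at 0 within {0..<d})"
    and \<psi>': "((\<lambda>t. \<psi> (\<gamma> t)) has_vector_derivative
      (c', y', B (page l \<theta> x, \<eta>) \<bullet> (page l \<theta> c' + x $ l *\<^sub>R page_normal l \<theta>))) (at 0 within {0..<d})"
    and X': "((\<lambda>t. page l (fst (\<gamma> t)) (fst (\<psi> (\<gamma> t)))) has_vector_derivative
      page l \<theta> c' + x $ l *\<^sub>R page_normal l \<theta>) (at 0 within {0..<d})" by blast
  let ?X' = "page l \<theta> c' + x $ l *\<^sub>R page_normal l \<theta>" and ?B = "B (page l \<theta> x, \<eta>)"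
  let ?Y = "fst (snd (\<Psi> (\<theta>, q)))"
  have "isotropic_on (J \<times> U) \<Psi>" using lift unfolding spin_lift_def by (elim conjE)
  from bspec[OF this[unfolded isotropic_on_def], of "(\<theta>, q)"]
  obtain D where D: "(\<Psi> has_derivative D) (at (\<gamma> 0) within J \<times> U)"
    and contact: "\<And>v. contact_form (\<Psi> (\<theta>, q)) (D v) = 0"
    using \<theta> \<gamma>0 by auto
  have \<Psi>': "((\<lambda>t. \<Psi> (\<gamma> t)) has_vector_derivative D (1, w)) (at 0 within {0..<d})"
    by (rule has_vector_derivative_compose_within[OF \<gamma>' D]) (use \<gamma>JU in blast)
  have \<Psi>\<gamma>: "fst (\<Psi> (\<gamma> t)) = page l (fst (\<gamma> t)) (fst (\<psi> (\<gamma> t)))"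
    "snd (snd (\<Psi> (\<gamma> t))) = snd (snd (\<psi> (\<gamma> t)))" if "t \<in> {0..<d}" for t
    using spin_liftD(1,2)[OF lift, of "fst (\<gamma> t)" "snd (\<gamma> t)"] \<gamma>JU[OF that] by (simp_all add: mem_Times_iff)
  have 0: "0 \<in> {0..<d}" using d by simp
  have "((\<lambda>t. page l (fst (\<gamma> t)) (fst (\<psi> (\<gamma> t)))) has_vector_derivative fst (D (1, w))) (at 0 within {0..<d})"
    using bounded_linear.has_vector_derivative[OF bounded_linear_fst \<Psi>']
    by (rule has_vector_derivative_transform[OF 0, rotated]) (simp add: \<Psi>\<gamma>)
  then have DX: "fst (D (1, w)) = ?X'" using X' has_vector_derivative_unique_right d by blast
  have "((\<lambda>t. snd (snd (\<psi> (\<gamma> t)))) has_vector_derivative snd (snd (D (1, w)))) (at 0 within {0..<d})"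
    using bounded_linear.has_vector_derivative[OF bounded_linear_snd
        bounded_linear.has_vector_derivative[OF bounded_linear_snd \<Psi>']]
    by (rule has_vector_derivative_transform[OF 0, rotated]) (simp add: \<Psi>\<gamma>)
  moreover have "((\<lambda>t. snd (snd (\<psi> (\<gamma> t)))) has_vector_derivative ?B \<bullet> ?X') (at 0 within {0..<d})"
    using bounded_linear.has_vector_derivative[OF bounded_linear_snd
        bounded_linear.has_vector_derivative[OF bounded_linear_snd \<psi>']] by simp
  ultimately have "snd (snd (D (1, w))) = ?B \<bullet> ?X'"
    using has_vector_derivative_unique_right d by blast
  then have "?B \<bullet> ?X' = ?Y \<bullet> ?X'"
    using contact[of "(1, w)"] DX by (simp add: contact_form_def)
  moreover have page: "?Y \<bullet> page l \<theta> v = ?B \<bullet> page l \<theta> v" for v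
    using spin_liftD(3)[OF lift \<theta>] \<psi> by (simp add: inner_unpage)
  ultimately have "?Y \<bullet> page_normal l \<theta> = ?B \<bullet> page_normal l \<theta>"
    using x(2) by (simp add: inner_add_right)
  then have "?Y = ?B" using page by (intro page_eqI) auto
  then show ?thesis
    using spin_liftD(1,2)[OF lift \<theta>] \<psi> by (simp add: prod_eq_iff)
qed

lemma twist_spun_subset: "twist_spun l \<Lambda> \<subseteq> generated_legendrian UNIV F"
proof
  fix p assume "p \<in> twist_spun l \<Lambda>"
  then obtain J U \<psi> \<Psi> \<theta> q where chart: "loop_chart l \<Lambda> J U \<psi>" and lift: "spin_lift l J U \<psi> \<Psi>"
    and \<theta>: "\<theta> \<in> J" "q \<in> U" and p: "p = \<Psi> (\<theta>, q)"
    unfolding twist_spun_def by blast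
  define x where "x = fst (\<psi> (\<theta>, q))"
  from loop_chart_mem[OF chart \<theta>] obtain \<eta> where x: "x \<in> halfspace l"
    and crit: "G (page l \<theta> x, \<eta>) = 0" and \<psi>: "\<psi> (\<theta>, q) = jet \<theta> x \<eta>"
    unfolding mem_\<Lambda> x_def by blast
  have "\<Psi> (\<theta>, q) = (page l \<theta> x, B (page l \<theta> x, \<eta>), F (page l \<theta> x, \<eta>))"
  proof (cases "x $ l = 0")
    case False
    show ?thesis by (rule lift_off_binding[OF chart lift \<theta> x False crit \<psi>])
  next
    case True
    \<comment> \<open>No factor \<open>x $ l\<close> can be cancelled here. The jets of critical
      points off the binding, on the same page, converge to the given jet, and the inverse chart and
      the lift are continuous; so the identity passes to the limit.\<close>
    from critical_curve_off_binding[OF x True crit] obtain \<epsilon> :: real and c e where \<epsilon>: "\<epsilon> > 0"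
      and c: "(c \<longlongrightarrow> x) (at_right 0)" and e: "(e \<longlongrightarrow> \<eta>) (at_right 0)"
      and ce: "\<And>t. t \<in> {0<..<\<epsilon>} \<Longrightarrow> c t \<in> halfspace l \<and> c t $ l > 0 \<and> G (page l \<theta> (c t), e t) = 0"
      by blast
    let ?jet = "\<lambda>v. (\<theta>, jet \<theta> (fst v) (snd v))"
    let ?J = "\<lambda>v. (page l \<theta> (fst v), B (page l \<theta> (fst v), snd v), F (page l \<theta> (fst v), snd v))"
    have "Cinf_on UNIV ?jet" "Cinf_on UNIV ?J"
      by (intro Cinf_intros open_UNIV Cinf_on_compose[OF open_UNIV open_UNIV subset_UNIV _ Cinf_B]
          Cinf_on_compose[OF open_UNIV open_UNIV subset_UNIV _ Cinf_F])+
    then have cont: "continuous_on UNIV ?jet" "continuous_on UNIV ?J"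
      using Cinf_on_continuous by blast+
    have ce_lim: "((\<lambda>t. (c t, e t)) \<longlongrightarrow> (x, \<eta>)) (at_right 0)"
      by (rule tendsto_Pair[OF c e])
    have jet_lim: "((\<lambda>t. ?jet (c t, e t)) \<longlongrightarrow> ?jet (x, \<eta>)) (at_right 0)"
      and J_lim: "((\<lambda>t. ?J (c t, e t)) \<longlongrightarrow> ?J (x, \<eta>)) (at_right 0)"
      using continuous_on_tendsto_compose[OF cont(1) ce_lim] continuous_on_tendsto_compose[OF cont(2) ce_lim]
      by simp_all
    obtain W \<kappa> where W: "openin (top_of_set (track \<Lambda>)) W"
      and diff: "diffeomorphism (J \<times> U) W (\<lambda>(\<theta>, q). (\<theta>, \<psi> (\<theta>, q))) \<kappa>"
      using chart unfolding loop_chart_def by blast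
    note D = diffeomorphismD[OF diff]
    obtain N where N: "open N" "W = track \<Lambda> \<inter> N" using W openin_open by metis
    have jetW: "?jet (x, \<eta>) \<in> W" using D(1)[of "(\<theta>, q)"] \<theta> \<psi> by simp
    have "eventually (\<lambda>t. ?jet (c t, e t) \<in> N) (at_right 0)"
      using topological_tendstoD[OF jet_lim N(1)] jetW N(2) by simp
    moreover have ev: "eventually (\<lambda>t. t \<in> {0<..<\<epsilon>}) (at_right 0)"
      using \<epsilon> by (auto simp: eventually_at_right_field)
    ultimately have evW: "eventually (\<lambda>t. ?jet (c t, e t) \<in> W \<and> t \<in> {0<..<\<epsilon>}) (at_right 0)"
      by eventually_elim (use N(2) \<Lambda>_jetI ce in \<open>auto simp: track_def\<close>)
    have \<kappa>_cont: "continuous_on W \<kappa>" and \<Psi>_cont: "continuous_on (J \<times> U) \<Psi>"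
      using smooth_on_continuous D(6) lift unfolding spin_lift_def by blast+
    have "continuous_on W (\<lambda>v. \<Psi> (\<kappa> v))"
      by (rule continuous_on_compose2[OF \<Psi>_cont \<kappa>_cont]) (use D(2) in blast)
    from continuous_on_tendsto_compose[OF this jet_lim jetW]
    have "((\<lambda>t. \<Psi> (\<kappa> (?jet (c t, e t)))) \<longlongrightarrow> \<Psi> (\<kappa> (?jet (x, \<eta>)))) (at_right 0)"
      using evW by (simp add: eventually_conj_iff)
    moreover have "eventually (\<lambda>t. \<Psi> (\<kappa> (?jet (c t, e t))) = ?J (c t, e t)) (at_right 0)"
      using evW
    proof eventually_elim
      case (elim t)
      let ?v = "\<kappa> (?jet (c t, e t))"
      have v: "?v \<in> J \<times> U" using D(2) elim by blast
      have "(fst ?v, \<psi> ?v) = ?jet (c t, e t)"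
        using D(4)[of "?jet (c t, e t)"] elim by (simp add: case_prod_unfold)
      then have 1: "?v = (\<theta>, snd ?v)" and 2: "\<psi> ?v = jet \<theta> (c t) (e t)" by (auto simp: prod_eq_iff)
      have t: "c t \<in> halfspace l" "c t $ l \<noteq> 0" "G (page l \<theta> (c t), e t) = 0"
        using ce[of t] elim by auto
      have U: "snd ?v \<in> U" using v by (rule mem_Times_iff[THEN iffD1, THEN conjunct2])
      have "\<psi> (\<theta>, snd ?v) = jet \<theta> (c t) (e t)" using 2 1 by metis
      from lift_off_binding[OF chart lift \<theta>(1) U t this]
      have "\<Psi> (\<theta>, snd ?v) = ?J (c t, e t)" by simp
      then show ?case using 1 by metis
    qed
    ultimately have "((\<lambda>t. ?J (c t, e t)) \<longlongrightarrow> \<Psi> (\<kappa> (?jet (x, \<eta>)))) (at_right 0)"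
      using tendsto_cong by fast
    then have "\<Psi> (\<kappa> (?jet (x, \<eta>))) = ?J (x, \<eta>)"
      using J_lim by (intro tendsto_unique[of "at_right (0::real)"]) auto
    moreover have "\<kappa> (?jet (x, \<eta>)) = (\<theta>, q)"
      using D(3)[of "(\<theta>, q)"] \<theta> \<psi> by simp
    ultimately show ?thesis by simp
  qed
  then show "p \<in> generated_legendrian UNIV F"
    using crit p unfolding generated_legendrian_def by blast
qed

text \<open>With the angle fixed the chart moves inside the Legendrian
  \<open>\<Lambda> \<theta>\<close>. Only basis vectors are tested, as the rays along them stay in
  the half-space even from the boundary; linearity does the rest.\<close>

lemma chart_contact_fibre:
  assumes chart: "loop_chart l \<Lambda> J U \<psi>" and \<theta>: "\<theta> \<in> J" "q \<in> U"
    and D: "(\<psi> has_derivative D) (at (\<theta>, q) within J \<times> U)"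
  shows "contact_form (\<psi> (\<theta>, q)) (D (0, w)) = 0"
proof -
  let ?L = "\<lambda>w. contact_form (\<psi> (\<theta>, q)) (D (0, w))"
  have "linear (\<lambda>w :: real^'n. (0 :: real, w))" by (rule linearI) auto
  from linear_compose[OF this has_derivative_linear[OF D]]
  have D0: "linear (\<lambda>w :: real^'n. D (0, w))" by (simp add: o_def)
  have lin: "linear ?L"
    using linear_compose[OF D0 contact_form_linear[of "\<psi> (\<theta>, q)"]] unfolding o_def .
  have "?L b = 0" if b: "b \<in> Basis" for b
  proof -
    have "openin (top_of_set (halfspace l)) U" using chart unfolding loop_chart_def by blast
    then obtain N where N: "open N" "U = halfspace l \<inter> N" using openin_open by metis
    have "open ((\<lambda>t. q + t *\<^sub>R b) -` N)"
      using N(1) by (rule open_vimage) (intro continuous_intros)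
    moreover have "0 \<in> (\<lambda>t. q + t *\<^sub>R b) -` N" using \<theta>(2) N(2) by simp
    ultimately obtain \<epsilon> where \<epsilon>: "\<epsilon> > 0" "ball 0 \<epsilon> \<subseteq> (\<lambda>t. q + t *\<^sub>R b) -` N"
      using open_contains_ball by blast
    have "0 \<le> b $ l" using b by (auto simp: Basis_vec_def axis_def)
    then have U: "q + t *\<^sub>R b \<in> U" if "t \<in> {0..<\<epsilon>}" for t
      using that subsetD[OF \<epsilon>(2), of t] \<theta>(2) N(2) by (auto simp: mem_halfspace)
    have "((\<lambda>t. (\<theta>, q + t *\<^sub>R b)) has_vector_derivative (0, b)) (at 0 within {0..<\<epsilon>})"
      by (auto intro!: derivative_eq_intros)
    moreover have "(\<psi> has_derivative D) (at (\<theta>, q + 0 *\<^sub>R b) within J \<times> U)" using D by simp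
    ultimately have "((\<lambda>t. \<psi> (\<theta>, q + t *\<^sub>R b)) has_vector_derivative D (0, b)) (at 0 within {0..<\<epsilon>})"
      by (rule has_vector_derivative_compose_within) (use U \<theta>(1) in auto)
    from legendrian_curve[OF legendrian_\<Lambda> \<epsilon>(1) loop_chart_mem[OF chart \<theta>(1) U] this]
    show ?thesis by simp
  qed
  then have "(\<Sum>b\<in>Basis. (w \<bullet> b) *\<^sub>R ?L b) = 0" by simp
  then show ?thesis using linear_sum_Basis[OF lin, of w] by simp
qed

text \<open>The curve \<gamma> has velocity \<open>(1, w)\<close> with \<open>w\<close> unknown, but
  the \<open>w\<close>-part is annihilated by \<open>chart_contact_fibre\<close>. On the whole
  velocity the page parts cancel and the normal term remains. Since the left side does not mention
  \<eta>, neither does the right side depend on it.\<close>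

lemma chart_contact_angle:
  assumes chart: "loop_chart l \<Lambda> J U \<psi>" and \<theta>: "\<theta> \<in> J" "q \<in> U"
    and D: "(\<psi> has_derivative D) (at (\<theta>, q) within J \<times> U)"
    and x: "x \<in> halfspace l" and crit: "G (page l \<theta> x, \<eta>) = 0" and \<psi>: "\<psi> (\<theta>, q) = jet \<theta> x \<eta>"
  shows "contact_form (\<psi> (\<theta>, q)) (D (1, 0)) = x $ l * (B (page l \<theta> x, \<eta>) \<bullet> page_normal l \<theta>)"
proof -
  from chart_critical_curve[OF chart \<theta> x crit \<psi>]
  obtain d \<gamma> w c' y' where d: "d > 0" and \<gamma>0: "\<gamma> 0 = (\<theta>, q)" and \<gamma>JU: "\<And>t. t \<in> {0..<d} \<Longrightarrow> \<gamma> t \<in> J \<times> U"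
    and \<gamma>': "(\<gamma> has_vector_derivative (1, w)) (at 0 within {0..<d})"
    and \<psi>': "((\<lambda>t. \<psi> (\<gamma> t)) has_vector_derivative
      (c', y', B (page l \<theta> x, \<eta>) \<bullet> (page l \<theta> c' + x $ l *\<^sub>R page_normal l \<theta>))) (at 0 within {0..<d})"
    and "((\<lambda>t. page l (fst (\<gamma> t)) (fst (\<psi> (\<gamma> t)))) has_vector_derivative
      page l \<theta> c' + x $ l *\<^sub>R page_normal l \<theta>) (at 0 within {0..<d})" by blast
  have "(\<psi> has_derivative D) (at (\<gamma> 0) within J \<times> U)" using D \<gamma>0 by simp
  from has_vector_derivative_compose_within[OF \<gamma>' this]
  have "((\<lambda>t. \<psi> (\<gamma> t)) has_vector_derivative D (1, w)) (at 0 within {0..<d})"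
    using \<gamma>JU by blast
  from has_vector_derivative_unique_right[OF this \<psi>' d]
  have "contact_form (\<psi> (\<theta>, q)) (D (1, w)) = x $ l * (B (page l \<theta> x, \<eta>) \<bullet> page_normal l \<theta>)"
    by (simp add: contact_form_def \<psi> inner_unpage inner_add_right)
  moreover have "D (1, w) = D (1, 0) + D (0, w)"
    using linear_add[OF has_derivative_linear[OF D], of "(1, 0)" "(0, w)"] by simp
  ultimately show ?thesis
    using chart_contact_fibre[OF chart \<theta> D, of w] by (simp add: linear_add[OF contact_form_linear])
qed

text \<open>The normal component \<open>c\<close> of the lift is that of \<open>B\<close> at a
  critical point over the jet. The choice \<open>h\<close> of this point has no continuity, but
  \<open>c\<close> is smooth: it is 0 for \<open>x $ l < \<delta>\<close>, and for
  \<open>x $ l > 0\<close> it is a quotient by \<open>x $ l\<close> of the contact form on the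
  angular derivative of the chart. The second conclusion covers every \<eta> over the jet, not just
  the chosen one, so that the lift passes through any prescribed generated point.\<close>

lemma spin_lift_exists:
  assumes chart: "loop_chart l \<Lambda> J U \<psi>"
  obtains \<Psi> where "spin_lift l J U \<psi> \<Psi>"
    "\<And>\<theta> q x \<eta>. \<theta> \<in> J \<Longrightarrow> q \<in> U \<Longrightarrow> x \<in> halfspace l \<Longrightarrow> G (page l \<theta> x, \<eta>) = 0 \<Longrightarrow>
      \<psi> (\<theta>, q) = jet \<theta> x \<eta> \<Longrightarrow> \<Psi> (\<theta>, q) = (page l \<theta> x, B (page l \<theta> x, \<eta>), F (page l \<theta> x, \<eta>))"
proof -
  let ?x = "\<lambda>v. fst (\<psi> v)" and ?y = "\<lambda>v. fst (snd (\<psi> v))" and ?z = "\<lambda>v. snd (snd (\<psi> v))"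
  have "\<forall>v\<in>J \<times> U. \<exists>\<eta>. ?x v \<in> halfspace l \<and> G (page l (fst v) (?x v), \<eta>) = 0 \<and> \<psi> v = jet (fst v) (?x v) \<eta>"
  proof
    fix v assume "v \<in> J \<times> U"
    then have "\<psi> v \<in> \<Lambda> (fst v)" using loop_chart_mem[OF chart, of "fst v" "snd v"] by (simp add: mem_Times_iff)
    then show "\<exists>\<eta>. ?x v \<in> halfspace l \<and> G (page l (fst v) (?x v), \<eta>) = 0 \<and> \<psi> v = jet (fst v) (?x v) \<eta>"
      unfolding mem_\<Lambda> by blast
  qed
  from bchoice[OF this] obtain h where
    h: "\<And>v. v \<in> J \<times> U \<Longrightarrow> ?x v \<in> halfspace l" "\<And>v. v \<in> J \<times> U \<Longrightarrow> G (page l (fst v) (?x v), h v) = 0"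
      "\<And>v. v \<in> J \<times> U \<Longrightarrow> \<psi> v = jet (fst v) (?x v) (h v)" by blast
  define c where "c = (\<lambda>v. B (page l (fst v) (?x v), h v) \<bullet> page_normal l (fst v))"
  define \<Psi> where "\<Psi> = (\<lambda>v. (page l (fst v) (?x v), page l (fst v) (?y v) + c v *\<^sub>R page_normal l (fst v), ?z v))"
  from critical_near_binding obtain \<delta> where "\<delta> > 0"
    and steady: "\<And>\<theta> x \<eta>. x \<in> halfspace l \<Longrightarrow> G (page l \<theta> x, \<eta>) = 0 \<Longrightarrow> x $ l < \<delta> \<Longrightarrow> (x, \<eta>) \<in> steady" by blast
  have c_near: "c v = 0" if "v \<in> J \<times> U" "?x v $ l < \<delta>" for v
    unfolding c_def
    by (rule normal_derivative_steady[OF steady[OF h(1,2)[OF that(1)] that(2)] h(1)[OF that(1)]])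
  have c_contact: "contact_form (\<psi> v) (D (1, 0)) = ?x v $ l * c v"
    if v: "v \<in> J \<times> U" and D: "(\<psi> has_derivative D) (at v within J \<times> U)" for v D
    unfolding c_def using chart_contact_angle[OF chart, of "fst v" "snd v" D "?x v" "h v"] h[OF v] v D
    by (simp add: mem_Times_iff)
  have smooth: "smooth_on (J \<times> U) \<psi>" by (rule loop_chart_smooth[OF chart])
  have normal: "page_normal l \<theta> = page l (\<theta> + pi / 2) (axis l 1)" for \<theta>
    by (rule page_normal_def)
  have "smooth_on (J \<times> U) \<Psi>"
  proof (rule smooth_onI)
    fix v assume v: "v \<in> J \<times> U"
    from smooth_onE[OF smooth v] obtain N g where N: "open N" "v \<in> N" and g: "Cinf_on N g"
      and eq: "\<And>w. w \<in> J \<times> U \<Longrightarrow> w \<in> N \<Longrightarrow> g w = \<psi> w" by blast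
    have cont: "continuous_on N (\<lambda>w. fst (g w) $ l)"
      by (rule Cinf_on_continuous) (intro Cinf_intros N g)
    show "\<exists>M k. open M \<and> v \<in> M \<and> Cinf_on M k \<and> (\<forall>w. w \<in> J \<times> U \<longrightarrow> w \<in> M \<longrightarrow> k w = \<Psi> w)"
    proof (cases "?x v $ l < \<delta>")
      case True
      let ?M = "N \<inter> (\<lambda>w. fst (g w) $ l) -` {..<\<delta>}"
      let ?k = "\<lambda>w. (page l (fst w) (fst (g w)), page l (fst w) (fst (snd (g w))), snd (snd (g w)))"
      have M: "open ?M" by (rule continuous_open_preimage[OF cont N(1) open_lessThan])
      have gM: "Cinf_on ?M g" by (rule Cinf_on_subset[OF g]) blast
      have "Cinf_on ?M ?k" by (intro Cinf_intros M gM)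
      moreover have "?k w = \<Psi> w" if "w \<in> J \<times> U" "w \<in> ?M" for w
        using eq[of w] c_near[of w] that by (simp add: \<Psi>_def)
      moreover have "v \<in> ?M" using N(2) eq[OF v] True by simp
      ultimately show ?thesis using M by (intro exI[of _ ?M] exI[of _ ?k] conjI allI impI)
    next
      case False
      let ?M = "N \<inter> (\<lambda>w. fst (g w) $ l) -` {0<..}"
      \<comment> \<open>The contact form on the angular derivative of the local extension
        \<open>g\<close>, divided by the last coordinate: a smooth formula that no longer refers to
        \<open>h\<close>.\<close>
      let ?c = "\<lambda>w. (snd (snd (frechet_derivative g (at w) (1, 0))) -
        fst (snd (g w)) \<bullet> fst (frechet_derivative g (at w) (1, 0))) / (fst (g w) $ l)"
      let ?k = "\<lambda>w. (page l (fst w) (fst (g w)),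
        page l (fst w) (fst (snd (g w))) + ?c w *\<^sub>R page l (fst w + pi / 2) (axis l 1), snd (snd (g w)))"
      have M: "open ?M" by (rule continuous_open_preimage[OF cont N(1) open_greaterThan])
      have gM: "Cinf_on ?M g" by (rule Cinf_on_subset[OF g]) blast
      have "Cinf_on ?M ?k" by (intro Cinf_intros M gM Cinf_on_frechet_derivative[OF gM]) auto
      moreover have "?k w = \<Psi> w" if w: "w \<in> J \<times> U" "w \<in> ?M" for w
      proof -
        have gw: "g w = \<psi> w" using eq w by blast
        have "(\<psi> has_derivative frechet_derivative g (at w)) (at w within J \<times> U)"
          by (rule has_derivative_within_extension[OF N(1) _ w(1) eq Cinf_on_has_derivative[OF g N(1)]])
            (use w(2) in auto)
        from c_contact[OF w(1) this] have "?c w = c w"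
          using w(2) by (simp add: gw contact_form_def)
        then show ?thesis by (simp add: \<Psi>_def gw normal)
      qed
      moreover have "v \<in> ?M" using N(2) eq[OF v] False \<open>\<delta> > 0\<close> by simp
      ultimately show ?thesis using M by (intro exI[of _ ?M] exI[of _ ?k] conjI allI impI)
    qed
  qed
  moreover have "isotropic_on (J \<times> U) \<Psi>"
    unfolding isotropic_on_def
  proof
    fix v assume v: "v \<in> J \<times> U"
    from smooth_on_has_derivative[OF \<open>smooth_on (J \<times> U) \<Psi>\<close> v] obtain D\<Psi>
      where D\<Psi>: "(\<Psi> has_derivative D\<Psi>) (at v within J \<times> U)" by blast
    from smooth_on_has_derivative[OF smooth v] obtain D
      where D: "(\<psi> has_derivative D) (at v within J \<times> U)" by blast
    \<comment> \<open>Only the \<open>x\<close>- and \<open>z\<close>-components of a tangent vector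
      enter the contact form, so the derivative of the \<open>y\<close>-components is copied from
      \<open>D\<Psi>\<close>.\<close>
    let ?E = "\<lambda>u. (page l (fst v) (fst (D u)) + (fst u * ?x v $ l) *\<^sub>R page_normal l (fst v),
      fst (snd (D\<Psi> u)), snd (snd (D u)))"
    have "((\<lambda>v. (fst v, ?x v)) has_derivative (\<lambda>u. (fst u, fst (D u)))) (at v within J \<times> U)"
      by (intro has_derivative_Pair has_derivative_fst has_derivative_ident D)
    from has_derivative_compose[OF this has_derivative_page[of l]]
    have "((\<lambda>v. page l (fst v) (?x v)) has_derivative
        (\<lambda>u. page l (fst v) (fst (D u)) + (fst u * ?x v $ l) *\<^sub>R page_normal l (fst v))) (at v within J \<times> U)"
      by simp
    then have "((\<lambda>v. (page l (fst v) (?x v), fst (snd (\<Psi> v)), ?z v)) has_derivative ?E) (at v within J \<times> U)"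
      by (intro has_derivative_Pair has_derivative_fst has_derivative_snd D D\<Psi>)
    moreover have "(\<lambda>v. (page l (fst v) (?x v), fst (snd (\<Psi> v)), ?z v)) = \<Psi>"
      by (simp add: \<Psi>_def)
    ultimately have E: "(\<Psi> has_derivative ?E) (at v within J \<times> U)" by simp
    have "contact_form (\<Psi> v) (?E u) = 0" for u
    proof -
      \<comment> \<open>Page and normal are orthogonal, so the only new term is the product of the
        normal parts, and \<open>c\<close> was chosen to make it cancel.\<close>
      have "contact_form (\<Psi> v) (?E u) = contact_form (\<psi> v) (D u) - fst u * (?x v $ l * c v)"
        by (simp add: contact_form_def \<Psi>_def inner_add_left inner_add_right algebra_simps)
      moreover have "D u = fst u *\<^sub>R D (1, 0) + D (0, snd u)"
        using linear_add[OF has_derivative_linear[OF D], of "fst u *\<^sub>R (1, 0)" "(0, snd u)"]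
          linear_cmul[OF has_derivative_linear[OF D], of "fst u" "(1, 0)"] by simp
      moreover have "contact_form (\<psi> v) (D (0, snd u)) = 0"
        using chart_contact_fibre[OF chart, of "fst v" "snd v" D "snd u"] v D by (simp add: mem_Times_iff)
      ultimately show ?thesis
        by (simp add: linear_add[OF contact_form_linear] linear_cmul[OF contact_form_linear]
            c_contact[OF v D])
    qed
    then show "\<exists>D. (\<Psi> has_derivative D) (at v within J \<times> U) \<and> (\<forall>u. contact_form (\<Psi> v) (D u) = 0)"
      using E by blast
  qed
  moreover have "\<forall>\<theta>\<in>J. \<forall>q\<in>U. case (\<psi> (\<theta>, q), \<Psi> (\<theta>, q)) of ((x, y, z), (X, Y, Z)) \<Rightarrow>
      X = page l \<theta> x \<and> Z = z \<and> (\<forall>v. Y \<bullet> page l \<theta> v = y \<bullet> v)"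
    by (simp add: \<Psi>_def case_prod_unfold inner_add_left)
  ultimately have "spin_lift l J U \<psi> \<Psi>"
    unfolding spin_lift_def by blast
  moreover have "\<Psi> (\<theta>, q) = (page l \<theta> x, B (page l \<theta> x, \<eta>), F (page l \<theta> x, \<eta>))"
    if \<theta>: "\<theta> \<in> J" "q \<in> U" and x: "x \<in> halfspace l" and crit: "G (page l \<theta> x, \<eta>) = 0"
      and \<psi>: "\<psi> (\<theta>, q) = jet \<theta> x \<eta>" for \<theta> q x \<eta>
  proof -
    have v: "(\<theta>, q) \<in> J \<times> U" using \<theta> by simp
    \<comment> \<open>The chosen and the given \<eta> may differ. Near the binding both normal
      derivatives are 0; elsewhere both equal the same value of the contact form divided by
      \<open>x $ l\<close>.\<close>
    have "c (\<theta>, q) = B (page l \<theta> x, \<eta>) \<bullet> page_normal l \<theta>"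
    proof (cases "x $ l < \<delta>")
      case True
      then show ?thesis
        using c_near[OF v] normal_derivative_steady[OF steady[OF x crit True] x] \<psi> by simp
    next
      case False
      from smooth_on_has_derivative[OF smooth v] obtain D
        where D: "(\<psi> has_derivative D) (at (\<theta>, q) within J \<times> U)" by blast
      have "x $ l * c (\<theta>, q) = x $ l * (B (page l \<theta> x, \<eta>) \<bullet> page_normal l \<theta>)"
        using c_contact[OF v D] chart_contact_angle[OF chart \<theta> D x crit \<psi>] \<psi> by simp
      then show ?thesis using False \<open>\<delta> > 0\<close> by simp
    qed
    then have "page l \<theta> (unpage l \<theta> (B (page l \<theta> x, \<eta>))) + c (\<theta>, q) *\<^sub>R page_normal l \<theta> = B (page l \<theta> x, \<eta>)"
      by (intro page_eqI[of _ l \<theta>]) (auto simp: inner_add_left inner_unpage)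
    then show ?thesis using \<psi> by (simp add: \<Psi>_def)
  qed
  ultimately show ?thesis using that by blast
qed

text \<open>For the second inclusion: every point of the base lies on some page, a generated jet
  restricts there to a jet of \<open>\<Lambda> \<theta>\<close>, and the lift of a chart through the
  latter passes through the former.\<close>

lemma twist_spun_eq: "twist_spun l \<Lambda> = generated_legendrian UNIV F"
proof
  show "twist_spun l \<Lambda> \<subseteq> generated_legendrian UNIV F" by (rule twist_spun_subset)
  show "generated_legendrian UNIV F \<subseteq> twist_spun l \<Lambda>"
  proof
    fix p assume "p \<in> generated_legendrian UNIV F"
    then obtain X \<eta> where p: "p = (X, B (X, \<eta>), F (X, \<eta>))" and "G (X, \<eta>) = 0"
      unfolding generated_legendrian_def by blast
    obtain \<theta> where X: "X = page l \<theta> (unspin l X)" using page_unspin_ex by blast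
    let ?x = "unspin l X"
    have crit: "G (page l \<theta> ?x, \<eta>) = 0" using \<open>G (X, \<eta>) = 0\<close> X by simp
    from loop_chart_exists[OF legendrian_loop \<Lambda>_jetI[OF unspin_in_halfspace crit]]
    obtain U \<psi> q where chart: "loop_chart l \<Lambda> UNIV U \<psi>" and q: "q \<in> U" and \<psi>: "\<psi> (\<theta>, q) = jet \<theta> ?x \<eta>"
      by blast
    from spin_lift_exists[OF chart] obtain \<Psi> where lift: "spin_lift l UNIV U \<psi> \<Psi>"
      and "\<And>\<theta> q x \<eta>. \<theta> \<in> UNIV \<Longrightarrow> q \<in> U \<Longrightarrow> x \<in> halfspace l \<Longrightarrow> G (page l \<theta> x, \<eta>) = 0 \<Longrightarrow>
        \<psi> (\<theta>, q) = jet \<theta> x \<eta> \<Longrightarrow> \<Psi> (\<theta>, q) = (page l \<theta> x, B (page l \<theta> x, \<eta>), F (page l \<theta> x, \<eta>))" by blast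
    from this(2)[OF UNIV_I q unspin_in_halfspace crit \<psi>] have "\<Psi> (\<theta>, q) = p"
      using X p by simp
    then have "p \<in> \<Psi> ` (UNIV \<times> U)" using q by (intro image_eqI[of _ _ "(\<theta>, q)"]) auto
    then show "p \<in> twist_spun l \<Lambda>"
      unfolding twist_spun_def using chart lift by blast
  qed
qed

end

section \<open>Constant loops and the conclusion\<close>

lemma spinnable_family_loop_const:
  assumes "spinnable_family l f" "linear_at_infinity (halfspace l) f"
  shows "spinnable_family_loop l (\<lambda>\<theta>. f)"
  unfolding spinnable_family_loop_def
proof (intro conjI allI ballI)
  have "smooth_on (halfspace l \<times> UNIV) f"
    using assms(1) unfolding spinnable_family_def generating_family_def by blast
  from smooth_on_compose_snd[OF this]
  show "smooth_on (UNIV \<times> (halfspace l \<times> UNIV)) (\<lambda>(\<theta>, p). f p)"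
    by (simp add: case_prod_unfold)
  show "\<exists>A K. linear A \<and> A \<noteq> (\<lambda>\<eta>. 0) \<and> compact K \<and> K \<subseteq> halfspace l \<times> UNIV \<and>
      (\<forall>\<theta>. \<forall>x\<in>halfspace l. \<forall>\<eta>. (x, \<eta>) \<notin> K \<longrightarrow> f (x, \<eta>) = A \<eta>)"
    using assms(2) unfolding linear_at_infinity_def by simp
qed (use assms(1) in \<open>auto intro!: exI[of _ UNIV]\<close>)

lemma legendrian_loop_const:
  assumes "legendrian_submanifold l \<Lambda>" shows "legendrian_loop l (\<lambda>\<theta>. \<Lambda>)"
proof -
  have "diffeomorphism (UNIV \<times> \<Lambda>) (track (\<lambda>\<theta>. \<Lambda>)) (\<lambda>(\<theta>, p). (\<theta>, (\<lambda>\<theta> p. p) \<theta> p)) (\<lambda>v. v)"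
  proof (rule diffeomorphismI)
    show "smooth_on (UNIV \<times> \<Lambda>) (\<lambda>(\<theta>, p). (\<theta>, (\<lambda>\<theta> p. p) \<theta> p))"
      by (simp add: case_prod_unfold smooth_on_id)
  qed (auto simp: track_def smooth_on_id)
  then show ?thesis
    unfolding legendrian_loop_def
    using assms by (intro conjI allI refl exI[of _ "\<lambda>\<theta> p. p"] exI[of _ "\<lambda>v. v"]) auto
qed

theorem proposition3p2:
  fixes l :: "'n::finite"
  shows
    "(\<forall>(\<Lambda> :: 'n jet1 set) (f :: (real^'n) \<times> (real^'N::finite) \<Rightarrow> real).
        legendrian_submanifold l \<Lambda> \<and>
        spinnable_family l f \<and> linear_at_infinity (halfspace l) f \<and>
        \<Lambda> = generated_legendrian (halfspace l) f
        \<longrightarrow> (\<exists>F :: (real^('n option)) \<times> (real^'N) \<Rightarrow> real.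
              generating_family UNIV F \<and> linear_at_infinity UNIV F \<and>
              spun l \<Lambda> = generated_legendrian UNIV F))
     \<and>
     (\<forall>(\<Lambda> :: real \<Rightarrow> 'n jet1 set) (f :: real \<Rightarrow> (real^'n) \<times> (real^'N) \<Rightarrow> real).
        legendrian_loop l \<Lambda> \<and>
        spinnable_family_loop l f \<and>
        (\<forall>\<theta>. \<Lambda> \<theta> = generated_legendrian (halfspace l) (f \<theta>))
        \<longrightarrow> (\<exists>F :: (real^('n option)) \<times> (real^'N) \<Rightarrow> real.
              generating_family UNIV F \<and> linear_at_infinity UNIV F \<and>
              twist_spun l \<Lambda> = generated_legendrian UNIV F))"
proof -
  \<comment> \<open>Constant loops reduce the spun case to the twisted one, so only this statement
    needs the geometric argument.\<close>
  have twist: "\<exists>F :: (real^('n option)) \<times> (real^'N) \<Rightarrow> real.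
      generating_family UNIV F \<and> linear_at_infinity UNIV F \<and>
      twist_spun l \<Lambda> = generated_legendrian UNIV F"
    if "legendrian_loop l \<Lambda>" "spinnable_family_loop l f"
      "\<forall>\<theta>. \<Lambda> \<theta> = generated_legendrian (halfspace l) (f \<theta>)"
    for \<Lambda> :: "real \<Rightarrow> 'n jet1 set" and f :: "real \<Rightarrow> (real^'n) \<times> (real^'N) \<Rightarrow> real"
  proof -
    interpret generated_loop l f \<Lambda>
      by unfold_locales (use that in auto)
    show ?thesis
      using generating_F linear_at_infinity_F twist_spun_eq by blast
  qed
  show ?thesis
  proof (intro conjI allI impI)
    fix \<Lambda> :: "'n jet1 set" and f :: "(real^'n) \<times> (real^'N) \<Rightarrow> real"
    assume "legendrian_submanifold l \<Lambda> \<and> spinnable_family l f \<and> linear_at_infinity (halfspace l) f \<and>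
      \<Lambda> = generated_legendrian (halfspace l) f"
    then show "\<exists>F :: (real^('n option)) \<times> (real^'N) \<Rightarrow> real.
        generating_family UNIV F \<and> linear_at_infinity UNIV F \<and> spun l \<Lambda> = generated_legendrian UNIV F"
      unfolding spun_def
      by (intro twist[of "\<lambda>\<theta>. \<Lambda>" "\<lambda>\<theta>. f"] legendrian_loop_const spinnable_family_loop_const) auto
  qed (use twist in blast)
qed

end
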